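(* There is an algorithm which, given a bipartite graph $G=(V^+,V^-;E)$ with $|V^+|\le|V^-|=n$ and $|E|=m$, finds in $O(nm)$ time an edge set $F\subseteq(V^+\times V^-)\setminus E$ such that: - $G+F$ is DM-irreducible, and - $|F|$ is the minimum possible among all such edge sets.
   Context: A bipartite graph $G=(V^+,V^-;E)$ has finite disjoint vertex sides $V^+,V^-$, and its edge set satisfies $E\subseteq V^+\times V^-$. For $X\subseteq V^+$, $\Gamma_G(X)$ is the set of vertices of $V^-$ adjacent to some vertex of $X$. DM-decomposition. Define $f_G(X)=|\Gamma_G(X)|-|X|$ for $X\subseteq V^+$. Its minimizers form a lattice under union and intersection. Take a maximal chain $X_0\subsetneq\cdots\subsetneq X_k$ of minimizers and set: - $V_0=X_0\cup\Gamma_G(X_0)$; - $V_i=(X_i\setminus X_{i-1})\cup(\Gamma_G(X_i)\setminus\Gamma_G(X_{i-1}))$ for $i=1,\dots,k$; - $V_\infty=(V^+\setminus X_k)\cup(V^-\setminus\Gamma_G(X_k))$. This partition of $V=V^+\cup V^-$ is independent of the chain. $G$ is DM-irreducible if exactly one part is nonempty, i.e. $V_0=V$, or $V_1=V$, or $V_\infty=V$. $G+F$ denotes $(V^+,V^-;E\cup F)$. *)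

theory Defs
  imports Main
begin

section \<open>Bipartite graphs and the Dulmage-Mendelsohn decomposition\<close>

record 'v bigraph =
  vplus :: "'v set"
  vminus :: "'v set"
  edges :: "('v \<times> 'v) set"

definition bipartite_graph :: "'v bigraph \<Rightarrow> bool" where
  "bipartite_graph G \<longleftrightarrow>
     finite (vplus G) \<and> finite (vminus G) \<and> vplus G \<inter> vminus G = {} \<and>
     edges G \<subseteq> vplus G \<times> vminus G"

abbreviation verts :: "'v bigraph \<Rightarrow> 'v set" where
  "verts G \<equiv> vplus G \<union> vminus G"

definition add_edges :: "'v bigraph \<Rightarrow> ('v \<times> 'v) set \<Rightarrow> 'v bigraph" where
  "add_edges G F = G\<lparr>edges := edges G \<union> F\<rparr>"

definition nbhd :: "'v bigraph \<Rightarrow> 'v set \<Rightarrow> 'v set" where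
  "nbhd G X = {v \<in> vminus G. \<exists>u\<in>X. (u, v) \<in> edges G}"

definition surplus :: "'v bigraph \<Rightarrow> 'v set \<Rightarrow> int" where
  "surplus G X = int (card (nbhd G X)) - int (card X)"

definition minimizers :: "'v bigraph \<Rightarrow> 'v set set" where
  "minimizers G = {X. X \<subseteq> vplus G \<and> (\<forall>Y. Y \<subseteq> vplus G \<longrightarrow> surplus G X \<le> surplus G Y)}"

text \<open>The list \<open>[X\<^sub>0, \<dots>, X\<^sub>k]\<close> enumerates a maximal chain of minimizers in increasing order.\<close>

definition dm_chain :: "'v bigraph \<Rightarrow> 'v set list \<Rightarrow> bool" where
  "dm_chain G Xs \<longleftrightarrow> sorted_wrt (\<subset>) Xs \<and> subset.maxchain (minimizers G) (set Xs)"

definition dm_first :: "'v bigraph \<Rightarrow> 'v set list \<Rightarrow> 'v set" where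
  "dm_first G Xs = Xs ! 0 \<union> nbhd G (Xs ! 0)"

definition dm_part :: "'v bigraph \<Rightarrow> 'v set list \<Rightarrow> nat \<Rightarrow> 'v set" where
  "dm_part G Xs i =
     (Xs ! i - Xs ! (i - 1)) \<union> (nbhd G (Xs ! i) - nbhd G (Xs ! (i - 1)))"

definition dm_infinity :: "'v bigraph \<Rightarrow> 'v set list \<Rightarrow> 'v set" where
  "dm_infinity G Xs = (vplus G - last Xs) \<union> (vminus G - nbhd G (last Xs))"

text \<open>
  The partition does not depend on the chain, so it is immaterial whether the chain is quantified
  existentially or universally.  The part \<open>V\<^sub>1\<close> exists only if \<open>k \<ge> 1\<close>.  The graph without
  vertices is DM-irreducible under this definition.
\<close>

definition DM_irreducible :: "'v bigraph \<Rightarrow> bool" where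
  "DM_irreducible G \<longleftrightarrow>
     (\<exists>Xs. dm_chain G Xs \<and>
        (dm_first G Xs = verts G \<or>
         (1 < length Xs \<and> dm_part G Xs 1 = verts G) \<or>
         dm_infinity G Xs = verts G))"

definition DM_augmentation :: "'v bigraph \<Rightarrow> ('v \<times> 'v) set \<Rightarrow> bool" where
  "DM_augmentation G F \<longleftrightarrow>
     F \<subseteq> (vplus G \<times> vminus G) - edges G \<and> DM_irreducible (add_edges G F)"

definition min_DM_augmentation :: "'v bigraph \<Rightarrow> ('v \<times> 'v) set \<Rightarrow> bool" where
  "min_DM_augmentation G F \<longleftrightarrow>
     DM_augmentation G F \<and> (\<forall>F'. DM_augmentation G F' \<longrightarrow> card F \<le> card F')"


section \<open>Word-RAM programs and their running time\<close>

text \<open>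
  Algorithms are programs of a structured word-RAM language.  The random access memory is divided
  into segments (arrays), of which a given program can address only finitely many; cell \<open>0\<close>
  of a segment serves as a scalar variable.  Every operation costs one unit of time.  To exclude
  packing unbounded information into one cell, the semantics is parameterised by the largest
  representable number \<open>W\<close>: a program whose computation produces a larger number (as a
  value or as an address) is stuck, that is, has no execution.  Subtraction is truncated at 0.
\<close>

type_synonym vname = string
type_synonym state = "vname \<Rightarrow> nat \<Rightarrow> nat"

datatype aexp =
    Num nat
  | Cell vname aexp
  | Add aexp aexp
  | Sub aexp aexp
  | Mul aexp aexp

datatype bexp =
    Less aexp aexp
  | Equal aexp aexp
  | Not bexp
  | And bexp bexp

datatype com =
    Skip
  | Assign vname aexp aexp
  | Seq com com
  | If bexp com com
  | While bexp com

primrec aval :: "aexp \<Rightarrow> state \<Rightarrow> nat" where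
  "aval (Num k) s = k"
| "aval (Cell x e) s = s x (aval e s)"
| "aval (Add e1 e2) s = aval e1 s + aval e2 s"
| "aval (Sub e1 e2) s = aval e1 s - aval e2 s"
| "aval (Mul e1 e2) s = aval e1 s * aval e2 s"

primrec bval :: "bexp \<Rightarrow> state \<Rightarrow> bool" where
  "bval (Less e1 e2) s \<longleftrightarrow> aval e1 s < aval e2 s"
| "bval (Equal e1 e2) s \<longleftrightarrow> aval e1 s = aval e2 s"
| "bval (Not b) s \<longleftrightarrow> \<not> bval b s"
| "bval (And b1 b2) s \<longleftrightarrow> bval b1 s \<and> bval b2 s"

text \<open>All values arising in the evaluation of an expression, including addresses, are at most
  \<open>W\<close>.\<close>

primrec afits :: "nat \<Rightarrow> aexp \<Rightarrow> state \<Rightarrow> bool" where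
  "afits W (Num k) s \<longleftrightarrow> aval (Num k) s \<le> W"
| "afits W (Cell x e) s \<longleftrightarrow> afits W e s \<and> aval (Cell x e) s \<le> W"
| "afits W (Add e1 e2) s \<longleftrightarrow> afits W e1 s \<and> afits W e2 s \<and> aval (Add e1 e2) s \<le> W"
| "afits W (Sub e1 e2) s \<longleftrightarrow> afits W e1 s \<and> afits W e2 s \<and> aval (Sub e1 e2) s \<le> W"
| "afits W (Mul e1 e2) s \<longleftrightarrow> afits W e1 s \<and> afits W e2 s \<and> aval (Mul e1 e2) s \<le> W"

primrec bfits :: "nat \<Rightarrow> bexp \<Rightarrow> state \<Rightarrow> bool" where
  "bfits W (Less e1 e2) s \<longleftrightarrow> afits W e1 s \<and> afits W e2 s"
| "bfits W (Equal e1 e2) s \<longleftrightarrow> afits W e1 s \<and> afits W e2 s"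
| "bfits W (Not b) s \<longleftrightarrow> bfits W b s"
| "bfits W (And b1 b2) s \<longleftrightarrow> bfits W b1 s \<and> bfits W b2 s"

primrec acost :: "aexp \<Rightarrow> nat" where
  "acost (Num k) = 1"
| "acost (Cell x e) = 1 + acost e"
| "acost (Add e1 e2) = 1 + acost e1 + acost e2"
| "acost (Sub e1 e2) = 1 + acost e1 + acost e2"
| "acost (Mul e1 e2) = 1 + acost e1 + acost e2"

primrec bcost :: "bexp \<Rightarrow> nat" where
  "bcost (Less e1 e2) = 1 + acost e1 + acost e2"
| "bcost (Equal e1 e2) = 1 + acost e1 + acost e2"
| "bcost (Not b) = 1 + bcost b"
| "bcost (And b1 b2) = 1 + bcost b1 + bcost b2"

text \<open>\<open>exec W c s t s'\<close>: on words bounded by \<open>W\<close>, program \<open>c\<close> started in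
  \<open>s\<close> halts in \<open>s'\<close> after exactly \<open>t\<close> time units.\<close>

inductive exec :: "nat \<Rightarrow> com \<Rightarrow> state \<Rightarrow> nat \<Rightarrow> state \<Rightarrow> bool" for W :: nat where
  exec_Skip: "exec W Skip s 1 s"
| exec_Assign: "\<lbrakk>afits W i s; afits W e s\<rbrakk> \<Longrightarrow>
    exec W (Assign x i e) s (1 + acost i + acost e) (s(x := (s x)(aval i s := aval e s)))"
| exec_Seq: "\<lbrakk>exec W c1 s t1 s1; exec W c2 s1 t2 s2\<rbrakk> \<Longrightarrow> exec W (Seq c1 c2) s (t1 + t2) s2"
| exec_IfTrue: "\<lbrakk>bfits W b s; bval b s; exec W c1 s t s'\<rbrakk> \<Longrightarrow>
    exec W (If b c1 c2) s (1 + bcost b + t) s'"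
| exec_IfFalse: "\<lbrakk>bfits W b s; \<not> bval b s; exec W c2 s t s'\<rbrakk> \<Longrightarrow>
    exec W (If b c1 c2) s (1 + bcost b + t) s'"
| exec_WhileFalse: "\<lbrakk>bfits W b s; \<not> bval b s\<rbrakk> \<Longrightarrow> exec W (While b c) s (1 + bcost b) s"
| exec_WhileTrue: "\<lbrakk>bfits W b s; bval b s; exec W c s t1 s1; exec W (While b c) s1 t2 s2\<rbrakk> \<Longrightarrow>
    exec W (While b c) s (1 + bcost b + t1 + t2) s2"

inductive_cases exec_SkipE: "exec W Skip s t s'"
inductive_cases exec_AssignE: "exec W (Assign x i e) s t s'"
inductive_cases exec_SeqE: "exec W (Seq c1 c2) s t s'"
inductive_cases exec_IfE: "exec W (If b c1 c2) s t s'"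
inductive_cases exec_WhileE: "exec W (While b c) s t s'"

lemma exec_deterministic:
  "exec W c s t s' \<Longrightarrow> exec W c s u s'' \<Longrightarrow> t = u \<and> s' = s''"
proof (induction arbitrary: u s'' rule: exec.induct)
  case (exec_Skip s)
  then show ?case by (auto elim: exec_SkipE)
next
  case (exec_Assign i s e x)
  from exec_Assign.prems show ?case by (rule exec_AssignE) simp
next
  case (exec_Seq c1 s t1 s1 c2 t2 s2)
  from exec_Seq.prems show ?case by (rule exec_SeqE) (auto dest!: exec_Seq.IH)
next
  case (exec_IfTrue b s c1 t s' c2)
  from exec_IfTrue.prems exec_IfTrue.hyps show ?case
    by (elim exec_IfE) (auto dest!: exec_IfTrue.IH)
next
  case (exec_IfFalse b s c2 t s' c1)
  from exec_IfFalse.prems exec_IfFalse.hyps show ?case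
    by (elim exec_IfE) (auto dest!: exec_IfFalse.IH)
next
  case (exec_WhileFalse b s c)
  from exec_WhileFalse.prems show ?case
    by (rule exec_WhileE) (use exec_WhileFalse.hyps(2) in simp_all)
next
  case (exec_WhileTrue b s c t1 s1 t2 s2)
  from exec_WhileTrue.prems show ?case
  proof (rule exec_WhileE)
    fix u1 r u2
    assume u: "u = Suc (bcost b + u1 + u2)" and c: "exec W c s u1 r"
      and w: "exec W (While b c) r u2 s''"
    have "t1 = u1 \<and> s1 = r" using c by (rule exec_WhileTrue.IH(1))
    moreover from this w have "exec W (While b c) s1 u2 s''" by simp
    then have "t2 = u2 \<and> s2 = s''" by (rule exec_WhileTrue.IH(2))
    ultimately show ?thesis using u by simp
  qed (use exec_WhileTrue.hyps(2) in simp)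
qed


section \<open>Encoding of inputs and outputs\<close>

text \<open>
  Vertices are named by consecutive numbers: \<open>V\<^sup>+ = {0..<p}\<close> and
  \<open>V\<^sup>- = {p..<p + n}\<close>.  Every finite bipartite graph is of this form up to renaming.
\<close>

definition numbered :: "nat bigraph \<Rightarrow> bool" where
  "numbered G \<longleftrightarrow>
     vplus G = {0..<card (vplus G)} \<and>
     vminus G = {card (vplus G)..<card (vplus G) + card (vminus G)}"

text \<open>The edges are given as an array of pairs in an arbitrary order \<open>es\<close>; all memory not
  occupied by the input is 0.\<close>

definition input_state :: "nat bigraph \<Rightarrow> (nat \<times> nat) list \<Rightarrow> state" where
  "input_state G es = (\<lambda>_ _. 0)
     (''p'' := (\<lambda>_. 0)(0 := card (vplus G)),
      ''n'' := (\<lambda>_. 0)(0 := card (vminus G)),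
      ''m'' := (\<lambda>_. 0)(0 := length es),
      ''tail'' := (\<lambda>i. if i < length es then fst (es ! i) else 0),
      ''head'' := (\<lambda>i. if i < length es then snd (es ! i) else 0))"

definition output_edges :: "state \<Rightarrow> (nat \<times> nat) set" where
  "output_edges s = {(s ''F_tail'' i, s ''F_head'' i) | i. i < s ''F_size'' 0}"

end

theory Submission
  imports Defs
begin

text \<open>
  Call a set \<open>I\<close> of vertices on one side independent if \<open>|\<Gamma>(Y)| > |Y|\<close> for all nonempty \<open>Y \<subseteq> I\<close>;
  these are the independent sets of a matroid.  If \<open>G + F\<close> is DM-irreducible and \<open>F \<noteq> {}\<close>, \<open>n \<ge> 2\<close>, then the
  vertices not touched by \<open>F\<close> form an independent set, and isolated vertices are touched at least
  twice, so that \<open>|F|\<close> is at least the corank of either side (of \<open>V\<^sup>+\<close> if \<open>|V\<^sup>+| < |V\<^sup>-|\<close>) plus the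
  number of its isolated vertices.

  The algorithm attains this bound.  It makes \<open>O(n)\<close> searches of time \<open>O(m + 1)\<close> each.
  It first builds maximal independent sets on both sides greedily, together with a matching
  covering them: \<open>r\<close> can be added to \<open>I\<close> if and only if, once \<open>I\<close> and \<open>r\<close> are matched, a second
  alternating search from \<open>r\<close> escapes.  The matching is then made maximum, and the exposed
  vertices are paired off arbitrarily by new edges.  Contracting the resulting matching gives a
  digraph in which every closed set contains a vertex outside the independent sets.  If
  \<open>|V\<^sup>+| < |V\<^sup>-|\<close>, joining the remaining such vertices of \<open>V\<^sup>+\<close> to one exposed vertex destroys all
  closed sets.  If \<open>|V\<^sup>+| = |V\<^sup>-|\<close>, the digraph is made strongly connected as in the algorithm of
  Eswaran and Tarjan, by chaining source-sink pairs into a cycle and attaching the rest to it; the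
  edge closing the cycle is omitted if it is redundant, which is the case if \<open>G\<close> is DM-irreducible.

  The new edges need not be tested against \<open>E\<close>: an edge of \<open>F\<close> lying in \<open>E\<close> could be dropped,
  contradicting the lower bound.
\<close>

section \<open>Independent sets and the lower bound\<close>

text \<open>The two bounds meet because of how exposed vertices are charged. A pairing edge takes
  its endpoint off the list of vertices that still need an edge, unless the endpoint is isolated; it
  then stays on the list and is served again, which is the second touch demanded by the lower bound.
  Hence on each side exposed plus remaining vertices equals corank plus isolated vertices. In the
  balanced case both sides have equally many exposed vertices, so exposed plus the larger remainder
  meets the bound of the worse side. There the lower bound is false for \<open>F = {}\<close> and
  may fail for \<open>n = 1\<close>; the first case forces the closing edge to be omitted whenever
  it is redundant, and in the second only one edge is possible.

  The time bound forbids a search to touch all vertices: visited marks are time stamps, and work is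
  charged only to vertices with at least one edge. Correctness is proved for unbounded words. Since
  the program never multiplies and never adds anything but 1, the word size follows from a bound on
  the growth of stored values.\<close>

definition nbrs :: "('a \<Rightarrow> 'b set) \<Rightarrow> 'a set \<Rightarrow> 'b set" where
  "nbrs N X = \<Union> (N ` X)"

definition hindep :: "('a \<Rightarrow> 'b set) \<Rightarrow> 'a set \<Rightarrow> bool" where
  "hindep N I \<longleftrightarrow> (\<forall>Y\<subseteq>I. Y \<noteq> {} \<longrightarrow> card Y < card (nbrs N Y))"

lemma nbrs_Un: "nbrs N (X \<union> Y) = nbrs N X \<union> nbrs N Y"
  unfolding nbrs_def by blast

lemma nbrs_mono: "X \<subseteq> Y \<Longrightarrow> nbrs N X \<subseteq> nbrs N Y"
  unfolding nbrs_def by blast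

lemma hindepD: "hindep N I \<Longrightarrow> Y \<subseteq> I \<Longrightarrow> Y \<noteq> {} \<Longrightarrow> card Y < card (nbrs N Y)"
  unfolding hindep_def by blast

lemma hindep_nonempty:
  assumes "hindep N I" "x \<in> I"
  shows "N x \<noteq> {}"
  using hindepD[OF assms(1), of "{x}"] assms(2) unfolding nbrs_def by auto

text \<open>\<open>cert\<close> expresses inclusion-maximality, with a witness for each rejected
  vertex. That such a set has maximum cardinality, as the lower bound requires, is proved directly
  by a rank formula instead of through the matroid axioms.\<close>

locale maximal_hindep =
  fixes N :: "'a \<Rightarrow> 'b set" and S I :: "'a set"
  assumes fin: "finite S" "\<And>x. x \<in> S \<Longrightarrow> finite (N x)"
    and I: "I \<subseteq> S" "hindep N I"
    and cert: "\<And>r. r \<in> S - I \<Longrightarrow> \<exists>X\<subseteq>insert r I. r \<in> X \<and> card (nbrs N X) \<le> card X"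
begin

text \<open>Equality in the strict Hall condition. A tight \<open>Y\<close> blocks every further
  vertex whose neighbours all lie in \<open>nbrs N Y\<close>.\<close>

definition tight :: "'a set \<Rightarrow> bool" where
  "tight Y \<longleftrightarrow> Y \<subseteq> I \<and> Y \<noteq> {} \<and> card (nbrs N Y) = Suc (card Y)"

lemma finI: "Y \<subseteq> I \<Longrightarrow> finite Y"
  by (rule finite_subset[OF _ finite_subset[OF I(1) fin(1)]])

lemma fin_nbrs: "Y \<subseteq> S \<Longrightarrow> finite (nbrs N Y)"
  unfolding nbrs_def using fin finite_subset[of Y S] by auto

text \<open>Submodularity of \<open>card (nbrs N Y)\<close>: the common neighbours outnumber
  \<open>Y1 \<inter> Y2\<close>, by independence if that intersection is nonempty and by the assumed
  shared neighbour if it is empty.\<close>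

lemma tight_union:
  assumes "tight Y1" "tight Y2" "nbrs N Y1 \<inter> nbrs N Y2 \<noteq> {}"
  shows "tight (Y1 \<union> Y2)"
proof -
  have YI: "Y1 \<subseteq> I" "Y2 \<subseteq> I" using assms(1,2) unfolding tight_def by blast+
  note Y = YI finI[OF YI(1)] finI[OF YI(2)]
  note f = fin_nbrs[OF subset_trans[OF YI(1) I(1)]] fin_nbrs[OF subset_trans[OF YI(2) I(1)]]
  have "Suc (card (Y1 \<inter> Y2)) \<le> card (nbrs N Y1 \<inter> nbrs N Y2)"
  proof (cases "Y1 \<inter> Y2 = {}")
    case True
    then show ?thesis using assms(3) f(1) by (simp add: Suc_le_eq card_gt_0_iff)
  next
    case False
    have "Y1 \<inter> Y2 \<subseteq> I" using YI by blast
    then have "card (Y1 \<inter> Y2) < card (nbrs N (Y1 \<inter> Y2))" using False by (rule hindepD[OF I(2)])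
    also have "nbrs N (Y1 \<inter> Y2) \<subseteq> nbrs N Y1 \<inter> nbrs N Y2" unfolding nbrs_def by blast
    then have "card (nbrs N (Y1 \<inter> Y2)) \<le> card (nbrs N Y1 \<inter> nbrs N Y2)"
      using f(1) by (intro card_mono) simp
    finally show ?thesis by simp
  qed
  moreover have "card (nbrs N Y1) + card (nbrs N Y2) =
      card (nbrs N (Y1 \<union> Y2)) + card (nbrs N Y1 \<inter> nbrs N Y2)"
    using card_Un_Int[OF f] by (simp add: nbrs_Un)
  moreover have "card Y1 + card Y2 = card (Y1 \<union> Y2) + card (Y1 \<inter> Y2)"
    using card_Un_Int[OF Y(3,4)] .
  ultimately have "card (nbrs N (Y1 \<union> Y2)) \<le> Suc (card (Y1 \<union> Y2))"
    using assms(1,2) unfolding tight_def by simp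
  moreover have ne: "Y1 \<union> Y2 \<noteq> {}" using assms(1) unfolding tight_def by blast
  moreover have sub: "Y1 \<union> Y2 \<subseteq> I" using YI by blast
  moreover have "card (Y1 \<union> Y2) < card (nbrs N (Y1 \<union> Y2))" by (rule hindepD[OF I(2) sub ne])
  ultimately show ?thesis unfolding tight_def by simp
qed

text \<open>The sets \<open>K y\<close> are the blocks of the partition of the vertices \<open>y\<close> in the rank formula.\<close>

definition U :: "'b \<Rightarrow> 'a set" where
  "U y = \<Union> {Y. tight Y \<and> y \<in> nbrs N Y}"

definition K :: "'b \<Rightarrow> 'b set" where
  "K y = insert y (nbrs N (U y))"

lemma tight_Union:
  assumes "finite \<F>" "\<F> \<noteq> {}" "\<forall>Y\<in>\<F>. tight Y \<and> y \<in> nbrs N Y"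
  shows "tight (\<Union>\<F>) \<and> y \<in> nbrs N (\<Union>\<F>)"
  using assms
proof (induction \<F> rule: finite_ne_induct)
  case (insert Y \<F>)
  then have "tight (\<Union>\<F>)" "y \<in> nbrs N (\<Union>\<F>)" "tight Y" "y \<in> nbrs N Y" by auto
  then have "tight (Y \<union> \<Union>\<F>)" by (intro tight_union) auto
  then show ?case using \<open>y \<in> nbrs N Y\<close> by (simp add: nbrs_Un)
qed simp

lemma U_I: "U y \<subseteq> I"
  unfolding U_def tight_def by blast

lemma tight_U:
  assumes "tight Y" "y \<in> nbrs N Y"
  shows "tight (U y)" "y \<in> nbrs N (U y)" "Y \<subseteq> U y"
proof -
  have "{Y. tight Y \<and> y \<in> nbrs N Y} \<subseteq> Pow I" unfolding tight_def by blast
  then have "finite {Y. tight Y \<and> y \<in> nbrs N Y}" using finI[of I] by (simp add: finite_subset)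
  then have "tight (U y) \<and> y \<in> nbrs N (U y)"
    unfolding U_def using assms by (intro tight_Union) auto
  then show "tight (U y)" "y \<in> nbrs N (U y)" by auto
  show "Y \<subseteq> U y" unfolding U_def using assms by blast
qed

lemma U_empty: "\<not> (\<exists>Y. tight Y \<and> y \<in> nbrs N Y) \<Longrightarrow> U y = {}"
  unfolding U_def by blast

text \<open>A vertex covered by no tight set forms a singleton block with \<open>U y = {}\<close>,
  and the same formula holds for it.\<close>

lemma card_K: "card (K y) = Suc (card (U y))"
proof (cases "\<exists>Y. tight Y \<and> y \<in> nbrs N Y")
  case True
  then have "tight (U y)" "y \<in> nbrs N (U y)" using tight_U by auto
  then show ?thesis unfolding K_def tight_def by (simp add: insert_absorb)
next
  case False
  then show ?thesis unfolding K_def using U_empty[OF False] by (simp add: nbrs_def)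
qed

lemma finite_K: "finite (K y)"
  unfolding K_def using fin_nbrs[OF subset_trans[OF U_I I(1)]] by simp

text \<open>The blocks partition the vertices \<open>y\<close>: each of \<open>U y\<close> and
  \<open>U z\<close> is a tight set covering the other's vertex, so each contains the other.\<close>

lemma K_eq:
  assumes "z \<in> K y"
  shows "K z = K y"
proof (cases "z = y")
  case False
  then have z: "z \<in> nbrs N (U y)" using assms unfolding K_def by blast
  have "\<exists>Y. tight Y \<and> y \<in> nbrs N Y"
  proof (rule ccontr)
    assume "\<not> ?thesis"
    then show False using z U_empty unfolding nbrs_def by auto
  qed
  then have y: "tight (U y)" "y \<in> nbrs N (U y)" using tight_U by auto
  have 1: "U y \<subseteq> U z" by (rule tight_U(3)[OF y(1) z])
  have "tight (U z)" by (rule tight_U(1)[OF y(1) z])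
  moreover have "y \<in> nbrs N (U z)" using nbrs_mono[OF 1, of N] y(2) by blast
  ultimately have "U z \<subseteq> U y" by (rule tight_U(3))
  with 1 have "U z = U y" by blast
  then show ?thesis unfolding K_def using z y(2) by auto
qed simp

text \<open>Counting over the blocks. An independent set has at most \<open>card k - 1\<close>
  elements with neighbourhood inside a block \<open>k\<close>, and \<open>I\<close> has at least
  that many, namely those of \<open>U y\<close>. All other elements of \<open>B\<close> already
  belong to \<open>I\<close>.\<close>

lemma card_le:
  assumes B: "B \<subseteq> S" "hindep N B"
  shows "card B \<le> card I"
proof -
  \<comment> \<open>The nonempty neighbourhood makes the classes of different blocks
    disjoint.\<close>
  define C where "C k = {x \<in> S. N x \<noteq> {} \<and> N x \<subseteq> k}" for k
  let ?P = "K ` nbrs N S"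
  let ?W = "\<Union>k\<in>?P. C k"
  have finP: "finite ?P" using fin_nbrs by simp
  have finB: "finite B" by (rule finite_subset[OF B(1) fin(1)])
  have disj: "C k \<inter> C k' = {}" if k: "k \<in> ?P" "k' \<in> ?P" "k \<noteq> k'" for k k'
  proof (rule ccontr)
    assume "C k \<inter> C k' \<noteq> {}"
    then obtain x y where y: "y \<in> N x" "N x \<subseteq> k" "N x \<subseteq> k'" unfolding C_def by blast
    obtain a where a: "k = K a" using k(1) by (rule imageE)
    obtain a' where a': "k' = K a'" using k(2) by (rule imageE)
    have "y \<in> K a" "y \<in> K a'" using y a a' by auto
    then have "K a = K a'" using K_eq[of y a] K_eq[of y a'] by simp
    then show False using k(3) a a' by simp
  qed
  have part: "card (Z \<inter> ?W) = (\<Sum>k\<in>?P. card (Z \<inter> C k))" if "finite Z" for Z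
  proof -
    have "Z \<inter> ?W = (\<Union>k\<in>?P. Z \<inter> C k)" by (rule Int_UN_distrib)
    moreover have "card (\<Union>k\<in>?P. Z \<inter> C k) = (\<Sum>k\<in>?P. card (Z \<inter> C k))"
    proof (rule card_UN_disjoint[OF finP])
      show "\<forall>k\<in>?P. finite (Z \<inter> C k)" using that by simp
      show "\<forall>k\<in>?P. \<forall>k'\<in>?P. k \<noteq> k' \<longrightarrow> Z \<inter> C k \<inter> (Z \<inter> C k') = {}"
      proof (intro ballI impI)
        fix k k' assume "k \<in> ?P" "k' \<in> ?P" "k \<noteq> k'"
        then have "C k \<inter> C k' = {}" by (rule disj)
        then show "Z \<inter> C k \<inter> (Z \<inter> C k') = {}" by blast
      qed
    qed
    ultimately show ?thesis by simp
  qed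
  have le: "card (B \<inter> C k) \<le> card (I \<inter> C k)" if k: "k \<in> ?P" for k
  proof (cases "B \<inter> C k = {}")
    case False
    obtain y where y: "k = K y" using k by (rule imageE)
    have "card (B \<inter> C k) < card (nbrs N (B \<inter> C k))"
      by (rule hindepD[OF B(2) _ False]) simp
    also have "\<dots> \<le> card k"
    proof (rule card_mono)
      show "finite k" using finite_K y by simp
      show "nbrs N (B \<inter> C k) \<subseteq> k" unfolding nbrs_def C_def by blast
    qed
    also have "\<dots> = Suc (card (U y))" using card_K y by simp
    finally have "card (B \<inter> C k) \<le> card (U y)" by simp
    also have "U y \<subseteq> I \<inter> C k"
    proof
      fix x assume x: "x \<in> U y"
      then have "x \<in> I" using U_I by blast
      moreover from this have "N x \<noteq> {}" by (rule hindep_nonempty[OF I(2)])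
      moreover have "N x \<subseteq> K y" using x unfolding K_def nbrs_def by blast
      ultimately show "x \<in> I \<inter> C k" using y I(1) unfolding C_def by blast
    qed
    then have "card (U y) \<le> card (I \<inter> C k)" using finI[of "I \<inter> C k"] by (intro card_mono) simp_all
    finally show ?thesis .
  qed simp
  \<comment> \<open>By its certificate, a vertex of \<open>B\<close> outside \<open>I\<close> has
    all its neighbours in a single block and so belongs to some \<open>C k\<close>.\<close>
  have out: "B - ?W \<subseteq> I - ?W"
  proof
    fix b assume b: "b \<in> B - ?W"
    show "b \<in> I - ?W"
    proof (rule ccontr)
      assume "b \<notin> I - ?W"
      moreover have "b \<in> S" using b B(1) by auto
      ultimately have bI: "b \<in> S - I" using b by simp
      obtain y where y: "y \<in> N b" using hindep_nonempty[OF B(2), of b] b by auto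
      obtain X where X: "X \<subseteq> insert b I" "b \<in> X" "card (nbrs N X) \<le> card X"
        using cert[OF bI] by blast
      have finX: "finite X" using finite_subset[OF X(1)] finI[of I] by simp
      let ?Y = "X - {b}"
      have YI: "?Y \<subseteq> I" using X(1) by blast
      have cX: "card X = Suc (card ?Y)" using finX X(2) by (rule card.remove)
      have XS: "X \<subseteq> S" using X(1) I(1) bI by blast
      have NX: "nbrs N X = nbrs N ?Y \<union> N b" using X(2) unfolding nbrs_def by blast
      have "N b \<subseteq> K y"
      proof (cases "?Y = {}")
        case True
        have "card (nbrs N X) \<le> 1" using X(3) cX unfolding True by simp
        moreover have "nbrs N X = N b" unfolding NX True by (simp add: nbrs_def)
        ultimately have "\<forall>z\<in>N b. z = y" using y fin(2)[of b] bI by (simp add: card_le_Suc0_iff_eq)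
        then show ?thesis unfolding K_def by blast
      next
        case False
        \<comment> \<open>Independence of \<open>?Y\<close> and deficiency of \<open>X\<close> leave
          no slack: \<open>?Y\<close> is tight and \<open>b\<close> contributes no new
          neighbour.\<close>
        have "card ?Y < card (nbrs N ?Y)" by (rule hindepD[OF I(2) YI False])
        moreover have "nbrs N ?Y \<subseteq> nbrs N X" by (rule nbrs_mono) blast
        moreover from this have "card (nbrs N ?Y) \<le> card (nbrs N X)"
          using fin_nbrs[OF XS] by (rule card_mono[rotated])
        ultimately have eq: "nbrs N ?Y = nbrs N X" "card (nbrs N ?Y) = Suc (card ?Y)"
          using X(3) cX card_seteq[OF fin_nbrs[OF XS]] by simp_all
        then have "tight ?Y" using YI False unfolding tight_def by blast
        moreover have "y \<in> nbrs N ?Y" using y NX eq(1) by blast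
        ultimately have "nbrs N ?Y \<subseteq> nbrs N (U y)" by (intro nbrs_mono tight_U(3))
        then show ?thesis using NX eq(1) unfolding K_def by blast
      qed
      moreover have "y \<in> nbrs N S" using y bI unfolding nbrs_def by blast
      moreover from this have "K y \<in> ?P" by (rule imageI)
      moreover have "b \<in> C (K y)" if "N b \<subseteq> K y" using that y bI unfolding C_def by auto
      ultimately have "b \<in> ?W" by (intro UN_I)
      then show False using b by blast
    qed
  qed
  have "card B = card (B \<inter> ?W) + card (B - ?W)" using card_Int_Diff[OF finB] .
  also have "\<dots> \<le> card (I \<inter> ?W) + card (I - ?W)"
  proof (rule add_mono)
    show "card (B \<inter> ?W) \<le> card (I \<inter> ?W)"
      unfolding part[OF finB] part[OF finI[OF subset_refl]] by (rule sum_mono) (rule le)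
    show "card (B - ?W) \<le> card (I - ?W)" using finI[of I] by (intro card_mono[OF _ out]) simp
  qed
  also have "\<dots> = card I" using card_Int_Diff[OF finI[OF subset_refl]] by simp
  finally show ?thesis .
qed

end

text \<open>On vertices untouched by the new edges \<open>Fn\<close> the Hall condition already
  holds in the old graph, so they are independent and at least \<open>card (S - I)\<close> vertices
  are touched. A singleton needs two neighbours, so an isolated vertex costs one edge more.
  \<open>strict\<close> stands for unequal sides; with equal sides the Hall condition is strict for
  proper subsets only, and \<open>proper\<close> ensures that singletons and the untouched set are
  proper.\<close>

lemma added_edges_lower_bound:
  fixes N Fn :: "'a \<Rightarrow> 'b set"
  assumes fin: "finite S" "\<And>x. x \<in> S \<Longrightarrow> finite (Fn x)"
    and hall: "\<And>Y. Y \<subseteq> S \<Longrightarrow> Y \<noteq> {} \<Longrightarrow> Y \<noteq> S \<or> strict \<Longrightarrow>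
      card Y < card (nbrs (\<lambda>x. N x \<union> Fn x) Y)"
    and proper: "strict \<or> 2 \<le> card S \<and> (\<exists>x\<in>S. Fn x \<noteq> {})"
    and I: "I \<subseteq> S" "\<And>B. B \<subseteq> S \<Longrightarrow> hindep N B \<Longrightarrow> card B \<le> card I"
  shows "card (S - I) + card {x \<in> S. N x = {}} \<le> (\<Sum>x\<in>S. card (Fn x))"
proof -
  let ?A = "{x \<in> S. Fn x = {}}" and ?T = "{x \<in> S. Fn x \<noteq> {}}" and ?iso = "{x \<in> S. N x = {}}"
  have "hindep N ?A" unfolding hindep_def
  proof (intro allI impI)
    fix Y assume Y: "Y \<subseteq> ?A" "Y \<noteq> {}"
    then have "Y \<noteq> S \<or> strict" using proper by blast
    then have "card Y < card (nbrs (\<lambda>x. N x \<union> Fn x) Y)" using Y by (intro hall) auto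
    also have "nbrs (\<lambda>x. N x \<union> Fn x) Y = nbrs N Y" using Y unfolding nbrs_def by blast
    finally show "card Y < card (nbrs N Y)" .
  qed
  then have "card ?A \<le> card I" by (intro I(2)) auto
  then have 1: "card (S - I) \<le> card ?T"
  proof -
    have "?T = S - ?A" by blast
    then show ?thesis using \<open>card ?A \<le> card I\<close> fin(1) I(1)
      by (simp add: card_Diff_subset finite_subset)
  qed
  have two: "2 \<le> card (Fn x)" if x: "x \<in> ?iso" for x
  proof -
    have "{x} \<noteq> S \<or> strict" using proper by auto
    then have "card {x} < card (nbrs (\<lambda>x. N x \<union> Fn x) {x})" using x by (intro hall) auto
    then show ?thesis using x by (simp add: nbrs_def)
  qed
  have "card ?T + card ?iso = (\<Sum>x\<in>S. if x \<in> ?T then 1 else 0) + (\<Sum>x\<in>S. if x \<in> ?iso then 1 else 0)"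
    using fin(1) by (simp add: sum.If_cases Int_def)
  also have "\<dots> = (\<Sum>x\<in>S. (if x \<in> ?T then 1 else 0) + (if x \<in> ?iso then 1 else 0))"
    by (simp add: sum.distrib)
  also have "\<dots> \<le> (\<Sum>x\<in>S. card (Fn x))"
  proof (rule sum_mono)
    fix x assume x: "x \<in> S"
    have "1 \<le> card (Fn x)" if "Fn x \<noteq> {}" using that fin(2)[OF x] by (simp add: Suc_le_eq card_gt_0_iff)
    then show "(if x \<in> ?T then 1 else 0) + (if x \<in> ?iso then 1 else 0) \<le> card (Fn x)"
      using two[of x] x by auto
  qed
  finally show ?thesis using 1 by simp
qed

section \<open>DM-irreducibility as a Hall condition\<close>

lemma maxchain_extend:
  assumes "subset.maxchain A C" "X \<in> A" "\<And>Y. Y \<in> C \<Longrightarrow> X \<subseteq> Y \<or> Y \<subseteq> X"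
  shows "X \<in> C"
proof (rule ccontr)
  assume "X \<notin> C"
  have "subset.chain A C" using assms(1) unfolding subset.maxchain_def by blast
  then have "subset.chain A (insert X C)"
    using assms(2,3) unfolding subset_chain_def by blast
  moreover have "C \<subset> insert X C" using \<open>X \<notin> C\<close> by blast
  ultimately show False using assms(1) unfolding subset.maxchain_def by blast
qed

lemma maxchain_whole:
  assumes "\<And>X Y. X \<in> A \<Longrightarrow> Y \<in> A \<Longrightarrow> X \<subseteq> Y \<or> Y \<subseteq> X"
  shows "subset.maxchain A A"
  using assms unfolding subset.maxchain_def subset_chain_def by blast

lemma nbhd_empty [simp]: "nbhd H {} = {}"
  unfolding nbhd_def by simp

lemma surplus_empty [simp]: "surplus H {} = 0"
  unfolding surplus_def by simp

text \<open>The empty set is the only minimizer, so the tail part is the whole graph.\<close>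

lemma DM_irreducibleI_strict:
  fixes H :: "'a bigraph"
  assumes hall: "\<And>X. X \<subseteq> vplus H \<Longrightarrow> X \<noteq> {} \<Longrightarrow> card X < card (nbhd H X)"
  shows "DM_irreducible H"
proof -
  have pos: "0 < surplus H X" if "X \<subseteq> vplus H" "X \<noteq> {}" for X
    using hall[OF that] unfolding surplus_def by simp
  have "minimizers H = {{}}"
  proof (intro equalityI subsetI)
    fix X assume "X \<in> minimizers H"
    then have "X \<subseteq> vplus H" "surplus H X \<le> surplus H {}" unfolding minimizers_def by blast+
    then show "X \<in> {{}}" using pos[of X] by force
  next
    fix X :: "'a set" assume "X \<in> {{}}"
    moreover have "surplus H {} \<le> surplus H Y" if "Y \<subseteq> vplus H" for Y
      using pos[OF that] by (cases "Y = {}") simp_all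
    ultimately show "X \<in> minimizers H" unfolding minimizers_def by auto
  qed
  moreover have "subset.maxchain {{}} {{} :: 'a set}" by (rule maxchain_whole) simp
  ultimately have "dm_chain H [{}]" unfolding dm_chain_def by simp
  moreover have "dm_infinity H [{}] = verts H" unfolding dm_infinity_def by simp
  ultimately show ?thesis unfolding DM_irreducible_def by blast
qed

text \<open>The only minimizers are \<open>{}\<close> and \<open>V^+\<close>, so the single part
  between them is the whole graph.\<close>

lemma DM_irreducibleI_balanced:
  assumes H: "bipartite_graph H" "card (vplus H) = card (vminus H)" "vplus H \<noteq> {}"
    and hall: "\<And>X. X \<subseteq> vplus H \<Longrightarrow> X \<noteq> {} \<Longrightarrow> X \<noteq> vplus H \<Longrightarrow> card X < card (nbhd H X)"
    and all: "nbhd H (vplus H) = vminus H"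
  shows "DM_irreducible H"
proof -
  have pos: "0 < surplus H X" if "X \<subseteq> vplus H" "X \<noteq> {}" "X \<noteq> vplus H" for X
    using hall[OF that] unfolding surplus_def by simp
  have top: "surplus H (vplus H) = 0" using all H(2) unfolding surplus_def by simp
  have ge: "0 \<le> surplus H X" if "X \<subseteq> vplus H" for X
    using pos[OF that] top by (cases "X = {} \<or> X = vplus H") auto
  have "minimizers H = {{}, vplus H}"
  proof (intro equalityI subsetI)
    fix X assume "X \<in> minimizers H"
    then have "X \<subseteq> vplus H" "surplus H X \<le> surplus H {}" unfolding minimizers_def by blast+
    then show "X \<in> {{}, vplus H}" using pos[of X] by force
  next
    fix X assume "X \<in> {{}, vplus H}"
    then show "X \<in> minimizers H" using ge top unfolding minimizers_def by auto
  qed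
  moreover have "subset.maxchain {{}, vplus H} {{}, vplus H}" by (rule maxchain_whole) auto
  ultimately have "dm_chain H [{}, vplus H]" unfolding dm_chain_def using H(3) by auto
  moreover have "dm_part H [{}, vplus H] 1 = verts H" unfolding dm_part_def using all by simp
  ultimately show ?thesis unfolding DM_irreducible_def by fastforce
qed

text \<open>If the first part is everything, \<open>{}\<close> is a minimizer too and would precede
  \<open>V^+\<close> in the chain. If the second part is everything, the chain starts with
  \<open>{}\<close> and \<open>V^+\<close>, and the minimizer \<open>X\<close> does not fit between
  them; \<open>X_max\<close> excludes \<open>X = V^+\<close>. If the last part is everything, the
  chain consists of \<open>{}\<close> alone, and the minimizer \<open>X\<close> would extend
  it.\<close>

lemma DM_irreducible_deficient:
  assumes H: "bipartite_graph H" "card (vplus H) \<le> card (vminus H)" and irr: "DM_irreducible H"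
    and X: "X \<subseteq> vplus H" "X \<noteq> {}" and neg: "card (nbhd H X) \<le> card X"
    and X_max: "X \<noteq> vplus H \<or> card (vplus H) < card (vminus H) \<or> card (nbhd H X) < card X"
  shows False
proof -
  let ?P = "vplus H" and ?Q = "vminus H"
  have fin: "finite ?P" "finite ?Q" and disj: "?P \<inter> ?Q = {}"
    using H(1) unfolding bipartite_graph_def by auto
  have nb: "nbhd H Y \<subseteq> ?Q" for Y unfolding nbhd_def by blast
  obtain Xs where ch: "dm_chain H Xs" and
    cases: "dm_first H Xs = verts H \<or> (1 < length Xs \<and> dm_part H Xs 1 = verts H) \<or>
      dm_infinity H Xs = verts H"
    using irr unfolding DM_irreducible_def by blast
  have mc: "subset.maxchain (minimizers H) (set Xs)" and so: "sorted_wrt (\<subset>) Xs"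
    using ch unfolding dm_chain_def by auto
  have sub: "set Xs \<subseteq> minimizers H"
    using mc unfolding subset.maxchain_def subset_chain_def by blast
  have minP: "Y \<subseteq> ?P" if "Y \<in> minimizers H" for Y using that unfolding minimizers_def by blast
  have min_le: "surplus H Y \<le> surplus H Z" if "Y \<in> minimizers H" "Z \<subseteq> ?P" for Y Z
    using that unfolding minimizers_def by blast
  have minI: "Y \<in> minimizers H" if "Z \<in> minimizers H" "Y \<subseteq> ?P" "surplus H Y \<le> surplus H Z" for Y Z
    unfolding minimizers_def using that(2) order_trans[OF that(3) min_le[OF that(1)]] by simp
  have sX: "surplus H X \<le> 0" using neg unfolding surplus_def by simp
  \<comment> \<open>An empty chain would make \<open>Xs ! 0\<close> and \<open>last Xs\<close>
    unspecified; it is not maximal, because a finite side always has a minimizer.\<close>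
  have "Xs \<noteq> []"
  proof
    assume "Xs = []"
    have "finite (surplus H ` Pow ?P)" "surplus H ` Pow ?P \<noteq> {}" using fin by auto
    then have "Min (surplus H ` Pow ?P) \<in> surplus H ` Pow ?P" by (rule Min_in)
    then obtain Y where "Y \<in> Pow ?P" "surplus H Y = Min (surplus H ` Pow ?P)" by auto
    moreover have "Min (surplus H ` Pow ?P) \<le> surplus H Z" if "Z \<subseteq> ?P" for Z
      using fin that by (intro Min_le) auto
    ultimately have "Y \<in> minimizers H" unfolding minimizers_def by auto
    from maxchain_extend[OF mc this] \<open>Xs = []\<close> show False by simp
  qed
  then have first: "Xs ! 0 \<in> set Xs" and lst: "last Xs \<in> set Xs" by auto
  have first_le: "Xs ! 0 \<subseteq> Y" if Y: "Y \<in> set Xs" for Y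
  proof -
    obtain i where "i < length Xs" "Y = Xs ! i" using Y by (auto simp: in_set_conv_nth)
    then show ?thesis using sorted_wrt_nth_less[OF so, of 0 i] by (cases "i = 0") auto
  qed
  from cases show False
  proof (elim disjE)
    assume "dm_first H Xs = verts H"
    then have "Xs ! 0 \<union> nbhd H (Xs ! 0) = ?P \<union> ?Q" unfolding dm_first_def .
    then have *: "Xs ! 0 = ?P" "nbhd H (Xs ! 0) = ?Q"
      using minP[of "Xs ! 0"] first sub nb[of "Xs ! 0"] disj by blast+
    then have "surplus H ?P \<ge> 0" using H(2) unfolding surplus_def by simp
    then have "{} \<in> minimizers H" using minI[of "Xs ! 0" "{}"] first sub * by auto
    then have "{} \<in> set Xs" using maxchain_extend[OF mc] by blast
    then show False using first_le[of "{}"] * X by auto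
  next
    assume a: "1 < length Xs \<and> dm_part H Xs 1 = verts H"
    then have p: "(Xs ! 1 - Xs ! 0) \<union> (nbhd H (Xs ! 1) - nbhd H (Xs ! 0)) = ?P \<union> ?Q"
      unfolding dm_part_def by simp
    have X1: "Xs ! 1 \<in> set Xs" using a by simp
    have P01: "Xs ! 0 \<subseteq> ?P" "Xs ! 1 \<subseteq> ?P" using minP first X1 sub by auto
    have 1: "Xs ! 1 = ?P" "Xs ! 0 = {}" "nbhd H ?P = ?Q"
    proof -
      show e: "Xs ! 1 = ?P" using p P01 nb disj by blast
      show "Xs ! 0 = {}" using p P01 nb[of "Xs ! 1"] disj by blast
      show "nbhd H ?P = ?Q" using p P01 nb[of ?P] disj unfolding e by blast
    qed
    have mins: "{} \<in> minimizers H" "?P \<in> minimizers H" using 1 first X1 sub by auto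
    have "surplus H ?P = 0"
      using min_le[OF mins(1), of ?P] min_le[OF mins(2), of "{}"] by simp
    then have eq: "card ?P = card ?Q" using 1 unfolding surplus_def by simp
    have "X \<in> minimizers H" using minI[OF mins(1) X(1)] sX by simp
    moreover have "X \<subseteq> Y \<or> Y \<subseteq> X" if Y: "Y \<in> set Xs" for Y
    proof -
      obtain i where i: "i < length Xs" "Y = Xs ! i" using Y by (auto simp: in_set_conv_nth)
      have "Y \<subseteq> ?P" using minP Y sub by blast
      show ?thesis
      proof (cases "i \<le> 1")
        case True
        then have "i = 0 \<or> i = 1" by auto
        then show ?thesis using 1 i X(1) by auto
      next
        case False
        then have "?P \<subset> Y" using sorted_wrt_nth_less[OF so, of 1 i] i 1 by simp
        then show ?thesis using X(1) by blast
      qed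
    qed
    ultimately have "X \<in> set Xs" using maxchain_extend[OF mc] by blast
    then obtain i where i: "i < length Xs" "X = Xs ! i" by (auto simp: in_set_conv_nth)
    have "i \<noteq> 0" "i \<noteq> 1" using 1 i X X_max eq by auto
    then have "?P \<subset> X" using sorted_wrt_nth_less[OF so, of 1 i] i 1 by simp
    then show False using X(1) by blast
  next
    assume "dm_infinity H Xs = verts H"
    then have p: "(?P - last Xs) \<union> (?Q - nbhd H (last Xs)) = ?P \<union> ?Q" unfolding dm_infinity_def .
    have "last Xs \<subseteq> ?P" using minP lst sub by blast
    then have l: "last Xs = {}" using p disj by blast
    have all: "Y = {}" if Y: "Y \<in> set Xs" for Y
    proof -
      obtain i where i: "i < length Xs" "Y = Xs ! i" using Y by (auto simp: in_set_conv_nth)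
      have le: "last Xs = Xs ! (length Xs - 1)" using \<open>Xs \<noteq> []\<close> by (rule last_conv_nth)
      show ?thesis
      proof (cases "i = length Xs - 1")
        case False
        then have "Y \<subset> last Xs" using sorted_wrt_nth_less[OF so, of i "length Xs - 1"] i le by simp
        then show ?thesis using l by blast
      qed (use i le l in simp)
    qed
    have "{} \<in> minimizers H" using lst l sub by auto
    then have "X \<in> minimizers H" using minI[OF _ X(1), of "{}"] sX by simp
    moreover have "X \<subseteq> Y \<or> Y \<subseteq> X" if "Y \<in> set Xs" for Y using all[OF that] by simp
    ultimately have "X \<in> set Xs" using maxchain_extend[OF mc] by blast
    then show False using all X(2) by blast
  qed
qed

lemma DM_irreducible_hall:
  assumes H: "bipartite_graph H" "card (vplus H) \<le> card (vminus H)" and irr: "DM_irreducible H"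
    and X: "X \<subseteq> vplus H" "X \<noteq> {}"
  shows "card X \<le> card (nbhd H X)"
    "X \<noteq> vplus H \<or> card (vplus H) < card (vminus H) \<Longrightarrow> card X < card (nbhd H X)"
proof -
  note * = DM_irreducible_deficient[OF H irr X]
  show "card X \<le> card (nbhd H X)"
  proof (rule ccontr)
    assume "\<not> ?thesis"
    then show False using * by simp
  qed
  assume "X \<noteq> vplus H \<or> card (vplus H) < card (vminus H)"
  show "card X < card (nbhd H X)"
  proof (rule ccontr)
    assume "\<not> ?thesis"
    then show False using * \<open>X \<noteq> vplus H \<or> _\<close> by simp
  qed
qed

section \<open>Program logic\<close>

text \<open>This is \<open>exec\<close> without the word bound. Correctness and time are proved for
  it, and \<open>run_exec\<close> returns to bounded words once for the complete program.\<close>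

inductive run :: "com \<Rightarrow> state \<Rightarrow> nat \<Rightarrow> state \<Rightarrow> bool" where
  run_Skip: "run Skip s 1 s"
| run_Assign: "run (Assign x i e) s (1 + acost i + acost e) (s(x := (s x)(aval i s := aval e s)))"
| run_Seq: "\<lbrakk>run c1 s t1 s1; run c2 s1 t2 s2\<rbrakk> \<Longrightarrow> run (Seq c1 c2) s (t1 + t2) s2"
| run_IfTrue: "\<lbrakk>bval b s; run c1 s t s'\<rbrakk> \<Longrightarrow> run (If b c1 c2) s (1 + bcost b + t) s'"
| run_IfFalse: "\<lbrakk>\<not> bval b s; run c2 s t s'\<rbrakk> \<Longrightarrow> run (If b c1 c2) s (1 + bcost b + t) s'"
| run_WhileFalse: "\<not> bval b s \<Longrightarrow> run (While b c) s (1 + bcost b) s"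
| run_WhileTrue: "\<lbrakk>bval b s; run c s t1 s1; run (While b c) s1 t2 s2\<rbrakk> \<Longrightarrow>
    run (While b c) s (1 + bcost b + t1 + t2) s2"

inductive_cases run_SkipE: "run Skip s t s'"
inductive_cases run_AssignE: "run (Assign x i e) s t s'"

text \<open>An expression of this form exceeds the largest stored value by at most its evaluation cost, so
  a run of length \<open>t\<close> needs only words that are \<open>t\<close> larger than the input.\<close>

primrec tame_aexp :: "aexp \<Rightarrow> bool" where
  "tame_aexp (Num k) \<longleftrightarrow> k \<le> 1"
| "tame_aexp (Cell x e) \<longleftrightarrow> tame_aexp e"
| "tame_aexp (Add e1 e2) \<longleftrightarrow> tame_aexp e1 \<and> e2 = Num 1"
| "tame_aexp (Sub e1 e2) \<longleftrightarrow> tame_aexp e1 \<and> tame_aexp e2"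
| "tame_aexp (Mul e1 e2) \<longleftrightarrow> False"

primrec tame_bexp :: "bexp \<Rightarrow> bool" where
  "tame_bexp (Less e1 e2) \<longleftrightarrow> tame_aexp e1 \<and> tame_aexp e2"
| "tame_bexp (Equal e1 e2) \<longleftrightarrow> tame_aexp e1 \<and> tame_aexp e2"
| "tame_bexp (Not b) \<longleftrightarrow> tame_bexp b"
| "tame_bexp (And b1 b2) \<longleftrightarrow> tame_bexp b1 \<and> tame_bexp b2"

primrec tame :: "com \<Rightarrow> bool" where
  "tame Skip \<longleftrightarrow> True"
| "tame (Assign x i e) \<longleftrightarrow> tame_aexp i \<and> tame_aexp e"
| "tame (Seq c1 c2) \<longleftrightarrow> tame c1 \<and> tame c2"
| "tame (If b c1 c2) \<longleftrightarrow> tame_bexp b \<and> tame c1 \<and> tame c2"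
| "tame (While b c) \<longleftrightarrow> tame_bexp b \<and> tame c"

section \<open>Transfer from unbounded to bounded words\<close>

lemma tame_aval: "tame_aexp e \<Longrightarrow> \<forall>x i. s x i \<le> B \<Longrightarrow> aval e s \<le> B + acost e"
proof (induction e)
  case (Cell x e)
  then have "s x (aval e s) \<le> B" by blast
  then show ?case by simp
qed auto

lemma tame_afits:
  "tame_aexp e \<Longrightarrow> \<forall>x i. s x i \<le> B \<Longrightarrow> B + acost e \<le> W \<Longrightarrow> afits W e s"
proof (induction e)
  case (Cell x e)
  then have "s x (aval e s) \<le> B" by blast
  with Cell.prems(3) have "s x (aval e s) \<le> W" by simp
  with Cell show ?case by simp
next
  case (Add e1 e2)
  then show ?case using tame_aval[of "Add e1 e2" s B] by auto
next
  case (Sub e1 e2)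
  then show ?case using tame_aval[of "Sub e1 e2" s B] by auto
qed auto

lemma tame_bfits:
  "tame_bexp b \<Longrightarrow> \<forall>x i. s x i \<le> B \<Longrightarrow> B + bcost b \<le> W \<Longrightarrow> bfits W b s"
  by (induction b) (auto intro!: tame_afits[of _ s B W])

text \<open>The induction generalises over \<open>B\<close>: each step raises the bound on stored
  values by at most its own cost, so the second half of a sequence starts from
  \<open>B + t1\<close>.\<close>

lemma run_exec:
  assumes "run c s t s'"
  shows "tame c \<Longrightarrow> \<forall>x i. s x i \<le> B \<Longrightarrow> B + t \<le> W \<Longrightarrow>
    exec W c s t s' \<and> (\<forall>x i. s' x i \<le> B + t)"
  using assms
proof (induction arbitrary: B rule: run.induct)
  case (run_Skip s)
  then show ?case using exec.exec_Skip[of W s] by (auto simp: le_SucI)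
next
  case (run_Assign x i e s)
  have "afits W i s" "afits W e s"
    using run_Assign by (auto intro!: tame_afits[of _ s B])
  moreover have "aval e s \<le> B + acost e" using run_Assign by (auto intro: tame_aval)
  moreover have "s y j \<le> B + (1 + acost i + acost e)" for y j
    using run_Assign.prems(2)[rule_format, of y j] by simp
  ultimately show ?case using exec_Assign[of W i s e x]
    by (simp del: fun_upd_apply) (simp add: le_SucI trans_le_add1)
next
  case (run_Seq c1 s t1 s1 c2 t2 s2)
  have 1: "exec W c1 s t1 s1 \<and> (\<forall>x i. s1 x i \<le> B + t1)"
    using run_Seq.IH(1)[of B] run_Seq.prems by auto
  have "exec W c2 s1 t2 s2 \<and> (\<forall>x i. s2 x i \<le> B + t1 + t2)"
    using run_Seq.IH(2)[of "B + t1"] run_Seq.prems 1 by auto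
  with 1 show ?case by (auto intro: exec_Seq simp: add.assoc)
next
  case (run_IfTrue b s c1 t s' c2)
  have "bfits W b s" using run_IfTrue.prems by (auto intro!: tame_bfits[of _ s B])
  moreover have "exec W c1 s t s' \<and> (\<forall>x i. s' x i \<le> B + t)"
    using run_IfTrue.IH[of B] run_IfTrue.prems by auto
  moreover have "s' x i \<le> B + (1 + bcost b + t)" if "s' x i \<le> B + t" for x i
    using that by simp
  ultimately show ?case using run_IfTrue.hyps exec_IfTrue[of W b s c1 t s' c2] by blast
next
  case (run_IfFalse b s c2 t s' c1)
  have "bfits W b s" using run_IfFalse.prems by (auto intro!: tame_bfits[of _ s B])
  moreover have "exec W c2 s t s' \<and> (\<forall>x i. s' x i \<le> B + t)"
    using run_IfFalse.IH[of B] run_IfFalse.prems by auto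
  moreover have "s' x i \<le> B + (1 + bcost b + t)" if "s' x i \<le> B + t" for x i
    using that by simp
  ultimately show ?case using run_IfFalse.hyps exec_IfFalse[of W b s c2 t s' c1] by blast
next
  case (run_WhileFalse b s c)
  have "bfits W b s" using run_WhileFalse.prems by (auto intro!: tame_bfits[of _ s B])
  moreover have "s x i \<le> B + (1 + bcost b)" for x i
    using run_WhileFalse.prems(2)[rule_format, of x i] by simp
  ultimately show ?case using run_WhileFalse.hyps exec_WhileFalse[of W b s c] by blast
next
  case (run_WhileTrue b s c t1 s1 t2 s2)
  have b: "bfits W b s" using run_WhileTrue.prems by (auto intro!: tame_bfits[of _ s B])
  have 1: "exec W c s t1 s1 \<and> (\<forall>x i. s1 x i \<le> B + t1)"
    using run_WhileTrue.IH(1)[of B] run_WhileTrue.prems by auto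
  have 2: "exec W (While b c) s1 t2 s2 \<and> (\<forall>x i. s2 x i \<le> B + t1 + t2)"
    using run_WhileTrue.IH(2)[of "B + t1"] run_WhileTrue.prems 1 by auto
  have "exec W (While b c) s (1 + bcost b + t1 + t2) s2"
    using exec_WhileTrue[OF b] run_WhileTrue.hyps(1) 1 2 by blast
  moreover have "s2 x i \<le> B + (1 + bcost b + t1 + t2)" for x i
  proof -
    have "s2 x i \<le> B + t1 + t2" using 2 by blast
    then show ?thesis by simp
  qed
  ultimately show ?case by blast
qed

section \<open>Frame conditions and weakest preconditions with elapsed time\<close>

primrec mods :: "com \<Rightarrow> vname set" where
  "mods Skip = {}"
| "mods (Assign x i e) = {x}"
| "mods (Seq c1 c2) = mods c1 \<union> mods c2"
| "mods (If b c1 c2) = mods c1 \<union> mods c2"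
| "mods (While b c) = mods c"

lemma run_mods: "run c s t s' \<Longrightarrow> x \<notin> mods c \<Longrightarrow> s' x = s x"
  by (induction rule: run.induct) auto

lemma frameD: "\<forall>x. x \<notin> mods c \<longrightarrow> s' x = s x \<Longrightarrow> mods c \<subseteq> V \<Longrightarrow> v \<notin> V \<Longrightarrow> s' v = s v"
  by blast

text \<open>\<open>t\<close> is the time already elapsed, so that postconditions bound the total time and no
  subtraction occurs.\<close>

definition wp :: "com \<Rightarrow> (state \<Rightarrow> nat \<Rightarrow> bool) \<Rightarrow> state \<Rightarrow> nat \<Rightarrow> bool" where
  "wp c Q s t \<longleftrightarrow> (\<exists>u s'. run c s u s' \<and> Q s' (t + u))"

lemma wp_mono: "wp c Q s t \<Longrightarrow> (\<And>s' t'. Q s' t' \<Longrightarrow> Q' s' t') \<Longrightarrow> wp c Q' s t"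
  unfolding wp_def by blast

lemma wp_frame:
  "wp c (\<lambda>s' t'. (\<forall>x. x \<notin> mods c \<longrightarrow> s' x = s x) \<longrightarrow> Q s' t') s t \<Longrightarrow> wp c Q s t"
  unfolding wp_def using run_mods by blast

lemma wp_Skip: "wp Skip Q s t \<longleftrightarrow> Q s (Suc t)"
proof
  show "Q s (Suc t) \<Longrightarrow> wp Skip Q s t"
    unfolding wp_def using run_Skip[of s] by (metis add.commute plus_1_eq_Suc)
qed (auto simp: wp_def elim: run_SkipE)

lemma wp_Assign:
  "wp (Assign x i e) Q s t \<longleftrightarrow>
   Q (s(x := (s x)(aval i s := aval e s))) (t + (1 + acost i + acost e))"
proof
  assume "wp (Assign x i e) Q s t"
  then show "Q (s(x := (s x)(aval i s := aval e s))) (t + (1 + acost i + acost e))"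
    unfolding wp_def by (auto elim!: run_AssignE simp del: fun_upd_apply)
qed (use run_Assign wp_def in blast)

lemma wp_Seq: "wp (Seq c1 c2) Q s t \<longleftrightarrow> wp c1 (wp c2 Q) s t"
proof
  assume "wp (Seq c1 c2) Q s t"
  then obtain u s' where "run (Seq c1 c2) s u s'" "Q s' (t + u)" unfolding wp_def by blast
  then show "wp c1 (wp c2 Q) s t"
    unfolding wp_def by (cases rule: run.cases) (auto simp: add.assoc)
next
  assume "wp c1 (wp c2 Q) s t"
  then show "wp (Seq c1 c2) Q s t" unfolding wp_def using run_Seq by (metis add.assoc)
qed

lemma wp_Seq_fun: "wp (Seq c1 c2) Q = wp c1 (wp c2 Q)"
  by (intro ext) (rule wp_Seq)

lemma wp_If:
  "wp (If b c1 c2) Q s t \<longleftrightarrow>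
   (if bval b s then wp c1 Q s (t + (1 + bcost b)) else wp c2 Q s (t + (1 + bcost b)))"
  (is "?l = ?r")
proof
  assume ?l
  then obtain u s' where "run (If b c1 c2) s u s'" "Q s' (t + u)" unfolding wp_def by blast
  then show ?r unfolding wp_def by (cases rule: run.cases) (auto simp: add.assoc)
next
  assume r: ?r
  show ?l
  proof (cases "bval b s")
    case True
    with r obtain u s' where "run c1 s u s'" "Q s' (t + (1 + bcost b) + u)"
      unfolding wp_def by auto
    then show ?thesis unfolding wp_def using run_IfTrue[OF True] by (metis add.assoc)
  next
    case False
    with r obtain u s' where "run c2 s u s'" "Q s' (t + (1 + bcost b) + u)"
      unfolding wp_def by auto
    then show ?thesis unfolding wp_def using run_IfFalse[OF False] by (metis add.assoc)
  qed
qed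

text \<open>Termination is automatic, since the elapsed time grows with every iteration and stays
  below \<open>K\<close>.\<close>

lemma wp_WhileI:
  assumes "I s t"
    and bound: "\<And>s t. I s t \<Longrightarrow> t \<le> K"
    and body: "\<And>s t. I s t \<Longrightarrow> bval b s \<Longrightarrow> wp c I s (t + (1 + bcost b))"
    and exit: "\<And>s t. I s t \<Longrightarrow> \<not> bval b s \<Longrightarrow> Q s (t + (1 + bcost b))"
  shows "wp (While b c) Q s t"
  using \<open>I s t\<close>
proof (induction "Suc K - t" arbitrary: s t rule: less_induct)
  case less
  show ?case
  proof (cases "bval b s")
    case False
    with exit[OF less.prems] run_WhileFalse[of b s c] show ?thesis unfolding wp_def by blast
  next
    case True
    obtain u s1 where u: "run c s u s1" "I s1 (t + (1 + bcost b) + u)"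
      using body[OF less.prems True] unfolding wp_def by blast
    have "Suc K - (t + (1 + bcost b) + u) < Suc K - t"
      using bound[OF less.prems] by simp
    from less.hyps[OF this u(2)] obtain u2 s2 where
      "run (While b c) s1 u2 s2" "Q s2 (t + (1 + bcost b) + u + u2)"
      unfolding wp_def by blast
    then show ?thesis unfolding wp_def using run_WhileTrue[OF True u(1)]
      by (metis add.assoc)
  qed
qed

text \<open>The frame relative to the state before the loop is carried along automatically, so
  invariants mention only what the body changes.\<close>

lemma wp_While_frameI:
  assumes init: "I s t"
    and bound: "\<And>s t. I s t \<Longrightarrow> t \<le> K"
    and body: "\<And>s1 t. I s1 t \<Longrightarrow> \<forall>x. x \<notin> mods c \<longrightarrow> s1 x = s x \<Longrightarrow> bval b s1 \<Longrightarrow>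
      wp c I s1 (t + (1 + bcost b))"
    and exit: "\<And>s1 t. I s1 t \<Longrightarrow> \<forall>x. x \<notin> mods c \<longrightarrow> s1 x = s x \<Longrightarrow> \<not> bval b s1 \<Longrightarrow>
      Q s1 (t + (1 + bcost b))"
  shows "wp (While b c) Q s t"
proof (rule wp_WhileI[where I = "\<lambda>s1 t. I s1 t \<and> (\<forall>x. x \<notin> mods c \<longrightarrow> s1 x = s x)" and K = K])
  fix s1 t assume *: "I s1 t \<and> (\<forall>x. x \<notin> mods c \<longrightarrow> s1 x = s x)" "bval b s1"
  have "wp c I s1 (t + (1 + bcost b))" using * body by blast
  then have "wp c (\<lambda>s' t'. (\<forall>x. x \<notin> mods c \<longrightarrow> s' x = s1 x) \<longrightarrow>
      I s' t' \<and> (\<forall>x. x \<notin> mods c \<longrightarrow> s' x = s x)) s1 (t + (1 + bcost b))"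
    by (rule wp_mono) (use *(1) in simp)
  then show "wp c (\<lambda>s1 t. I s1 t \<and> (\<forall>x. x \<notin> mods c \<longrightarrow> s1 x = s x)) s1 (t + (1 + bcost b))"
    by (rule wp_frame)
next
  show "\<And>s1 t. I s1 t \<and> (\<forall>x. x \<notin> mods c \<longrightarrow> s1 x = s x) \<Longrightarrow> t \<le> K" using bound by blast
  show "\<And>s1 t. I s1 t \<and> (\<forall>x. x \<notin> mods c \<longrightarrow> s1 x = s x) \<Longrightarrow> \<not> bval b s1 \<Longrightarrow>
      Q s1 (t + (1 + bcost b))" using exit by blast
qed (use init in simp)

lemmas wp_simps = wp_Skip wp_Assign wp_Seq wp_If

abbreviation Var :: "vname \<Rightarrow> aexp" where
  "Var x \<equiv> Cell x (Num 0)"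

abbreviation set_var :: "vname \<Rightarrow> aexp \<Rightarrow> com" where
  "set_var x e \<equiv> Assign x (Num 0) e"

abbreviation incr :: "vname \<Rightarrow> com" where
  "incr x \<equiv> set_var x (Add (Var x) (Num 1))"

abbreviation seq :: "com \<Rightarrow> com \<Rightarrow> com" (infixr ";;" 60) where
  "c1 ;; c2 \<equiv> Seq c1 c2"

section \<open>Alternating search\<close>

text \<open>Adjacency lists are singly linked lists of arc numbers with 0 as the null pointer; the
  list argument is their abstract content.\<close>

fun linked :: "(nat \<Rightarrow> nat) \<Rightarrow> nat \<Rightarrow> nat list \<Rightarrow> bool" where
  "linked nx a [] \<longleftrightarrow> a = 0"
| "linked nx a (b # bs) \<longleftrightarrow> a = b \<and> b \<noteq> 0 \<and> linked nx (nx b) bs"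

text \<open>The stored graph as the searches see it: \<open>AL v\<close> lists the arcs leaving
  \<open>v\<close>, and \<open>ds\<close> gives their heads. Every edge is stored as two opposite
  arcs, whence the symmetry condition and the bound \<open>2 * m\<close>.\<close>

locale graph_mem =
  fixes p n m :: nat and fs nx ds :: "nat \<Rightarrow> nat" and AL :: "nat \<Rightarrow> nat list"
  assumes linked: "v < p + n \<Longrightarrow> linked nx (fs v) (AL v)"
    and arcs: "v < p + n \<Longrightarrow> a \<in> set (AL v) \<Longrightarrow>
      ds a < p + n \<and> v \<in> ds ` set (AL (ds a)) \<and> (ds a < p \<longleftrightarrow> \<not> v < p)"
    and sum_length: "(\<Sum>v<p + n. length (AL v)) \<le> 2 * m"
begin

definition N :: "nat \<Rightarrow> nat set" where
  "N v = ds ` set (AL v)"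

lemma N_D:
  assumes "y \<in> N v" "v < p + n"
  shows "y < p + n" "v \<in> N y" "y < p \<longleftrightarrow> \<not> v < p"
  using assms arcs unfolding N_def by auto

lemma N_empty_iff: "N v = {} \<longleftrightarrow> AL v = []"
  unfolding N_def by simp

text \<open>A matching is stored as an involution whose fixed points are the exposed vertices.\<close>

definition invol :: "(nat \<Rightarrow> nat) \<Rightarrow> bool" where
  "invol \<mu> \<longleftrightarrow> (\<forall>x<p + n. \<mu> x < p + n \<and> \<mu> (\<mu> x) = x \<and> (\<mu> x \<noteq> x \<longrightarrow> (\<mu> x < p \<longleftrightarrow> \<not> x < p)))"

lemma invol_D:
  assumes "invol \<mu>" "x < p + n"
  shows "\<mu> x < p + n" "\<mu> (\<mu> x) = x" "\<mu> x \<noteq> x \<Longrightarrow> \<mu> x < p \<longleftrightarrow> \<not> x < p"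
  using assms unfolding invol_def by blast+

lemma invol_inj_on: "invol \<mu> \<Longrightarrow> inj_on \<mu> {..<p + n}"
  by (metis inj_onI invol_D(2) lessThan_iff)

lemma invol_bij_betw: "invol \<mu> \<Longrightarrow> bij_betw \<mu> {..<p + n} {..<p + n}"
  by (rule bij_betw_byWitness[where f' = \<mu>]) (auto dest: invol_D)

text \<open>A search continues from a visited vertex to its mate only if the mate carries the flag
  \<open>\<phi>\<close>. A vertex that does not pass is a target: it is exposed, or its mate lies
  outside the flagged set.\<close>

definition pass :: "(nat \<Rightarrow> nat) \<Rightarrow> (nat \<Rightarrow> nat) \<Rightarrow> nat \<Rightarrow> bool" where
  "pass \<phi> \<mu> y \<longleftrightarrow> \<phi> (\<mu> y) = 1 \<and> \<mu> y \<noteq> y"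

text \<open>The visited vertices all lie on the side opposite to the root. \<open>rk\<close> is the
  position in the queue; its decrease towards the root excludes cycles and later bounds the length
  of an augmenting path.\<close>

definition tree :: "(nat \<Rightarrow> nat) \<Rightarrow> (nat \<Rightarrow> nat) \<Rightarrow> nat \<Rightarrow> nat set \<Rightarrow> (nat \<Rightarrow> nat) \<Rightarrow>
    (nat \<Rightarrow> nat) \<Rightarrow> bool" where
  "tree \<phi> \<mu> r vis par rk \<longleftrightarrow>
     vis \<subseteq> {y. y < p + n \<and> (y < p \<longleftrightarrow> \<not> r < p)} \<and>
     (\<forall>y\<in>vis. y \<in> N (par y) \<and>
        (par y = r \<or> (\<exists>y'\<in>vis. pass \<phi> \<mu> y' \<and> \<mu> y' = par y \<and> rk y' < rk y)))"

text \<open>The expanded vertices on the side of the root; \<open>D\<close> is the dequeued set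
  during a search and the whole visited set afterwards.\<close>

definition reached :: "(nat \<Rightarrow> nat) \<Rightarrow> (nat \<Rightarrow> nat) \<Rightarrow> nat \<Rightarrow> nat set \<Rightarrow> nat set" where
  "reached \<phi> \<mu> r D = insert r (\<mu> ` {y \<in> D. pass \<phi> \<mu> y})"

text \<open>\<open>c\<close> and \<open>h\<close> count the enqueued and the dequeued vertices, \<open>rest\<close> lists the arcs at \<open>x\<close> still to
  be scanned, and \<open>tgt \<noteq> 0\<close> if some dequeued vertex did not pass, the last of them being \<open>g\<close>.\<close>

definition sinv where
  "sinv \<phi> \<mu> r x rest (queue :: nat \<Rightarrow> nat) c h par rk tgt g \<longleftrightarrow>
     h \<le> c \<and> (\<forall>i<c. rk (queue i) = i) \<and> tree \<phi> \<mu> r (queue ` {..<c}) par rk \<and>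
     ds ` set rest \<subseteq> N x \<and> x \<in> reached \<phi> \<mu> r (queue ` {..<h}) \<and>
     (\<forall>x'\<in>reached \<phi> \<mu> r (queue ` {..<h}). N x' \<subseteq> queue ` {..<c} \<union> ds ` set rest) \<and>
     (tgt = (0::nat) \<longrightarrow> (\<forall>i<h. pass \<phi> \<mu> (queue i))) \<and>
     (tgt \<noteq> 0 \<longrightarrow> g \<in> queue ` {..<c} \<and> \<not> pass \<phi> \<mu> g)"

lemma sinvI:
  assumes "h \<le> c" "\<And>i. i < c \<Longrightarrow> rk (queue i) = i" "tree \<phi> \<mu> r (queue ` {..<c}) par rk"
    "ds ` set rest \<subseteq> N x" "x \<in> reached \<phi> \<mu> r (queue ` {..<h})"
    "\<And>x'. x' \<in> reached \<phi> \<mu> r (queue ` {..<h}) \<Longrightarrow> N x' \<subseteq> queue ` {..<c} \<union> ds ` set rest"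
    "\<And>i. tgt = 0 \<Longrightarrow> i < h \<Longrightarrow> pass \<phi> \<mu> (queue i)"
    "tgt \<noteq> 0 \<Longrightarrow> g \<in> queue ` {..<c} \<and> \<not> pass \<phi> \<mu> g"
  shows "sinv \<phi> \<mu> r x rest queue c h par rk tgt g"
  unfolding sinv_def using assms by blast

lemma sinvD:
  assumes "sinv \<phi> \<mu> r x rest queue c h par rk tgt g"
  shows "h \<le> c" "\<And>i. i < c \<Longrightarrow> rk (queue i) = i" "tree \<phi> \<mu> r (queue ` {..<c}) par rk"
    "ds ` set rest \<subseteq> N x" "x \<in> reached \<phi> \<mu> r (queue ` {..<h})"
    "\<And>x'. x' \<in> reached \<phi> \<mu> r (queue ` {..<h}) \<Longrightarrow> N x' \<subseteq> queue ` {..<c} \<union> ds ` set rest"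
    "\<And>i. tgt = 0 \<Longrightarrow> i < h \<Longrightarrow> pass \<phi> \<mu> (queue i)"
    "tgt \<noteq> 0 \<Longrightarrow> g \<in> queue ` {..<c} \<and> \<not> pass \<phi> \<mu> g"
  using assms unfolding sinv_def by blast+

lemma treeD:
  assumes "tree \<phi> \<mu> r vis par rk" "y \<in> vis"
  shows "y < p + n" "y < p \<longleftrightarrow> \<not> r < p" "y \<in> N (par y)"
    "par y = r \<or> (\<exists>y'\<in>vis. pass \<phi> \<mu> y' \<and> \<mu> y' = par y \<and> rk y' < rk y)"
  using assms unfolding tree_def by auto

lemma sinv_init:
  "sinv \<phi> \<mu> r r (AL r) queue 0 0 par rk 0 g"
  by (rule sinvI) (auto simp: tree_def N_def reached_def)

lemma reached_side:
  assumes "x \<in> reached \<phi> \<mu> r D" "D \<subseteq> vis" "tree \<phi> \<mu> r vis par rk" "invol \<mu>" "r < p + n"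
  shows "x < p + n" "x < p \<longleftrightarrow> r < p"
proof -
  have "x < p + n \<and> (x < p \<longleftrightarrow> r < p)"
  proof (cases "x = r")
    case False
    then obtain y where "y \<in> vis" "pass \<phi> \<mu> y" "x = \<mu> y"
      using assms(1,2) unfolding reached_def by auto
    then show ?thesis using treeD(1,2)[OF assms(3), of y] invol_D[OF assms(4), of y]
      unfolding pass_def by auto
  qed (use assms(5) in simp)
  then show "x < p + n" "x < p \<longleftrightarrow> r < p" by auto
qed

lemma sinv_old:
  assumes "sinv \<phi> \<mu> r x (a # rest) queue c h par rk tgt g" "ds a \<in> queue ` {..<c}"
  shows "sinv \<phi> \<mu> r x rest queue c h par rk tgt g"
proof -
  have "queue ` {..<c} \<union> ds ` set (a # rest) = queue ` {..<c} \<union> ds ` set rest"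
    using assms(2) by auto
  with sinvD[OF assms(1)] show ?thesis by (intro sinvI) auto
qed

lemma sinv_new:
  assumes inv: "sinv \<phi> \<mu> r x (a # rest) queue c h par rk tgt g" and y: "ds a \<notin> queue ` {..<c}"
    and "invol \<mu>" "r < p + n"
  shows "sinv \<phi> \<mu> r x rest (queue(c := ds a)) (Suc c) h (par(ds a := x)) (rk(ds a := c)) tgt g"
proof -
  let ?y = "ds a" and ?V = "queue ` {..<c}" and ?D = "queue ` {..<h}"
  note I = sinvD[OF inv]
  have V: "queue(c := ?y) ` {..<Suc c} = insert ?y ?V"
    by (auto simp: image_iff less_Suc_eq)
  have H: "queue(c := ?y) ` {..<h} = ?D" using I(1) by (auto simp: image_iff)
  have DV: "?D \<subseteq> ?V" using I(1) by auto
  note xs = reached_side[OF I(5) DV I(3) assms(3,4)]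
  have yx: "?y \<in> N x" using I(4) by simp
  have ne: "z \<noteq> ?y" if "z \<in> ?V" for z using that y by metis
  \<comment> \<open>Unless it is the root, \<open>x\<close> is the mate of a dequeued vertex, whose
    rank is below \<open>h \<le> c\<close>; so the new rank \<open>c\<close> respects the order of
    the tree.\<close>
  have 1: "x = r \<or> (\<exists>y'\<in>?V. pass \<phi> \<mu> y' \<and> \<mu> y' = x \<and> rk y' < c)"
  proof (cases "x = r")
    case False
    then obtain y' where y': "y' \<in> ?D" "pass \<phi> \<mu> y'" "x = \<mu> y'"
      using I(5) unfolding reached_def by auto
    then obtain i where "i < h" "y' = queue i" by auto
    then have "rk y' < c" using I(1) I(2)[of i] by simp
    then show ?thesis using y' DV by blast
  qed simp
  have tree: "tree \<phi> \<mu> r (insert ?y ?V) (par(?y := x)) (rk(?y := c))"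
    unfolding tree_def
  proof (intro conjI ballI)
    show "insert ?y ?V \<subseteq> {y. y < p + n \<and> (y < p \<longleftrightarrow> \<not> r < p)}"
      using I(3) N_D[OF yx xs(1)] xs(2) unfolding tree_def by simp
    fix z assume z: "z \<in> insert ?y ?V"
    show "z \<in> N ((par(?y := x)) z)"
      using z yx treeD(3)[OF I(3), of z] by auto
    show "(par(?y := x)) z = r \<or> (\<exists>y'\<in>insert ?y ?V. pass \<phi> \<mu> y' \<and>
       \<mu> y' = (par(?y := x)) z \<and> (rk(?y := c)) y' < (rk(?y := c)) z)"
    proof (cases "z = ?y")
      case True
      then show ?thesis using 1 ne by auto
    next
      case False
      then have "par z = r \<or> (\<exists>y'\<in>?V. pass \<phi> \<mu> y' \<and> \<mu> y' = par z \<and> rk y' < rk z)"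
        using z treeD(4)[OF I(3)] by blast
      then show ?thesis using False ne by auto
    qed
  qed
  have rk': "(rk(?y := c)) ((queue(c := ?y)) i) = i" if "i < Suc c" for i
  proof (cases "i = c")
    case False
    then have "i < c" using that by simp
    then show ?thesis using I(2)[of i] ne[of "queue i"] by simp
  qed simp
  have q: "(queue(c := ?y)) i = queue i" if "i < h" for i using I(1) that by simp
  show ?thesis
  proof (rule sinvI, unfold V H)
    fix x' assume "x' \<in> reached \<phi> \<mu> r ?D"
    from I(6)[OF this] show "N x' \<subseteq> insert ?y ?V \<union> ds ` set rest" by auto
  next
    fix i assume "tgt = 0" "i < h"
    then show "pass \<phi> \<mu> ((queue(c := ?y)) i)" using I(7) q by simp
  qed (use I(1,4,5,8) rk' tree in auto)
qed

lemma sinv_pass: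
  assumes inv: "sinv \<phi> \<mu> r x [] queue c h par rk tgt g" and "h < c" "pass \<phi> \<mu> (queue h)"
  shows "sinv \<phi> \<mu> r (\<mu> (queue h)) (AL (\<mu> (queue h))) queue c (Suc h) par rk tgt g"
proof -
  let ?y = "queue h"
  note I = sinvD[OF inv]
  have "queue ` {..<Suc h} = insert ?y (queue ` {..<h})" by (auto simp: less_Suc_eq)
  then have *: "reached \<phi> \<mu> r (queue ` {..<Suc h}) =
      insert (\<mu> ?y) (reached \<phi> \<mu> r (queue ` {..<h}))"
    using assms(3) unfolding reached_def by auto
  show ?thesis
  proof (rule sinvI, unfold *)
    fix x' assume "x' \<in> insert (\<mu> ?y) (reached \<phi> \<mu> r (queue ` {..<h}))"
    then show "N x' \<subseteq> queue ` {..<c} \<union> ds ` set (AL (\<mu> ?y))"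
      using I(6)[of x'] by (auto simp: N_def)
  next
    fix i assume "tgt = 0" "i < Suc h"
    then show "pass \<phi> \<mu> (queue i)" using I(7) assms(3) by (cases "i = h") auto
  qed (use I(2,3,8) assms(2) in \<open>auto simp: N_def\<close>)
qed

lemma sinv_target:
  assumes inv: "sinv \<phi> \<mu> r x [] queue c h par rk tgt g" and "h < c" "\<not> pass \<phi> \<mu> (queue h)"
  shows "sinv \<phi> \<mu> r x [] queue c (Suc h) par rk (Suc tgt) (queue h)"
proof -
  have "{y \<in> queue ` {..<Suc h}. pass \<phi> \<mu> y} = {y \<in> queue ` {..<h}. pass \<phi> \<mu> y}"
    using assms(3) by (auto simp: less_Suc_eq)
  then have *: "reached \<phi> \<mu> r (queue ` {..<Suc h}) = reached \<phi> \<mu> r (queue ` {..<h})"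
    unfolding reached_def by simp
  show ?thesis
    by (rule sinvI, unfold *) (use sinvD[OF inv] assms(2,3) in auto)
qed

text \<open>The work still to be done: each vertex not yet dequeued pays for itself and for scanning
  the list of its mate. Restricting the sum to vertices with an edge is what makes a search cost
  \<open>O(m + 1)\<close> and not \<open>O(n + m)\<close>.\<close>

definition pot :: "(nat \<Rightarrow> nat) \<Rightarrow> (nat \<Rightarrow> nat) \<Rightarrow> nat \<Rightarrow> nat" where
  "pot \<mu> queue h = (\<Sum>y\<in>{y. y < p + n \<and> N y \<noteq> {}} - queue ` {..<h}. Suc (length (AL (\<mu> y))))"

lemma card_nonisolated: "card {y. y < p + n \<and> N y \<noteq> {}} \<le> 2 * m"
proof -
  have "card {y. y < p + n \<and> N y \<noteq> {}} = (\<Sum>y\<in>{y. y < p + n \<and> N y \<noteq> {}}. 1)" by simp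
  also have "\<dots> \<le> (\<Sum>y\<in>{y. y < p + n \<and> N y \<noteq> {}}. length (AL y))"
    by (rule sum_mono) (auto simp: N_empty_iff Suc_le_eq)
  also have "\<dots> \<le> (\<Sum>y<p + n. length (AL y))" by (rule sum_mono2) auto
  finally show ?thesis using sum_length by simp
qed

text \<open>At most \<open>2 * m\<close> vertices have an edge, and since \<open>\<mu>\<close> is a
  bijection the lists of the mates have total length at most \<open>2 * m\<close>.\<close>

lemma pot_le: "invol \<mu> \<Longrightarrow> pot \<mu> queue h \<le> 4 * m"
proof -
  assume \<mu>: "invol \<mu>"
  let ?B = "{y. y < p + n \<and> N y \<noteq> {}}"
  have "pot \<mu> queue h \<le> (\<Sum>y\<in>?B. Suc (length (AL (\<mu> y))))"
    unfolding pot_def by (rule sum_mono2) auto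
  also have "\<dots> = card ?B + (\<Sum>y\<in>?B. length (AL (\<mu> y)))" by (simp add: sum_Suc)
  also have "(\<Sum>y\<in>?B. length (AL (\<mu> y))) \<le> (\<Sum>y<p + n. length (AL (\<mu> y)))"
    by (rule sum_mono2) auto
  also have "(\<Sum>y<p + n. length (AL (\<mu> y))) = (\<Sum>y<p + n. length (AL y))"
    using sum.reindex_bij_betw[OF invol_bij_betw[OF \<mu>], of "\<lambda>y. length (AL y)"] .
  finally show ?thesis using sum_length card_nonisolated by linarith
qed

lemma pot_step:
  assumes inv: "sinv \<phi> \<mu> r x rest queue c h par rk tgt g" and h: "h < c"
    and r: "r < p + n" and \<mu>: "invol \<mu>"
  shows "pot \<mu> queue h = pot \<mu> queue (Suc h) + Suc (length (AL (\<mu> (queue h))))"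
proof -
  let ?B = "{y. y < p + n \<and> N y \<noteq> {}}"
  note I = sinvD[OF inv]
  have q: "queue h \<in> queue ` {..<c}" using h by simp
  note q' = treeD[OF I(3) q]
  have "par (queue h) < p + n"
  proof (cases "par (queue h) = r")
    case False
    then obtain y' where "y' \<in> queue ` {..<c}" "\<mu> y' = par (queue h)" using q'(4) by blast
    then show ?thesis using treeD(1)[OF I(3)] invol_D(1)[OF \<mu>, of y'] by simp
  qed (use r in simp)
  then have "queue h \<in> ?B" using q' N_D(2)[OF q'(3)] by auto
  moreover have "queue h \<notin> queue ` {..<h}"
  proof
    assume "queue h \<in> queue ` {..<h}"
    then obtain i where "i < h" "queue i = queue h" by auto
    then show False using I(2)[of i] I(2)[of h] h by simp
  qed
  moreover have "?B - queue ` {..<Suc h} = ?B - queue ` {..<h} - {queue h}"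
    by (auto simp: less_Suc_eq)
  ultimately show ?thesis unfolding pot_def
    using sum.remove[of "?B - queue ` {..<h}" "queue h" "\<lambda>y. Suc (length (AL (\<mu> y)))"] by simp
qed

end

text \<open>A flat loop body instead of nested loops: \<open>arc = 0\<close> means that the current
  list is exhausted, and the iteration dequeues a vertex; otherwise it scans one arc. Both cases
  then lower a single potential.\<close>

definition search_step :: "vname \<Rightarrow> com" where
  "search_step fl =
     If (Equal (Var ''arc'') (Num 0))
       (set_var ''y'' (Cell ''queue'' (Var ''done'')) ;;
        incr ''done'' ;;
        set_var ''z'' (Cell ''mate'' (Var ''y'')) ;;
        If (And (Equal (Cell fl (Var ''z'')) (Num 1)) (Not (Equal (Var ''z'') (Var ''y''))))
          (set_var ''x'' (Var ''z'') ;; set_var ''arc'' (Cell ''first'' (Var ''z'')))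
          (incr ''found'' ;; set_var ''goal'' (Var ''y'')))
       (set_var ''y'' (Cell ''dst'' (Var ''arc'')) ;;
        set_var ''arc'' (Cell ''next'' (Var ''arc'')) ;;
        If (Equal (Cell ''seen'' (Var ''y'')) (Var ''stamp''))
          Skip
          (Assign ''seen'' (Var ''y'') (Var ''stamp'') ;;
           Assign ''par'' (Var ''y'') (Var ''x'') ;;
           Assign ''rank'' (Var ''y'') (Var ''count'') ;;
           Assign ''queue'' (Var ''count'') (Var ''y'') ;;
           incr ''count''))"

text \<open>A fresh \<open>stamp\<close> invalidates the marks of all earlier searches, so that no
  array has to be cleared.\<close>

definition search :: "vname \<Rightarrow> com" where
  "search fl =
     incr ''stamp'' ;;
     set_var ''count'' (Num 0) ;; set_var ''done'' (Num 0) ;; set_var ''found'' (Num 0) ;;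
     set_var ''x'' (Var ''root'') ;; set_var ''arc'' (Cell ''first'' (Var ''root'')) ;;
     While (Not (And (Equal (Var ''arc'') (Num 0)) (Not (Less (Var ''done'') (Var ''count'')))))
       (search_step fl)"

definition search_vars :: "vname set" where
  "search_vars = {''stamp'', ''count'', ''done'', ''found'', ''x'', ''arc'', ''y'', ''z'',
     ''goal'', ''seen'', ''par'', ''rank'', ''queue''}"

lemma mods_search: "mods (search fl) = search_vars"
  unfolding search_def search_step_def search_vars_def by auto

section \<open>Correctness and running time of one search\<close>

context graph_mem
begin

text \<open>The bound on \<open>seen\<close> guarantees that incrementing \<open>stamp\<close>
  yields a mark that no vertex carries yet.\<close>

definition base :: "state \<Rightarrow> bool" where
  "base s \<longleftrightarrow> s ''first'' = fs \<and> s ''next'' = nx \<and> s ''dst'' = ds \<and>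
     s ''p'' 0 = p \<and> s ''n'' 0 = n \<and> s ''total'' 0 = p + n \<and> (\<forall>y. s ''seen'' y \<le> s ''stamp'' 0)"

text \<open>\<open>T\<close> is a deadline. Every arc or unit of potential is charged 100 time
  units, which covers one iteration of the loop; the summand 20 pays for the last evaluation of the
  guard, which costs 13.\<close>

definition search_inv :: "(nat \<Rightarrow> nat) \<Rightarrow> (nat \<Rightarrow> nat) \<Rightarrow> nat \<Rightarrow> nat \<Rightarrow> state \<Rightarrow> nat \<Rightarrow> bool" where
  "search_inv \<phi> \<mu> r T s t \<longleftrightarrow>
     (\<forall>y. s ''seen'' y \<le> s ''stamp'' 0) \<and>
     (\<forall>y. s ''seen'' y = s ''stamp'' 0 \<longleftrightarrow> y \<in> s ''queue'' ` {..<s ''count'' 0}) \<and>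
     (\<exists>rest. linked nx (s ''arc'' 0) rest \<and>
        sinv \<phi> \<mu> r (s ''x'' 0) rest (s ''queue'')
          (s ''count'' 0) (s ''done'' 0) (s ''par'') (s ''rank'') (s ''found'' 0) (s ''goal'' 0) \<and>
        t + 100 * (length rest + pot \<mu> (s ''queue'') (s ''done'' 0)) + 20 \<le> T)"

lemma search_invI:
  assumes "\<And>y. s ''seen'' y \<le> s ''stamp'' 0"
    "\<And>y. s ''seen'' y = s ''stamp'' 0 \<longleftrightarrow> y \<in> s ''queue'' ` {..<s ''count'' 0}"
    "linked nx (s ''arc'' 0) rest"
    "sinv \<phi> \<mu> r (s ''x'' 0) rest (s ''queue'')
       (s ''count'' 0) (s ''done'' 0) (s ''par'') (s ''rank'') (s ''found'' 0) (s ''goal'' 0)"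
    "t + 100 * (length rest + pot \<mu> (s ''queue'') (s ''done'' 0)) + 20 \<le> T"
  shows "search_inv \<phi> \<mu> r T s t"
  using assms unfolding search_inv_def by blast

lemma search_invD:
  assumes "search_inv \<phi> \<mu> r T s t"
  shows "s ''seen'' y \<le> s ''stamp'' 0" "t + 20 \<le> T"
proof -
  show "s ''seen'' y \<le> s ''stamp'' 0" using assms unfolding search_inv_def by blast
  obtain rest :: "nat list" where "t + 100 * (length rest + pot \<mu> (s ''queue'') (s ''done'' 0)) + 20 \<le> T"
    using assms unfolding search_inv_def by blast
  then show "t + 20 \<le> T" by linarith
qed

lemma pot_fun_upd: "h \<le> c \<Longrightarrow> pot \<mu> (queue(c := y)) h = pot \<mu> queue h"
proof -
  assume "h \<le> c"
  then have "queue(c := y) ` {..<h} = queue ` {..<h}" by (auto simp: image_iff)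
  then show ?thesis unfolding pot_def by simp
qed

lemma search_step_correct:
  assumes inv: "search_inv \<phi> \<mu> r T s t" and more: "\<not> (s ''arc'' 0 = 0 \<and> \<not> s ''done'' 0 < s ''count'' 0)"
    and fl: "fl \<notin> search_vars" "s fl = \<phi>"
    and f: "s ''mate'' = \<mu>" "s ''first'' = fs" "s ''next'' = nx" "s ''dst'' = ds"
    and \<mu>: "invol \<mu>" and r: "r < p + n"
  shows "wp (search_step fl) (search_inv \<phi> \<mu> r T) s (t + 13)"
proof -
  have names: "fl \<noteq> ''stamp''" "fl \<noteq> ''count''" "fl \<noteq> ''done''" "fl \<noteq> ''found''" "fl \<noteq> ''x''"
    "fl \<noteq> ''arc''" "fl \<noteq> ''y''" "fl \<noteq> ''z''" "fl \<noteq> ''goal''" "fl \<noteq> ''seen''" "fl \<noteq> ''par''"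
    "fl \<noteq> ''rank''" "fl \<noteq> ''queue''"
    using fl unfolding search_vars_def by auto
  obtain rest where rest: "linked nx (s ''arc'' 0) rest"
    and si: "sinv \<phi> \<mu> r (s ''x'' 0) rest (s ''queue'') (s ''count'' 0) (s ''done'' 0)
        (s ''par'') (s ''rank'') (s ''found'' 0) (s ''goal'' 0)"
    and time: "t + 100 * (length rest + pot \<mu> (s ''queue'') (s ''done'' 0)) + 20 \<le> T"
    using inv unfolding search_inv_def by blast
  have st: "\<And>y. s ''seen'' y \<le> s ''stamp'' 0"
    "\<And>y. s ''seen'' y = s ''stamp'' 0 \<longleftrightarrow> y \<in> s ''queue'' ` {..<s ''count'' 0}"
    using inv unfolding search_inv_def by blast+
  show ?thesis
  proof (cases "s ''arc'' 0 = 0")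
    case True
    then have rest0: "rest = []" using rest by (cases rest) auto
    let ?y = "s ''queue'' (s ''done'' 0)"
    have h: "s ''done'' 0 < s ''count'' 0" using more True by simp
    have pot: "pot \<mu> (s ''queue'') (s ''done'' 0) =
        pot \<mu> (s ''queue'') (Suc (s ''done'' 0)) + Suc (length (AL (\<mu> ?y)))"
      by (rule pot_step[OF si h r \<mu>])
    have y: "\<mu> ?y < p + n"
      using treeD(1)[OF sinvD(3)[OF si]] h invol_D(1)[OF \<mu>] by simp
    show ?thesis
    proof (cases "pass \<phi> \<mu> ?y")
      case ps: True
      show ?thesis unfolding search_step_def using ps unfolding pass_def
        by (simp add: wp_simps True f fl(2) names, intro search_invI[where rest = "AL (\<mu> ?y)"])
          (use time pot rest0 st linked[OF y] sinv_pass[OF si[unfolded rest0] h ps] in simp_all)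
    next
      case ps: False
      then consider "\<phi> (\<mu> ?y) \<noteq> 1" | "\<mu> ?y = ?y" unfolding pass_def by blast
      then show ?thesis
      proof cases
        case 1
        then show ?thesis unfolding search_step_def
          by (simp add: wp_simps True f fl(2) names, intro search_invI[where rest = "[]"])
            (use time pot rest0 st True sinv_target[OF si[unfolded rest0] h ps] in simp_all)
      next
        case 2
        then show ?thesis unfolding search_step_def
          by (simp add: wp_simps True f fl(2) names, intro search_invI[where rest = "[]"])
            (use time pot rest0 st True sinv_target[OF si[unfolded rest0] h ps] in simp_all)
      qed
    qed
  next
    case False
    then obtain a rest' where rest': "rest = a # rest'" "s ''arc'' 0 = a" "linked nx (nx a) rest'"
      using rest by (cases rest) auto
    have hc: "s ''done'' 0 \<le> s ''count'' 0" by (rule sinvD(1)[OF si])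
    show ?thesis
    proof (cases "ds a \<in> s ''queue'' ` {..<s ''count'' 0}")
      case True
      have seen: "s ''seen'' (ds a) = s ''stamp'' 0" using st True by blast
      show ?thesis unfolding search_step_def using False
        by (simp add: wp_simps f rest'(2) seen, intro search_invI[where rest = rest'])
          (use time rest' st sinv_old[OF si[unfolded rest'] True] in simp_all)
    next
      case new: False
      let ?c = "s ''count'' 0"
      have seen: "s ''seen'' (ds a) \<noteq> s ''stamp'' 0" using st new by blast
      have V: "(s ''queue'')(?c := ds a) ` {..<Suc ?c} = insert (ds a) (s ''queue'' ` {..<?c})"
        by (auto simp: image_iff less_Suc_eq)
      show ?thesis unfolding search_step_def using False
        by (simp add: wp_simps f rest'(2) seen, intro search_invI[where rest = rest'])
          (use time rest' st sinv_new[OF si[unfolded rest'] new \<mu> r] V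
             pot_fun_upd[OF hc, of \<mu> "s ''queue''" "ds a"] in simp_all)
    qed
  qed
qed

text \<open>The bound on \<open>rank\<close> limits the time for flipping a path, and
  \<open>count\<close> lets the last phase recognise that all of \<open>V^-\<close> was
  visited.\<close>

definition search_post :: "(nat \<Rightarrow> nat) \<Rightarrow> (nat \<Rightarrow> nat) \<Rightarrow> nat \<Rightarrow> state \<Rightarrow> nat set \<Rightarrow> bool" where
  "search_post \<phi> \<mu> r s vis \<longleftrightarrow>
     tree \<phi> \<mu> r vis (s ''par'') (s ''rank'') \<and>
     (\<forall>x\<in>reached \<phi> \<mu> r vis. N x \<subseteq> vis) \<and>
     (s ''found'' 0 = 0 \<longrightarrow> (\<forall>y\<in>vis. pass \<phi> \<mu> y)) \<and>
     (s ''found'' 0 \<noteq> 0 \<longrightarrow> s ''goal'' 0 \<in> vis \<and> \<not> pass \<phi> \<mu> (s ''goal'' 0)) \<and>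
     s ''count'' 0 = card vis \<and> (\<forall>y\<in>vis. s ''rank'' y < 2 * m)"

lemma search_postD:
  assumes "search_post \<phi> \<mu> r s vis"
  shows "tree \<phi> \<mu> r vis (s ''par'') (s ''rank'')"
    "\<And>x. x \<in> reached \<phi> \<mu> r vis \<Longrightarrow> N x \<subseteq> vis"
    "\<And>y. s ''found'' 0 = 0 \<Longrightarrow> y \<in> vis \<Longrightarrow> pass \<phi> \<mu> y"
    "s ''found'' 0 \<noteq> 0 \<Longrightarrow> s ''goal'' 0 \<in> vis \<and> \<not> pass \<phi> \<mu> (s ''goal'' 0)"
    "s ''count'' 0 = card vis" "\<And>y. y \<in> vis \<Longrightarrow> s ''rank'' y < 2 * m"
  using assms unfolding search_post_def by blast+

lemma search_exit:
  assumes inv: "search_inv \<phi> \<mu> r T s t" and exit: "s ''arc'' 0 = 0" "\<not> s ''done'' 0 < s ''count'' 0"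
    and \<mu>: "invol \<mu>" and r: "r < p + n"
  shows "search_post \<phi> \<mu> r s (s ''queue'' ` {..<s ''count'' 0})"
proof -
  let ?c = "s ''count'' 0"
  obtain rest where rest: "linked nx (s ''arc'' 0) rest"
    and si: "sinv \<phi> \<mu> r (s ''x'' 0) rest (s ''queue'') ?c (s ''done'' 0)
        (s ''par'') (s ''rank'') (s ''found'' 0) (s ''goal'' 0)"
    using inv unfolding search_inv_def by blast
  note I = sinvD[OF si]
  have "rest = []" using rest exit by (cases rest) auto
  have h: "s ''done'' 0 = ?c" using I(1) exit by simp
  let ?vis = "s ''queue'' ` {..<?c}"
  have inj: "inj_on (s ''queue'') {..<?c}" by (rule inj_onI) (metis I(2) lessThan_iff)
  then have card: "card ?vis = ?c" by (simp add: card_image)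
  have "?vis \<subseteq> {y. y < p + n \<and> N y \<noteq> {}}"
  proof
    fix y assume y: "y \<in> ?vis"
    note q' = treeD[OF I(3) y]
    have "par < p + n" if "par = s ''par'' y" for par
    proof (cases "par = r")
      case False
      then obtain y' where "y' \<in> ?vis" "\<mu> y' = par" using q'(4) \<open>par = _\<close> by blast
      then show ?thesis using treeD(1)[OF I(3)] invol_D(1)[OF \<mu>, of y'] by simp
    qed (use r in simp)
    then show "y \<in> {y. y < p + n \<and> N y \<noteq> {}}" using q' N_D(2)[OF q'(3)] by auto
  qed
  then have "card ?vis \<le> card {y. y < p + n \<and> N y \<noteq> {}}" by (intro card_mono) auto
  then have c: "?c \<le> 2 * m" using card card_nonisolated by linarith
  show ?thesis unfolding search_post_def
  proof (intro conjI ballI impI)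
    fix x assume "x \<in> reached \<phi> \<mu> r ?vis"
    then show "N x \<subseteq> ?vis" using I(6)[unfolded h] \<open>rest = []\<close> by simp
  next
    fix y assume "y \<in> ?vis"
    then show "s ''rank'' y < 2 * m" using I(2) c by auto
  next
    fix y assume "s ''found'' 0 = 0" "y \<in> ?vis"
    then show "pass \<phi> \<mu> y" using I(7) h by auto
  qed (use I card in simp_all)
qed

lemma search_correct:
  assumes b: "base s" and \<mu>: "invol (s ''mate'')" and r: "s ''root'' 0 < p + n"
    and fl: "fl \<notin> search_vars"
    and Q: "\<And>s' t' vis. \<lbrakk>\<forall>v. v \<notin> search_vars \<longrightarrow> s' v = s v; base s';
      search_post (s fl) (s ''mate'') (s ''root'' 0) s' vis; t' \<le> t + 700 * (m + 1)\<rbrakk> \<Longrightarrow> Q s' t'"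
  shows "wp (search fl) Q s t"
proof -
  let ?\<mu> = "s ''mate''" and ?r = "s ''root'' 0"
  let ?c = "Not (And (Equal (Var ''arc'') (Num 0)) (Not (Less (Var ''done'') (Var ''count''))))"
  have f: "s ''first'' = fs" "s ''next'' = nx" "s ''dst'' = ds"
    and seen: "\<And>y. s ''seen'' y \<le> s ''stamp'' 0"
    using b unfolding base_def by auto
  let ?s = "s(''stamp'' := (s ''stamp'')(0 := Suc (s ''stamp'' 0)), ''count'' := (s ''count'')(0 := 0),
    ''done'' := (s ''done'')(0 := 0), ''found'' := (s ''found'')(0 := 0),
    ''x'' := (s ''x'')(0 := ?r), ''arc'' := (s ''arc'')(0 := fs ?r))"
  have len: "length (AL ?r) \<le> 2 * m"
    using member_le_sum[of ?r "{..<p + n}" "\<lambda>v. length (AL v)"] r sum_length by simp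
  \<comment> \<open>The root has at most \<open>2 * m\<close> arcs and the potential is at most
    \<open>4 * m\<close>, each unit being charged 100.\<close>
  let ?T = "t + 700 * m + 80"
  have step: "wp (While ?c (search_step fl)) (\<lambda>s' t'. (\<forall>v. v \<notin> search_vars \<longrightarrow> s' v = ?s v) \<and>
         (\<exists>t1. t' = t1 + 13 \<and> search_inv (s fl) ?\<mu> ?r ?T s' t1 \<and> s' ''arc'' 0 = 0 \<and> \<not> s' ''done'' 0 < s' ''count'' 0))
       ?s (t + 24)"
  proof (rule wp_While_frameI[where I = "search_inv (s fl) ?\<mu> ?r ?T" and K = ?T])
    have ne: "s ''seen'' y \<noteq> Suc (s ''stamp'' 0)" for y using seen[of y] by simp
    show "search_inv (s fl) ?\<mu> ?r ?T ?s (t + 24)"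
    proof (rule search_invI[where rest = "AL ?r"])
      show "?s ''seen'' y \<le> ?s ''stamp'' 0" for y using seen[of y] by simp
      show "?s ''seen'' y = ?s ''stamp'' 0 \<longleftrightarrow> y \<in> ?s ''queue'' ` {..<?s ''count'' 0}" for y
        using ne[of y] by simp
      show "linked nx (?s ''arc'' 0) (AL ?r)" using linked[OF r] by simp
      show "t + 24 + 100 * (length (AL ?r) + pot ?\<mu> (?s ''queue'') (?s ''done'' 0)) + 20 \<le> ?T"
        using pot_le[OF \<mu>, of "s ''queue''" 0] len by simp
    qed (simp add: sinv_init)
  next
    fix s1 t1 assume I: "search_inv (s fl) ?\<mu> ?r ?T s1 t1"
      and fr: "\<forall>x. x \<notin> mods (search_step fl) \<longrightarrow> s1 x = ?s x"
      and c: "bval ?c s1"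
    have md: "mods (search_step fl) \<subseteq> search_vars"
      unfolding search_step_def search_vars_def by auto
    have fr': "s1 v = s v" if v: "v \<notin> search_vars" for v
    proof -
      have "v \<notin> mods (search_step fl)" using v md by blast
      then have "s1 v = ?s v" using fr by blast
      also have "\<dots> = s v" using v unfolding search_vars_def by simp
      finally show ?thesis .
    qed
    have mate: "s1 ''mate'' = ?\<mu>" "s1 ''first'' = s ''first''" "s1 ''next'' = s ''next''" "s1 ''dst'' = s ''dst''"
      by (rule fr', simp add: search_vars_def)+
    have "wp (search_step fl) (search_inv (s fl) ?\<mu> ?r ?T) s1 (t1 + 13)"
    proof (rule search_step_correct[OF I _ fl _ _ _ _ _ \<mu> r])
      show "\<not> (s1 ''arc'' 0 = 0 \<and> \<not> s1 ''done'' 0 < s1 ''count'' 0)" using c by simp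
    qed (simp_all add: mate f fr'[OF fl])
    then show "wp (search_step fl) (search_inv (s fl) ?\<mu> ?r ?T) s1 (t1 + (1 + bcost ?c))"
      by (simp add: eval_nat_numeral)
  next
    fix s1 t1 assume I: "search_inv (s fl) ?\<mu> ?r ?T s1 t1"
      and fr: "\<forall>x. x \<notin> mods (search_step fl) \<longrightarrow> s1 x = ?s x"
      and c: "\<not> bval ?c s1"
    have md: "mods (search_step fl) \<subseteq> search_vars"
      unfolding search_step_def search_vars_def by auto
    then have "\<forall>v. v \<notin> search_vars \<longrightarrow> s1 v = ?s v" using fr by blast
    then show "(\<forall>v. v \<notin> search_vars \<longrightarrow> s1 v = ?s v) \<and>
         (\<exists>ta. t1 + (1 + bcost ?c) = ta + 13 \<and> search_inv (s fl) ?\<mu> ?r ?T s1 ta \<and> s1 ''arc'' 0 = 0 \<and> \<not> s1 ''done'' 0 < s1 ''count'' 0)"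
      using I c by (simp add: eval_nat_numeral)
  qed (use search_invD(2) add_leD1 in blast)
  have "wp (search fl) Q s t = wp (While ?c (search_step fl)) Q ?s (t + 24)"
    unfolding search_def by (simp add: wp_simps f eval_nat_numeral)
  moreover have "wp (While ?c (search_step fl)) Q ?s (t + 24)"
  proof (rule wp_mono[OF step])
    fix s' t' assume *: "(\<forall>v. v \<notin> search_vars \<longrightarrow> s' v = ?s v) \<and>
         (\<exists>t1. t' = t1 + 13 \<and> search_inv (s fl) ?\<mu> ?r ?T s' t1 \<and> s' ''arc'' 0 = 0 \<and> \<not> s' ''done'' 0 < s' ''count'' 0)"
    then obtain t1 where t1: "t' = t1 + 13" "search_inv (s fl) ?\<mu> ?r ?T s' t1"
       "s' ''arc'' 0 = 0" "\<not> s' ''done'' 0 < s' ''count'' 0" by blast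
    have fr: "\<forall>v. v \<notin> search_vars \<longrightarrow> s' v = s v" using * unfolding search_vars_def by simp
    have "base s'" using b fr search_invD(1)[OF t1(2)] unfolding base_def search_vars_def by simp
    moreover have "t' \<le> t + 700 * (m + 1)" using t1(1) search_invD(2)[OF t1(2)] by simp
    ultimately show "Q s' t'" using Q[OF fr _ search_exit[OF t1(2-4) \<mu> r]] by blast
  qed
  ultimately show ?thesis by simp
qed

end

section \<open>Augmentation\<close>

text \<open>Forces the pair \<open>x\<close>, \<open>y\<close> into the matching and exposes their
  former mates. Iterated along a tree path it amounts to the symmetric difference with an
  alternating path.\<close>

definition link :: "(nat \<Rightarrow> nat) \<Rightarrow> nat \<Rightarrow> nat \<Rightarrow> nat \<Rightarrow> nat" where
  "link \<mu> x y v =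
     (if v = x then y else if v = y then x else if v = \<mu> x \<or> v = \<mu> y then v else \<mu> v)"

text \<open>\<open>z\<close> is the former mate of the parent \<open>x\<close>, where the walk
  continues. The root is exposed, so \<open>z = x\<close> marks the end of the path. Exposing the
  mate of \<open>y\<close> has an effect only in the first iteration, when the target is
  matched.\<close>

definition flip_step :: com where
  "flip_step =
     set_var ''x'' (Cell ''par'' (Var ''y'')) ;;
     set_var ''z'' (Cell ''mate'' (Var ''x'')) ;;
     Assign ''mate'' (Var ''z'') (Var ''z'') ;;
     Assign ''mate'' (Cell ''mate'' (Var ''y'')) (Cell ''mate'' (Var ''y'')) ;;
     Assign ''mate'' (Var ''x'') (Var ''y'') ;;
     Assign ''mate'' (Var ''y'') (Var ''x'') ;;
     If (Equal (Var ''z'') (Var ''x'')) (set_var ''go'' (Num 0)) (set_var ''y'' (Var ''z''))"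

definition flip :: com where
  "flip =
     set_var ''y'' (Var ''goal'') ;; set_var ''go'' (Num 1) ;;
     While (Equal (Var ''go'') (Num 1)) flip_step"

text \<open>A target may be matched to an unflagged vertex; flipping then covers the root at the
  expense of that vertex, while all flagged vertices stay covered.\<close>

definition augment :: "vname \<Rightarrow> com" where
  "augment fl =
     If (Equal (Cell ''mate'' (Var ''root'')) (Var ''root''))
       (search fl ;; If (Less (Num 0) (Var ''found'')) flip Skip) Skip"

text \<open>The root is flagged before the search, so that reaching its own mate does not count as
  an escape; the flag is withdrawn if the search finds no target.\<close>

definition probe :: com where
  "probe =
     If (Equal (Cell ''mate'' (Var ''root'')) (Var ''root'')) Skip
       (Assign ''ind'' (Var ''root'') (Num 1) ;; search ''ind'' ;;
        If (Equal (Var ''found'') (Num 0)) (Assign ''ind'' (Var ''root'') (Num 0)) Skip)"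

definition flip_vars :: "vname set" where
  "flip_vars = {''x'', ''y'', ''z'', ''go'', ''mate''}"

context graph_mem
begin

definition matching :: "(nat \<Rightarrow> nat) \<Rightarrow> bool" where
  "matching \<mu> \<longleftrightarrow> invol \<mu> \<and> (\<forall>x<p + n. \<mu> x \<noteq> x \<longrightarrow> \<mu> x \<in> N x)"

abbreviation Gam :: "nat set \<Rightarrow> nat set" where
  "Gam \<equiv> nbrs N"

lemma matching_link:
  assumes \<mu>: "matching \<mu>" and x: "x < p + n" and y: "y \<in> N x"
  shows "matching (link \<mu> x y)"
proof -
  note I = invol_D[OF \<mu>[unfolded matching_def, THEN conjunct1]]
  note yx = N_D[OF y x]
  have e: "v < p + n \<Longrightarrow> \<mu> v \<noteq> v \<Longrightarrow> \<mu> v \<in> N v" for v using \<mu> unfolding matching_def by blast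
  have xy: "x \<noteq> y" using yx(3) by auto
  have 1: "link \<mu> x y v < p + n \<and> link \<mu> x y (link \<mu> x y v) = v \<and>
     (link \<mu> x y v \<noteq> v \<longrightarrow> link \<mu> x y v \<in> N v)" if v: "v < p + n" for v
  proof (cases "v = x \<or> v = y")
    case True
    then show ?thesis using x y yx xy unfolding link_def by auto
  next
    case F: False
    show ?thesis
    proof (cases "v = \<mu> x \<or> v = \<mu> y")
      case True
      then show ?thesis using F v unfolding link_def by auto
    next
      case False
      have "\<mu> v \<noteq> x" "\<mu> v \<noteq> y" using I(2)[OF v] False by auto
      moreover have "\<mu> v \<noteq> \<mu> x" "\<mu> v \<noteq> \<mu> y"
        using I(2)[OF v] I(2)[OF x] I(2)[OF yx(1)] F by metis+
      ultimately show ?thesis using F False I[OF v] e[OF v] unfolding link_def by auto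
    qed
  qed
  then have "link \<mu> x y v \<noteq> v \<Longrightarrow> v < p + n \<Longrightarrow> (link \<mu> x y v < p \<longleftrightarrow> \<not> v < p)" for v
    using N_D(3) by blast
  with 1 show ?thesis unfolding matching_def invol_def by blast
qed

lemma link_upd:
  "x \<noteq> y \<Longrightarrow> \<mu>(\<mu> x := \<mu> x, \<mu> y := \<mu> y, x := y, y := x) = link \<mu> x y"
  unfolding link_def by (auto simp: fun_eq_iff)

text \<open>\<open>\<mu>0\<close> is the matching before the search.  The alternating path has been flipped from the target
  \<open>g\<close> back to \<open>y\<close>, and the tree is intact at all ranks below that of \<open>y\<close>.\<close>

definition flip_inv where
  "flip_inv \<phi> \<mu>0 r g vis (rk :: nat \<Rightarrow> nat) \<mu> y \<longleftrightarrow>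
     matching \<mu> \<and> y \<in> vis \<and> \<mu> r = r \<and> (\<mu> y = y \<or> y = g \<and> \<mu> y = \<mu>0 g) \<and>
     (\<forall>y'\<in>vis. pass \<phi> \<mu>0 y' \<and> rk y' < rk y \<longrightarrow> \<mu> y' = \<mu>0 y' \<and> \<mu> (\<mu>0 y') = y') \<and>
     (\<forall>x<p + n. \<mu>0 x \<noteq> x \<and> x \<noteq> \<mu>0 g \<and> x \<noteq> y \<longrightarrow> \<mu> x \<noteq> x)"

lemma flip_invD:
  assumes "flip_inv \<phi> \<mu>0 r g vis rk \<mu> y"
  shows "matching \<mu>" "y \<in> vis" "\<mu> r = r" "\<mu> y = y \<or> y = g \<and> \<mu> y = \<mu>0 g"
    "\<And>y'. y' \<in> vis \<Longrightarrow> pass \<phi> \<mu>0 y' \<Longrightarrow> rk y' < rk y \<Longrightarrow> \<mu> y' = \<mu>0 y' \<and> \<mu> (\<mu>0 y') = y'"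
    "\<And>x. x < p + n \<Longrightarrow> \<mu>0 x \<noteq> x \<Longrightarrow> x \<noteq> \<mu>0 g \<Longrightarrow> x \<noteq> y \<Longrightarrow> \<mu> x \<noteq> x"
  using assms unfolding flip_inv_def by blast+

definition flip_done where
  "flip_done \<mu>0 r g \<mu> \<longleftrightarrow>
     matching \<mu> \<and> \<mu> r \<noteq> r \<and> (\<forall>x<p + n. \<mu>0 x \<noteq> x \<and> x \<noteq> \<mu>0 g \<longrightarrow> \<mu> x \<noteq> x)"

text \<open>Earlier flips changed the tree only at larger ranks. Hence a parent other than the root
  is still matched to its predecessor in the tree, which has smaller rank; only the root is
  exposed.\<close>

lemma flip_inv_step:
  assumes inv: "flip_inv \<phi> \<mu>0 r g vis rk \<mu> y" and tree: "tree \<phi> \<mu>0 r vis par rk"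
    and \<mu>0: "invol \<mu>0" and r: "r < p + n"
  shows "if \<mu> (par y) = par y then flip_done \<mu>0 r g (link \<mu> (par y) y)
    else flip_inv \<phi> \<mu>0 r g vis rk (link \<mu> (par y) y) (\<mu> (par y)) \<and> rk (\<mu> (par y)) < rk y"
proof -
  note I = flip_invD[OF inv]
  note T = treeD[OF tree]
  let ?x = "par y"
  let ?\<mu>' = "link \<mu> ?x y"
  note I\<mu> = invol_D[OF I(1)[unfolded matching_def, THEN conjunct1]]
  note I0 = invol_D[OF \<mu>0]
  have y: "y < p + n" "y < p \<longleftrightarrow> \<not> r < p" "y \<in> N ?x" using T[OF I(2)] by auto
  have x: "?x < p + n \<and> (?x < p \<longleftrightarrow> r < p)"
  proof (cases "?x = r")
    case False
    then obtain y' where "y' \<in> vis" "pass \<phi> \<mu>0 y'" "\<mu>0 y' = ?x" using T(4)[OF I(2)] by blast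
    then show ?thesis using T(1,2)[of y'] I0[of y'] unfolding pass_def by auto
  qed (use r in simp)
  have m: "matching ?\<mu>'" using matching_link[OF I(1) _ y(3)] x by blast
  show ?thesis
  proof (cases "\<mu> ?x = ?x")
    case True
    have "?x = r"
    proof (rule ccontr)
      assume "?x \<noteq> r"
      then obtain y' where y': "y' \<in> vis" "pass \<phi> \<mu>0 y'" "\<mu>0 y' = ?x" "rk y' < rk y"
        using T(4)[OF I(2)] by blast
      then have "\<mu> ?x = y'" using I(5)[OF y'(1,2,4)] by simp
      then show False using y' True unfolding pass_def by simp
    qed
    moreover have "?\<mu>' v \<noteq> v" if "v < p + n" "\<mu>0 v \<noteq> v" "v \<noteq> \<mu>0 g" for v
      using I(4) I(6)[OF that] x y that True unfolding link_def by auto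
    ultimately show ?thesis using m True y x unfolding flip_done_def link_def by auto
  next
    case False
    then have "?x \<noteq> r" using I(3) by auto
    then obtain z where z: "z \<in> vis" "pass \<phi> \<mu>0 z" "\<mu>0 z = ?x" "rk z < rk y"
      using T(4)[OF I(2)] by blast
    have zx: "\<mu> ?x = z" using I(5)[OF z(1,2,4)] z(3) by simp
    have zs: "z < p + n" "z < p \<longleftrightarrow> \<not> r < p" using T[OF z(1)] by auto
    have "flip_inv \<phi> \<mu>0 r g vis rk ?\<mu>' z"
      unfolding flip_inv_def
    proof (intro conjI ballI allI impI)
      show "?\<mu>' r = r" using x y I(3) \<open>?x \<noteq> r\<close> unfolding link_def by auto
      have "?\<mu>' z = z" using zx zs z(4) x unfolding link_def by auto
      then show "?\<mu>' z = z \<or> z = g \<and> ?\<mu>' z = \<mu>0 g" ..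
    next
      fix v assume *: "v \<in> vis" "pass \<phi> \<mu>0 v \<and> rk v < rk z"
      then have v: "v < p + n" "v < p \<longleftrightarrow> \<not> r < p" "pass \<phi> \<mu>0 v" "rk v < rk z" using T by auto
      have old: "\<mu> v = \<mu>0 v" "\<mu> (\<mu>0 v) = v" using I(5)[OF *(1) v(3)] v(4) z(4) by auto
      have w: "\<mu>0 v < p \<longleftrightarrow> r < p" using I0(3)[OF v(1)] v unfolding pass_def by auto
      have ne: "v \<noteq> y" "v \<noteq> z" using v(4) z(4) by auto
      have "v \<noteq> \<mu> y"
      proof
        assume "v = \<mu> y"
        then have "\<mu> v = y" using I\<mu>(2)[OF y(1)] by simp
        then show False using old(1) w y(2) by auto
      qed
      then show "?\<mu>' v = \<mu>0 v" using ne v x zx old unfolding link_def by auto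
      have "\<mu>0 v \<noteq> ?x" using I0(2)[OF v(1)] I0(2)[OF zs(1)] z(3) ne by metis
      moreover have "\<mu>0 v \<noteq> \<mu> y" using old(2) I\<mu>(2)[OF y(1)] ne(1) by metis
      ultimately show "?\<mu>' (\<mu>0 v) = v" using w y zx zs old unfolding link_def by auto
    next
      fix v assume "v < p + n" "\<mu>0 v \<noteq> v \<and> v \<noteq> \<mu>0 g \<and> v \<noteq> z"
      then show "?\<mu>' v \<noteq> v" using I(4) I(6)[of v] x y zx unfolding link_def by auto
    qed (use m z in auto)
    then show ?thesis using False zx z(4) by simp
  qed
qed

text \<open>A set containing the root and closed under going to a neighbour and on to its mate traps
  the search; the induction is on \<open>rk\<close>.\<close>

lemma tree_sound:
  assumes tree: "tree \<phi> \<mu> r vis par rk" and r: "r \<in> X"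
    and cl: "\<And>x y. x \<in> X \<Longrightarrow> y \<in> N x \<Longrightarrow> pass \<phi> \<mu> y \<Longrightarrow> \<mu> y \<in> X"
  shows "vis \<subseteq> Gam X"
proof
  fix y assume "y \<in> vis"
  then show "y \<in> Gam X"
  proof (induction "rk y" arbitrary: y rule: less_induct)
    case less
    have "par y \<in> X"
    proof (cases "par y = r")
      case False
      then obtain y' where y': "y' \<in> vis" "pass \<phi> \<mu> y'" "\<mu> y' = par y" "rk y' < rk y"
        using treeD(4)[OF tree less.prems] by blast
      then have "y' \<in> Gam X" using less.hyps by blast
      then obtain x where "x \<in> X" "y' \<in> N x" unfolding nbrs_def by blast
      then show ?thesis using cl[of x y'] y' by simp
    qed (use r in simp)
    then show ?case using treeD(3)[OF tree less.prems] unfolding nbrs_def by blast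
  qed
qed

definition flip_loop_inv where
  "flip_loop_inv \<phi> \<mu>0 r g vis rk T s t \<longleftrightarrow>
     (s ''go'' 0 = (1::nat) \<longrightarrow> flip_inv \<phi> \<mu>0 r g vis rk (s ''mate'') (s ''y'' 0) \<and>
        t + 80 * (rk (s ''y'' 0) + 1) \<le> T) \<and>
     (s ''go'' 0 \<noteq> 1 \<longrightarrow> flip_done \<mu>0 r g (s ''mate'') \<and> t \<le> (T::nat))"

lemma flip_correct:
  assumes b: "base s" and post: "search_post \<phi> (s ''mate'') r s vis" and found: "s ''found'' 0 \<noteq> 0"
    and m: "matching (s ''mate'')" and r: "r < p + n" "s ''mate'' r = r"
    and Q: "\<And>s' t'. \<lbrakk>\<forall>v. v \<notin> flip_vars \<longrightarrow> s' v = s v; matching (s' ''mate'');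
      s' ''mate'' r \<noteq> r;
      \<forall>x<p + n. s ''mate'' x \<noteq> x \<and> x \<noteq> s ''mate'' (s ''goal'' 0) \<longrightarrow> s' ''mate'' x \<noteq> x;
      t' \<le> t + 200 * (m + 1)\<rbrakk> \<Longrightarrow> Q s' t'"
  shows "wp flip Q s t"
proof -
  let ?\<mu> = "s ''mate''" and ?g = "s ''goal'' 0" and ?par = "s ''par''" and ?rk = "s ''rank''"
  note P = search_postD[OF post]
  let ?s = "s(''y'' := (s ''y'')(0 := ?g), ''go'' := (s ''go'')(0 := 1))"
  \<comment> \<open>The path has at most \<open>2 * m\<close> steps of 80 units each; the 10 units
    held back pay for the final evaluation of the guard.\<close>
  let ?T = "t + 200 * (m + 1) - 10"
  let ?I = "flip_loop_inv \<phi> ?\<mu> r ?g vis ?rk ?T"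
  have md: "mods flip_step \<subseteq> flip_vars"
    unfolding flip_step_def flip_vars_def by auto
  have "wp (While (Equal (Var ''go'') (Num 1)) flip_step) Q ?s (t + 7)"
  proof (rule wp_While_frameI[where I = ?I and K = ?T])
    have "flip_inv \<phi> ?\<mu> r ?g vis ?rk ?\<mu> ?g"
      unfolding flip_inv_def
    proof (intro conjI ballI impI)
      fix y' assume "y' \<in> vis"
      then show "?\<mu> (?\<mu> y') = y'"
        using invol_D(2)[OF m[unfolded matching_def, THEN conjunct1] treeD(1)[OF P(1)]] by simp
    qed (use P(4) found m r(2) in auto)
    then show "?I ?s (t + 7)" using P(4) P(6)[of ?g] found unfolding flip_loop_inv_def by simp
  next
    fix s1 t1 assume I: "?I s1 t1"
    show "t1 \<le> ?T" using I unfolding flip_loop_inv_def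
      by (cases "s1 ''go'' 0 = 1") linarith+
  next
    fix s1 t1 assume I: "?I s1 t1" and fr: "\<forall>x. x \<notin> mods flip_step \<longrightarrow> s1 x = ?s x"
      and c: "bval (Equal (Var ''go'') (Num 1)) s1"
    have par: "s1 ''par'' = ?par" using frameD[OF fr md, of "''par''"] by (simp add: flip_vars_def)
    have go: "s1 ''go'' 0 = 1" using c by simp
    have inv: "flip_inv \<phi> ?\<mu> r ?g vis ?rk (s1 ''mate'') (s1 ''y'' 0)"
      and time: "t1 + 80 * (?rk (s1 ''y'' 0) + 1) \<le> ?T" using I go unfolding flip_loop_inv_def by blast+
    let ?y = "s1 ''y'' 0" let ?x = "?par ?y" let ?z = "s1 ''mate'' ?x"
    note st = flip_inv_step[OF inv P(1) m[unfolded matching_def, THEN conjunct1] r(1)]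
    note iv = flip_invD[OF inv]
    have xy: "?x \<noteq> ?y"
    proof (cases "?x = r")
      case True
      then show ?thesis using treeD(2)[OF P(1) iv(2)] by auto
    next
      case False
      then obtain y' where y': "y' \<in> vis" "pass \<phi> ?\<mu> y'" "?\<mu> y' = ?x"
        using treeD(4)[OF P(1) iv(2)] by blast
      then show ?thesis using treeD(1,2)[OF P(1), of y'] treeD(2)[OF P(1) iv(2)]
          invol_D[OF m[unfolded matching_def, THEN conjunct1], of y'] unfolding pass_def by auto
    qed
    have zy: "?z \<noteq> ?y"
    proof (cases "?z = ?x")
      case False
      with st show ?thesis by auto
    qed (use xy in simp)
    show "wp flip_step ?I s1 (t1 + (1 + bcost (Equal (Var ''go'') (Num 1))))"
    proof (cases "?z = ?x")
      case True
      then have "flip_done ?\<mu> r ?g (link (s1 ''mate'') ?x ?y)" using st by simp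
      moreover have "(s1 ''mate'')(s1 ''mate'' ?y := s1 ''mate'' ?y, ?x := ?y, ?y := ?x) =
          link (s1 ''mate'') ?x ?y"
        using True xy unfolding link_def by (auto simp: fun_eq_iff)
      ultimately show ?thesis
        unfolding flip_step_def using time True
        by (simp add: wp_simps par xy xy[symmetric] flip_loop_inv_def)
    next
      case False
      then have "flip_inv \<phi> ?\<mu> r ?g vis ?rk (link (s1 ''mate'') ?x ?y) ?z" "?rk ?z < ?rk ?y"
        using st by simp_all
      then show ?thesis
        unfolding flip_step_def using time False go
        by (simp add: wp_simps par zy zy[symmetric] link_upd[OF xy] flip_loop_inv_def)
    qed
  next
    fix s1 t1 assume I: "?I s1 t1" and fr: "\<forall>x. x \<notin> mods flip_step \<longrightarrow> s1 x = ?s x"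
      and c: "\<not> bval (Equal (Var ''go'') (Num 1)) s1"
    have "s1 v = s v" if v: "v \<notin> flip_vars" for v
    proof -
      have "s1 v = ?s v" by (rule frameD[OF fr md v])
      also have "\<dots> = s v" using v unfolding flip_vars_def by simp
      finally show ?thesis .
    qed
    then show "Q s1 (t1 + (1 + bcost (Equal (Var ''go'') (Num 1))))"
    proof (intro Q)
      have "s1 ''go'' 0 \<noteq> 1" using c by simp
      then have "flip_done ?\<mu> r ?g (s1 ''mate'')" "t1 \<le> ?T"
        using I unfolding flip_loop_inv_def by blast+
      then show "matching (s1 ''mate'')" "s1 ''mate'' r \<noteq> r"
        "\<forall>x<p + n. ?\<mu> x \<noteq> x \<and> x \<noteq> ?\<mu> ?g \<longrightarrow> s1 ''mate'' x \<noteq> x"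
        "t1 + (1 + bcost (Equal (Var ''go'') (Num 1))) \<le> t + 200 * (m + 1)"
        unfolding flip_done_def by simp_all
    qed blast
  qed
  then show ?thesis unfolding flip_def by (simp add: wp_simps eval_nat_numeral)
qed

definition same_side :: "nat \<Rightarrow> nat set" where
  "same_side r = {x. x < p + n \<and> (x < p \<longleftrightarrow> r < p)}"

lemma finite_same_side: "finite (same_side r)"
  unfolding same_side_def by simp

text \<open>A search without a target yields a Hall obstruction: all neighbours of \<open>X\<close>
  are visited and their mates lie in \<open>X\<close>. So \<open>X\<close> has at most
  \<open>card X\<close> neighbours, and fewer if the root is exposed, as it is then no mate of a
  visited vertex.\<close>

lemma search_stuck:
  assumes post: "search_post \<phi> \<mu> r s vis" and found: "s ''found'' 0 = 0"
    and \<mu>: "invol \<mu>" and r: "r < p + n"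
  defines "X \<equiv> reached \<phi> \<mu> r vis"
  shows "r \<in> X" "X \<subseteq> same_side r" "Gam X \<subseteq> vis" "X = insert r (\<mu> ` vis)" "inj_on \<mu> vis" "finite vis"
    "\<And>x. x \<in> \<mu> ` vis \<Longrightarrow> \<phi> x = 1 \<and> \<mu> x \<noteq> x" "\<And>y. y \<in> vis \<Longrightarrow> \<mu> (\<mu> y) = y"
proof -
  note P = search_postD[OF post]
  have vis: "vis \<subseteq> {..<p + n}" using P(1) unfolding tree_def by auto
  then show "finite vis" using finite_subset by blast
  show inj: "inj_on \<mu> vis" using invol_inj_on[OF \<mu>] vis by (rule inj_on_subset)
  show "r \<in> X" unfolding X_def reached_def by simp
  show X: "X = insert r (\<mu> ` vis)" using P(3)[OF found] unfolding X_def reached_def by blast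
  show "X \<subseteq> same_side r"
    using reached_side[OF _ subset_refl P(1) \<mu> r] unfolding X_def same_side_def by blast
  show "Gam X \<subseteq> vis" using P(2) unfolding X_def nbrs_def by blast
  show inv: "\<And>y. y \<in> vis \<Longrightarrow> \<mu> (\<mu> y) = y" using invol_D(2)[OF \<mu>] vis by blast
  fix x assume "x \<in> \<mu> ` vis"
  then obtain y where y: "y \<in> vis" "x = \<mu> y" by blast
  then show "\<phi> x = 1 \<and> \<mu> x \<noteq> x" using P(3)[OF found y(1)] inv[OF y(1)] unfolding pass_def by auto
qed

definition augment_vars :: "vname set" where
  "augment_vars = search_vars \<union> flip_vars"

lemma mods_augment: "mods (augment fl) \<subseteq> augment_vars"
  unfolding augment_def augment_vars_def flip_def flip_step_def search_vars_def flip_vars_def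
    search_def search_step_def by auto

text \<open>The only vertex that can lose its cover is the mate of a matched target; it lies on the
  side of the root and is unflagged because the target does not pass.\<close>

lemma augment_correct:
  assumes b: "base s" and m: "matching (s ''mate'')" and root: "s ''root'' 0 = r" and r: "r < p + n"
    and fl: "fl \<notin> search_vars"
    and Q: "\<And>s' t'. \<lbrakk>\<forall>v. v \<notin> augment_vars \<longrightarrow> s' v = s v; base s'; matching (s' ''mate'');
      \<forall>x<p + n. s ''mate'' x \<noteq> x \<and> (s fl x = 1 \<or> x \<notin> same_side r) \<longrightarrow> s' ''mate'' x \<noteq> x;
      s' ''mate'' r \<noteq> r \<or> s' ''mate'' = s ''mate'' \<and>
        (\<exists>X\<subseteq>same_side r. r \<in> X \<and> (\<forall>x\<in>X - {r}. s fl x = 1 \<and> s ''mate'' x \<noteq> x) \<and> card (Gam X) < card X);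
      t' \<le> t + 1000 * (m + 1)\<rbrakk> \<Longrightarrow> Q s' t'"
  shows "wp (augment fl) Q s t"
proof (cases "s ''mate'' r = r")
  case False
  then show ?thesis unfolding augment_def using b m root
    by (simp add: wp_simps) (rule Q, auto)
next
  case exposed: True
  note inv = m[unfolded matching_def, THEN conjunct1]
  have "wp (search fl) (wp (If (Less (Num 0) (Var ''found'')) flip Skip) Q) s (t + 7)"
  proof (rule search_correct[OF b inv _ fl])
    show "s ''root'' 0 < p + n" using root r by simp
    fix s' t' vis assume fr: "\<forall>v. v \<notin> search_vars \<longrightarrow> s' v = s v" and b': "base s'"
      and post: "search_post (s fl) (s ''mate'') (s ''root'' 0) s' vis" and t': "t' \<le> t + 7 + 700 * (m + 1)"
    note post = post[unfolded root]
    have mate: "s' ''mate'' = s ''mate''" using fr unfolding search_vars_def by simp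
    note P = search_postD[OF post]
    show "wp (If (Less (Num 0) (Var ''found'')) flip Skip) Q s' t'"
    proof (cases "s' ''found'' 0 = 0")
      case True
      note S = search_stuck[OF post True inv r]
      let ?X = "reached (s fl) (s ''mate'') r vis"
      have "r \<notin> s ''mate'' ` vis"
      proof
        assume "r \<in> s ''mate'' ` vis"
        then have "s ''mate'' r \<noteq> r" using S(7) by blast
        then show False using exposed by simp
      qed
      then have "card ?X = Suc (card vis)"
        using S(4,5,6) by (simp add: card_image)
      moreover have "card (Gam ?X) \<le> card vis" using S(3,6) by (rule card_mono[rotated])
      moreover have "\<forall>x\<in>?X - {r}. s fl x = 1 \<and> s ''mate'' x \<noteq> x" using S(4,7) by blast
      ultimately have cert: "\<exists>X\<subseteq>same_side r. r \<in> X \<and> (\<forall>x\<in>X - {r}. s fl x = 1 \<and> s ''mate'' x \<noteq> x) \<and>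
          card (Gam X) < card X"
        using S(1,2) by (intro exI[of _ ?X]) simp
      have "Q s' (t' + 6)"
      proof (rule Q)
        show "\<forall>v. v \<notin> augment_vars \<longrightarrow> s' v = s v" using fr unfolding augment_vars_def by blast
      qed (use b' m mate cert t' in simp_all)
      then show ?thesis using True by (simp add: wp_simps eval_nat_numeral)
    next
      case False
      have "wp flip Q s' (t' + 5)"
      proof (rule flip_correct[OF b' _ False _ r])
        show "search_post (s fl) (s' ''mate'') r s' vis" using post mate by simp
        show "matching (s' ''mate'')" "s' ''mate'' r = r" using m mate exposed by simp_all
        fix s2 t2 assume fr2: "\<forall>v. v \<notin> flip_vars \<longrightarrow> s2 v = s' v" and m2: "matching (s2 ''mate'')"
          and r2: "s2 ''mate'' r \<noteq> r"
          and cov: "\<forall>x<p + n. s' ''mate'' x \<noteq> x \<and> x \<noteq> s' ''mate'' (s' ''goal'' 0) \<longrightarrow> s2 ''mate'' x \<noteq> x"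
          and t2: "t2 \<le> t' + 5 + 200 * (m + 1)"
        let ?g = "s' ''goal'' 0"
        have g: "?g \<in> vis" "\<not> pass (s fl) (s ''mate'') ?g" using P(4)[OF False] by auto
        note gs = treeD(1,2)[OF P(1) g(1)]
        show "Q s2 t2"
        proof (rule Q)
          show "\<forall>v. v \<notin> augment_vars \<longrightarrow> s2 v = s v" using fr fr2 unfolding augment_vars_def by simp
          show "base s2" using b' fr2 unfolding base_def flip_vars_def by simp
          show "\<forall>x<p + n. s ''mate'' x \<noteq> x \<and> (s fl x = 1 \<or> x \<notin> same_side r) \<longrightarrow> s2 ''mate'' x \<noteq> x"
          proof (intro allI impI)
            fix x assume x: "x < p + n" and *: "s ''mate'' x \<noteq> x \<and> (s fl x = 1 \<or> x \<notin> same_side r)"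
            have "x \<noteq> s ''mate'' ?g"
            proof
              assume xg: "x = s ''mate'' ?g"
              then have "s ''mate'' x = ?g" using invol_D(2)[OF inv gs(1)] by simp
              then have ne: "s ''mate'' ?g \<noteq> ?g" using * xg by auto
              then have "x \<in> same_side r" using invol_D(3)[OF inv gs(1)] gs x xg unfolding same_side_def by auto
              then show False using * g(2) ne xg unfolding pass_def by auto
            qed
            then show "s2 ''mate'' x \<noteq> x" using cov x * mate by simp
          qed
        qed (use m2 r2 t2 t' in simp_all)
      qed
      then show ?thesis using False by (simp add: wp_simps eval_nat_numeral)
    qed
  qed
  then show ?thesis unfolding augment_def using exposed root
    by (simp add: wp_simps eval_nat_numeral)
qed

text \<open>This is the test for independence. If the search escapes, no set of \<open>r\<close> and
  flagged vertices on its side can be closed, since the search would be trapped in it; if it is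
  stuck, the explored set is the certificate of rejection.\<close>

lemma probe_correct:
  assumes b: "base s" and m: "matching (s ''mate'')" and root: "s ''root'' 0 = r" and r: "r < p + n"
    and Q: "\<And>s' t'. \<lbrakk>\<forall>v. v \<notin> insert ''ind'' search_vars \<longrightarrow> s' v = s v; base s';
      s ''mate'' r = r \<and> s' ''ind'' = s ''ind'' \<or>
      s ''mate'' r \<noteq> r \<and> s' ''ind'' = (s ''ind'')(r := 1) \<and>
        (\<forall>X\<subseteq>same_side r. r \<in> X \<longrightarrow> (\<forall>x\<in>X - {r}. s ''ind'' x = 1) \<longrightarrow> \<not> Gam X \<subseteq> s ''mate'' ` X) \<or>
      s ''mate'' r \<noteq> r \<and> s' ''ind'' = (s ''ind'')(r := 0) \<and>
        (\<exists>X\<subseteq>same_side r. r \<in> X \<and> (\<forall>x\<in>X - {r}. s ''ind'' x = 1) \<and> card (Gam X) \<le> card X);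
      t' \<le> t + 800 * (m + 1)\<rbrakk> \<Longrightarrow> Q s' t'"
  shows "wp probe Q s t"
proof (cases "s ''mate'' r = r")
  case True
  then show ?thesis unfolding probe_def using b m root
    by (simp add: wp_simps) (rule Q, auto)
next
  case covered: False
  note inv = m[unfolded matching_def, THEN conjunct1]
  let ?\<mu> = "s ''mate''"
  let ?s = "s(''ind'' := (s ''ind'')(r := 1))"
  have "wp (search ''ind'') (wp (If (Equal (Var ''found'') (Num 0)) (Assign ''ind'' (Var ''root'') (Num 0)) Skip) Q) ?s (t + 11)"
  proof (rule search_correct)
    show "base ?s" using b unfolding base_def by simp
    show "invol (?s ''mate'')" using inv by simp
    show "?s ''root'' 0 < p + n" using root r by simp
    show "''ind'' \<notin> search_vars" unfolding search_vars_def by simp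
    fix s' t' vis assume fr: "\<forall>v. v \<notin> search_vars \<longrightarrow> s' v = ?s v" and b': "base s'"
      and post0: "search_post (?s ''ind'') (?s ''mate'') (?s ''root'' 0) s' vis"
      and t': "t' \<le> t + 11 + 700 * (m + 1)"
    have post: "search_post ((s ''ind'')(r := 1)) ?\<mu> r s' vis" using post0 root by simp
    note P = search_postD[OF post]
    have s': "s' ''root'' 0 = r" "s' ''ind'' = (s ''ind'')(r := 1)"
      using fr root unfolding search_vars_def by simp_all
    have fr': "s' v = s v" if "v \<notin> insert ''ind'' search_vars" for v using fr that by simp
    show "wp (If (Equal (Var ''found'') (Num 0)) (Assign ''ind'' (Var ''root'') (Num 0)) Skip) Q s' t'"
    proof (cases "s' ''found'' 0 = 0")
      case True
      note S = search_stuck[OF post True inv r]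
      let ?X = "reached ((s ''ind'')(r := 1)) ?\<mu> r vis"
      have "card (Gam ?X) \<le> card vis" using S(3,6) by (rule card_mono[rotated])
      also have "\<dots> = card (?\<mu> ` vis)" using S(5) by (simp add: card_image)
      also have "\<dots> \<le> card ?X" using S(4,6) by (intro card_mono) auto
      finally have "card (Gam ?X) \<le> card ?X" .
      moreover have "\<forall>x\<in>?X - {r}. s ''ind'' x = 1"
      proof
        fix x assume x: "x \<in> ?X - {r}"
        then have "x \<in> ?\<mu> ` vis" using S(4) by blast
        from S(7)[OF this] x show "s ''ind'' x = 1" by auto
      qed
      ultimately have cert: "\<exists>X\<subseteq>same_side r. r \<in> X \<and> (\<forall>x\<in>X - {r}. s ''ind'' x = 1) \<and> card (Gam X) \<le> card X"
        using S(1,2) by blast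
      let ?s2 = "s'(''ind'' := (s' ''ind'')(r := 0))"
      have "Q ?s2 (t' + 9)"
      proof (rule Q)
        show "\<forall>v. v \<notin> insert ''ind'' search_vars \<longrightarrow> ?s2 v = s v" using fr' by simp
        show "base ?s2" using b' unfolding base_def by simp
        have "?s2 ''ind'' = (s ''ind'')(r := 0)" using s' by simp
        then show "?\<mu> r = r \<and> ?s2 ''ind'' = s ''ind'' \<or>
          ?\<mu> r \<noteq> r \<and> ?s2 ''ind'' = (s ''ind'')(r := 1) \<and>
            (\<forall>X\<subseteq>same_side r. r \<in> X \<longrightarrow> (\<forall>x\<in>X - {r}. s ''ind'' x = 1) \<longrightarrow> \<not> Gam X \<subseteq> ?\<mu> ` X) \<or>
          ?\<mu> r \<noteq> r \<and> ?s2 ''ind'' = (s ''ind'')(r := 0) \<and>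
            (\<exists>X\<subseteq>same_side r. r \<in> X \<and> (\<forall>x\<in>X - {r}. s ''ind'' x = 1) \<and> card (Gam X) \<le> card X)"
          using covered cert by blast
      qed (use t' in simp)
      then show ?thesis using True s' by (simp add: wp_simps eval_nat_numeral)
    next
      case False
      let ?g = "s' ''goal'' 0"
      have g: "?g \<in> vis" "\<not> pass ((s ''ind'')(r := 1)) ?\<mu> ?g" using P(4)[OF False] by auto
      note gs = treeD(1,2)[OF P(1) g(1)]
      have "\<not> Gam X \<subseteq> ?\<mu> ` X" if X: "X \<subseteq> same_side r" "r \<in> X" "\<forall>x\<in>X - {r}. s ''ind'' x = 1" for X
      proof
        assume cl: "Gam X \<subseteq> ?\<mu> ` X"
        have mem: "?\<mu> y \<in> X" if y: "y \<in> Gam X" for y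
        proof -
          obtain x where x: "x \<in> X" "y = ?\<mu> x" using cl y by blast
          then have "x < p + n" using X(1) unfolding same_side_def by blast
          then show ?thesis using x invol_D(2)[OF inv] by simp
        qed
        have "vis \<subseteq> Gam X"
        proof (rule tree_sound[OF P(1) X(2)])
          fix x y assume "x \<in> X" "y \<in> N x"
          then have "y \<in> Gam X" unfolding nbrs_def by blast
          then show "?\<mu> y \<in> X" by (rule mem)
        qed
        then have gX: "?\<mu> ?g \<in> X" using mem g(1) by blast
        then have "((s ''ind'')(r := 1)) (?\<mu> ?g) = 1" using X(3) by simp
        \<comment> \<open>The mate of the target is flagged, so the target can only be exposed;
          being its own mate, it would lie in \<open>X\<close> and thus on the wrong side.\<close>
        then have "?\<mu> ?g = ?g" using g(2) unfolding pass_def by blast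
        then have "?g \<in> same_side r" using gX X(1) by auto
        then show False using gs(2) unfolding same_side_def by blast
      qed
      then have ok: "\<forall>X\<subseteq>same_side r. r \<in> X \<longrightarrow> (\<forall>x\<in>X - {r}. s ''ind'' x = 1) \<longrightarrow> \<not> Gam X \<subseteq> ?\<mu> ` X"
        by blast
      have "Q s' (t' + 6)"
      proof (rule Q)
        show "\<forall>v. v \<notin> insert ''ind'' search_vars \<longrightarrow> s' v = s v" using fr' by blast
        show "?\<mu> r = r \<and> s' ''ind'' = s ''ind'' \<or>
          ?\<mu> r \<noteq> r \<and> s' ''ind'' = (s ''ind'')(r := 1) \<and>
            (\<forall>X\<subseteq>same_side r. r \<in> X \<longrightarrow> (\<forall>x\<in>X - {r}. s ''ind'' x = 1) \<longrightarrow> \<not> Gam X \<subseteq> ?\<mu> ` X) \<or>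
          ?\<mu> r \<noteq> r \<and> s' ''ind'' = (s ''ind'')(r := 0) \<and>
            (\<exists>X\<subseteq>same_side r. r \<in> X \<and> (\<forall>x\<in>X - {r}. s ''ind'' x = 1) \<and> card (Gam X) \<le> card X)"
          using covered ok s'(2) by blast
      qed (use b' t' in simp_all)
      then show ?thesis using False by (simp add: wp_simps eval_nat_numeral)
    qed
  qed
  then show ?thesis unfolding probe_def using covered root
    by (simp add: wp_simps eval_nat_numeral)
qed

end

section \<open>Maximal independent sets and a maximum matching\<close>

text \<open>One pass serves both sides, because augmenting from a root never exposes a vertex of the
  opposite side.\<close>

definition phase_independent :: com where
  "phase_independent =
     set_var ''root'' (Num 0) ;;
     While (Less (Var ''root'') (Var ''total'')) (augment ''ind'' ;; probe ;; incr ''root'')"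

text \<open>All entries of \<open>cov\<close> are 1, so only exposed vertices are targets and
  \<open>augment\<close> is ordinary augmentation, which leaves every covered vertex
  covered.\<close>

definition phase_maximum :: com where
  "phase_maximum =
     set_var ''root'' (Num 0) ;;
     While (Less (Var ''root'') (Var ''total'')) (augment ''cov'' ;; incr ''root'')"

definition emit :: "aexp \<Rightarrow> aexp \<Rightarrow> com" where
  "emit x y =
     Assign ''F_tail'' (Var ''F_size'') x ;; Assign ''F_head'' (Var ''F_size'') y ;; incr ''F_size''"

text \<open>A paired endpoint counts as settled from now on and is flagged. Isolated endpoints,
  recognised by an empty arc list, stay unflagged because they must receive a second new
  edge.\<close>

definition pair_step :: com where
  "pair_step =
     If (Not (Equal (Cell ''mate'' (Var ''u'')) (Var ''u''))) (incr ''u'')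
       (If (Not (Equal (Cell ''mate'' (Var ''w'')) (Var ''w''))) (incr ''w'')
         (emit (Var ''u'') (Var ''w'') ;;
          Assign ''mate'' (Var ''u'') (Var ''w'') ;; Assign ''mate'' (Var ''w'') (Var ''u'') ;;
          If (Equal (Cell ''first'' (Var ''u'')) (Num 0)) Skip (Assign ''ind'' (Var ''u'') (Num 1)) ;;
          If (Equal (Cell ''first'' (Var ''w'')) (Num 0)) Skip (Assign ''ind'' (Var ''w'') (Num 1))))"

definition phase_pair :: com where
  "phase_pair =
     set_var ''u'' (Num 0) ;; set_var ''w'' (Var ''p'') ;;
     While (Less (Var ''u'') (Var ''p'')) pair_step"

definition outs :: "(nat \<Rightarrow> nat) \<Rightarrow> (nat \<Rightarrow> nat) \<Rightarrow> nat \<Rightarrow> (nat \<times> nat) set" where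
  "outs ft fh k = {(ft i, fh i) | i. i < k}"

lemma output_edges_outs: "output_edges s = outs (s ''F_tail'') (s ''F_head'') (s ''F_size'' 0)"
  unfolding output_edges_def outs_def ..

lemma outs_Suc: "outs (ft(k := x)) (fh(k := y)) (Suc k) = insert (x, y) (outs ft fh k)"
proof -
  have "outs (ft(k := x)) (fh(k := y)) (Suc k) = (\<lambda>i. ((ft(k := x)) i, (fh(k := y)) i)) ` {..<Suc k}"
    unfolding outs_def by blast
  also have "\<dots> = insert (x, y) ((\<lambda>i. (ft i, fh i)) ` {..<k})"
    by (simp add: lessThan_Suc)
  also have "(\<lambda>i. (ft i, fh i)) ` {..<k} = outs ft fh k" unfolding outs_def by blast
  finally show ?thesis .
qed

text \<open>An upper bound is enough for optimality: emitting a pair twice could only make the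
  counter larger than the set.\<close>

lemma card_outs_le: "card (outs ft fh k) \<le> k"
proof -
  have *: "outs ft fh k = (\<lambda>i. (ft i, fh i)) ` {..<k}" unfolding outs_def by blast
  show ?thesis unfolding * using card_image_le[of "{..<k}"] by simp
qed

section \<open>Certificates for independence and for maximality of the matching\<close>

context graph_mem
begin

lemma same_side_eq: "x \<in> same_side r \<Longrightarrow> same_side x = same_side r"
  unfolding same_side_def by auto

lemma finite_N: "finite (N x)"
  unfolding N_def by simp

lemma finite_Gam: "finite X \<Longrightarrow> finite (Gam X)"
  unfolding nbrs_def using finite_N by simp

lemma matching_image:
  assumes m: "matching \<mu>" and X: "X \<subseteq> {..<p + n}" "\<And>x. x \<in> X \<Longrightarrow> \<mu> x \<noteq> x"
  shows "\<mu> ` X \<subseteq> Gam X" "card (\<mu> ` X) = card X"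
proof -
  show "\<mu> ` X \<subseteq> Gam X"
  proof
    fix y assume "y \<in> \<mu> ` X"
    then obtain x where x: "x \<in> X" "y = \<mu> x" by blast
    then have "\<mu> x \<in> N x" using m X unfolding matching_def by blast
    then show "y \<in> Gam X" using x unfolding nbrs_def by blast
  qed
  have "inj_on \<mu> X" using m X(1) invol_inj_on inj_on_subset unfolding matching_def by blast
  then show "card (\<mu> ` X) = card X" by (rule card_image)
qed

lemma Gam_eq_image:
  assumes m: "matching \<mu>" and X: "X \<subseteq> {..<p + n}" "\<And>x. x \<in> X \<Longrightarrow> \<mu> x \<noteq> x"
    and le: "card (Gam X) \<le> card X"
  shows "Gam X = \<mu> ` X"
proof -
  have 1: "\<mu> ` X \<subseteq> Gam X" by (rule matching_image(1)[OF m X])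
  have 2: "card (\<mu> ` X) = card X" by (rule matching_image(2)[OF m X])
  have "finite X" by (rule finite_subset[OF X(1)]) simp
  then have "finite (Gam X)" by (rule finite_Gam)
  then have "\<mu> ` X = Gam X" using 1 by (rule card_seteq) (use 2 le in linarith)
  then show ?thesis by simp
qed

text \<open>The state after all roots below \<open>r\<close>. The certificates of rejected vertices
  stay valid when \<open>I\<close> grows, since they only require \<open>X\<close> to lie in
  \<open>insert x I\<close> on one side.\<close>

definition prepared_upto :: "nat \<Rightarrow> (nat \<Rightarrow> nat) \<Rightarrow> nat set \<Rightarrow> bool" where
  "prepared_upto r \<mu> I \<longleftrightarrow>
     matching \<mu> \<and> (\<forall>x\<in>I. x < r \<and> x < p + n \<and> \<mu> x \<noteq> x) \<and> (\<forall>q. hindep N (I \<inter> same_side q)) \<and>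
     (\<forall>x<p + n. x < r \<longrightarrow> x \<notin> I \<longrightarrow>
        (\<exists>X\<subseteq>insert x (I \<inter> same_side x). x \<in> X \<and> card (Gam X) \<le> card X))"

lemma prepared_uptoD:
  assumes "prepared_upto r \<mu> I"
  shows "matching \<mu>" "\<And>x. x \<in> I \<Longrightarrow> x < r \<and> x < p + n \<and> \<mu> x \<noteq> x" "\<And>q. hindep N (I \<inter> same_side q)"
    "\<And>x. x < p + n \<Longrightarrow> x < r \<Longrightarrow> x \<notin> I \<Longrightarrow>
       \<exists>X\<subseteq>insert x (I \<inter> same_side x). x \<in> X \<and> card (Gam X) \<le> card X"
  using assms unfolding prepared_upto_def by blast+

lemma prepared_upto_reject:
  assumes pr: "prepared_upto r \<mu> I" and r: "r < p + n"
    and X: "X \<subseteq> same_side r" "r \<in> X" "\<And>x. x \<in> X - {r} \<Longrightarrow> x \<in> I" "card (Gam X) \<le> card X"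
  shows "prepared_upto (Suc r) \<mu> I"
proof -
  note P = prepared_uptoD[OF pr]
  have cert: "\<exists>X\<subseteq>insert r (I \<inter> same_side r). r \<in> X \<and> card (Gam X) \<le> card X"
    using X by (intro exI[of _ X]) blast
  show ?thesis unfolding prepared_upto_def
  proof (intro conjI allI impI ballI)
    fix x assume "x < p + n" "x < Suc r" "x \<notin> I"
    then show "\<exists>X\<subseteq>insert x (I \<inter> same_side x). x \<in> X \<and> card (Gam X) \<le> card X"
      using P(4)[of x] cert by (cases "x = r") simp_all
  next
    fix x assume "x \<in> I"
    from P(2)[OF this] show "x < Suc r" "x < p + n" "\<mu> x \<noteq> x" by simp_all
  qed (use P(1,3) in simp_all)
qed

lemma prepared_upto_accept:
  assumes pr: "prepared_upto r \<mu> I" and r: "r < p + n" "\<mu> r \<noteq> r"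
    and X: "\<And>X. X \<subseteq> same_side r \<Longrightarrow> r \<in> X \<Longrightarrow> X - {r} \<subseteq> I \<Longrightarrow> \<not> Gam X \<subseteq> \<mu> ` X"
  shows "prepared_upto (Suc r) \<mu> (insert r I)"
proof -
  note P = prepared_uptoD[OF pr]
  have ind: "hindep N (insert r I \<inter> same_side q)" for q
    unfolding hindep_def
  proof (intro allI impI)
    fix Y assume Y: "Y \<subseteq> insert r I \<inter> same_side q" "Y \<noteq> {}"
    show "card Y < card (Gam Y)"
    proof (cases "r \<in> Y")
      case False
      then have "Y \<subseteq> I \<inter> same_side q" using Y by blast
      then show ?thesis using Y(2) by (rule hindepD[OF P(3)])
    next
      case True
      then have "same_side r = same_side q" using Y same_side_eq[of r q] by blast
      then have ne: "\<not> Gam Y \<subseteq> \<mu> ` Y" using X[of Y] Y True by blast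
      have cov: "\<mu> y \<noteq> y" if "y \<in> Y" for y using that P(2) r(2) Y by auto
      have "Y \<subseteq> {..<p + n}" using Y unfolding same_side_def by auto
      from Gam_eq_image[OF P(1) this cov] ne show ?thesis by force
    qed
  qed
  show ?thesis unfolding prepared_upto_def
  proof (intro conjI allI impI ballI)
    fix x assume x: "x < p + n" "x < Suc r" "x \<notin> insert r I"
    then obtain X where "X\<subseteq>insert x (I \<inter> same_side x)" "x \<in> X" "card (Gam X) \<le> card X"
      using P(4)[of x] by auto
    then show "\<exists>X\<subseteq>insert x (insert r I \<inter> same_side x). x \<in> X \<and> card (Gam X) \<le> card X"
      by (intro exI[of _ X]) blast
  next
    fix x assume "x \<in> insert r I"
    then have "x < Suc r \<and> x < p + n \<and> \<mu> x \<noteq> x" using P(2)[of x] r less_Suc_eq by blast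
    then show "x < Suc r" "x < p + n" "\<mu> x \<noteq> x" by simp_all
  qed (use P(1) ind in simp_all)
qed

lemma prepared_upto_rematch:
  assumes "prepared_upto r \<mu> I" "matching \<mu>'" "\<And>x. x \<in> I \<Longrightarrow> \<mu> x \<noteq> x \<Longrightarrow> \<mu>' x \<noteq> x"
  shows "prepared_upto r \<mu>' I"
  using assms unfolding prepared_upto_def by blast

definition maximum_upto :: "nat \<Rightarrow> (nat \<Rightarrow> nat) \<Rightarrow> bool" where
  "maximum_upto r \<mu> \<longleftrightarrow>
     (\<forall>x<r. \<mu> x = x \<longrightarrow>
        (\<exists>Z\<subseteq>same_side x. x \<in> Z \<and> (\<forall>z\<in>Z - {x}. \<mu> z \<noteq> z) \<and> card (Gam Z) < card Z))"

lemma maximum_uptoD: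
  assumes "maximum_upto r \<mu>" "x < r" "\<mu> x = x"
  obtains Z where "Z \<subseteq> same_side x" "x \<in> Z" "\<forall>z\<in>Z - {x}. \<mu> z \<noteq> z" "card (Gam Z) < card Z"
  using assms(1)[unfolded maximum_upto_def, rule_format, OF assms(2,3)] by auto

text \<open>A certificate survives later augmentations: covered vertices stay covered, and a vertex
  still exposed was exposed before.\<close>

lemma maximum_upto_rematch:
  assumes "maximum_upto r \<mu>" "r \<le> p + n" "\<And>x. x < p + n \<Longrightarrow> \<mu> x \<noteq> x \<Longrightarrow> \<mu>' x \<noteq> x"
  shows "maximum_upto r \<mu>'"
  unfolding maximum_upto_def
proof (intro allI impI)
  fix x assume x: "x < r" "\<mu>' x = x"
  then have "\<mu> x = x" using assms(2) assms(3)[of x] by auto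
  with assms(1) x(1) obtain Z where Z: "Z\<subseteq>same_side x" "x \<in> Z" "\<forall>z\<in>Z - {x}. \<mu> z \<noteq> z"
    "card (Gam Z) < card Z" by (rule maximum_uptoD)
  have "\<mu>' z \<noteq> z" if "z \<in> Z - {x}" for z
  proof (rule assms(3))
    show "z < p + n" using that Z(1) unfolding same_side_def by auto
    show "\<mu> z \<noteq> z" using that Z(3) by blast
  qed
  then show "\<exists>Z\<subseteq>same_side x. x \<in> Z \<and> (\<forall>z\<in>Z - {x}. \<mu>' z \<noteq> z) \<and> card (Gam Z) < card Z"
    using Z by (intro exI[of _ Z]) simp
qed

lemma maximum_upto_Suc:
  assumes "maximum_upto r \<mu>"
    and "\<mu> r \<noteq> r \<or> (\<exists>Z\<subseteq>same_side r. r \<in> Z \<and> (\<forall>z\<in>Z - {r}. \<mu> z \<noteq> z) \<and> card (Gam Z) < card Z)"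
  shows "maximum_upto (Suc r) \<mu>"
  unfolding maximum_upto_def
proof (intro allI impI)
  fix x assume "x < Suc r" "\<mu> x = x"
  then show "\<exists>Z\<subseteq>same_side x. x \<in> Z \<and> (\<forall>z\<in>Z - {x}. \<mu> z \<noteq> z) \<and> card (Gam Z) < card Z"
    using assms unfolding maximum_upto_def by (cases "x = r") simp_all
qed

definition prepared :: "(nat \<Rightarrow> nat) \<Rightarrow> nat set \<Rightarrow> bool" where
  "prepared \<mu> I \<longleftrightarrow> prepared_upto (p + n) \<mu> I \<and> maximum_upto (p + n) \<mu>"

definition extension :: "(nat \<Rightarrow> nat) \<Rightarrow> nat set \<Rightarrow> (nat \<Rightarrow> nat) \<Rightarrow> nat set \<Rightarrow> bool" where
  "extension \<mu> I \<mu>' I' \<longleftrightarrow>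
     invol \<mu>' \<and> (\<forall>x<p + n. \<mu> x \<noteq> x \<longrightarrow> \<mu>' x = \<mu> x) \<and>
     (\<forall>x. x \<in> I' \<longleftrightarrow> x \<in> I \<or> x < p + n \<and> \<mu> x = x \<and> \<mu>' x \<noteq> x \<and> N x \<noteq> {})"

text \<open>Let \<open>Z\<close> certify that the exposed vertex \<open>u \<in> X\<close> cannot be covered. Then \<open>\<mu>\<close> maps \<open>Z - {u}\<close> onto
  \<open>\<Gamma>(Z)\<close>, so \<open>X \<inter> Z - {u} \<subseteq> I\<close> has at most as many neighbours as elements.\<close>

lemma closed_meets_complement:
  assumes pr: "prepared \<mu> I" and ex: "extension \<mu> I \<mu>' I'"
    and X: "X \<subseteq> same_side q" "X \<noteq> {}" and cl: "\<And>x y. x \<in> X \<Longrightarrow> y \<in> N x \<Longrightarrow> \<mu>' y \<in> X"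
  shows "\<not> X \<subseteq> I'"
proof
  assume XI': "X \<subseteq> I'"
  note P = prepared_uptoD[OF pr[unfolded prepared_def, THEN conjunct1]]
  have M: "maximum_upto (p + n) \<mu>" using pr unfolding prepared_def by blast
  have inv: "invol \<mu>" using P(1) unfolding matching_def by blast
  have inv': "invol \<mu>'" and ext: "\<And>x. x < p + n \<Longrightarrow> \<mu> x \<noteq> x \<Longrightarrow> \<mu>' x = \<mu> x"
    and I': "\<And>x. x \<in> I' \<longleftrightarrow> x \<in> I \<or> x < p + n \<and> \<mu> x = x \<and> \<mu>' x \<noteq> x \<and> N x \<noteq> {}"
    using ex unfolding extension_def by blast+
  have XV: "x < p + n" if "x \<in> X" for x using that X(1) unfolding same_side_def by blast
  have finX: "finite X" by (rule finite_subset[OF X(1) finite_same_side])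
  show False
  proof (cases "\<exists>u\<in>X. \<mu> u = u")
    case False
    have "X \<subseteq> I" using XI' I' False by blast
    then have "card X < card (Gam X)" using X by (intro hindepD[OF P(3)[of q]]) auto
    moreover have "Gam X \<subseteq> \<mu>' ` X"
    proof
      fix y assume "y \<in> Gam X"
      then obtain x where x: "x \<in> X" "y \<in> N x" unfolding nbrs_def by blast
      then have "y < p + n" using N_D(1) XV by blast
      then have "y = \<mu>' (\<mu>' y)" using invol_D(2)[OF inv'] by simp
      then show "y \<in> \<mu>' ` X" using cl[OF x] by blast
    qed
    then have "card (Gam X) \<le> card (\<mu>' ` X)" using finX by (intro card_mono) simp
    moreover have "card (\<mu>' ` X) \<le> card X" using finX by (rule card_image_le)
    ultimately show False by simp
  next
    case True
    then obtain u where u: "u \<in> X" "\<mu> u = u" by blast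
    then have "u \<notin> I" using P(2) by blast
    then have Nu: "N u \<noteq> {}" using u XI' I' by blast
    obtain Z where Z: "Z\<subseteq>same_side u" "u \<in> Z" "\<forall>z\<in>Z - {u}. \<mu> z \<noteq> z" "card (Gam Z) < card Z"
      using M XV[OF u(1)] u(2) by (rule maximum_uptoD)
    have finZ: "finite Z" by (rule finite_subset[OF Z(1) finite_same_side])
    have ZV: "Z - {u} \<subseteq> {..<p + n}" using Z(1) unfolding same_side_def by auto
    note im = matching_image[OF P(1) ZV]
    have "card (Gam Z) \<le> card (Z - {u})" using Z(2,4) finZ by simp
    also have "\<dots> = card (\<mu> ` (Z - {u}))" using im(2) Z(3) by simp
    finally have "card (Gam Z) \<le> card (\<mu> ` (Z - {u}))" .
    moreover have "\<mu> ` (Z - {u}) \<subseteq> Gam Z" using im(1) Z(3) nbrs_mono[of "Z - {u}" Z N] by blast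
    ultimately have GZ: "\<mu> ` (Z - {u}) = Gam Z" using card_seteq[OF finite_Gam[OF finZ]] by blast
    let ?Q = "X \<inter> Z" and ?R = "X \<inter> Z - {u}"
    have GQ: "Gam ?Q \<subseteq> \<mu> ` ?R"
    proof
      fix y assume "y \<in> Gam ?Q"
      then obtain x where x: "x \<in> X" "x \<in> Z" "y \<in> N x" unfolding nbrs_def by blast
      then have "y \<in> Gam Z" unfolding nbrs_def by blast
      then obtain z where z: "z \<in> Z - {u}" "y = \<mu> z" using GZ by blast
      have zV: "z < p + n" using z ZV by blast
      then have zy: "\<mu> y = z" using z(2) invol_D(2)[OF inv] by simp
      have "y < p + n" using N_D(1)[OF x(3)] XV x(1) by blast
      moreover have "\<mu> y \<noteq> y" using Z(3)[rule_format, OF z(1)] z(2) zy by simp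
      ultimately have "\<mu>' y = z" using ext zy by simp
      then have "z \<in> X" using cl[OF x(1,3)] by simp
      then show "y \<in> \<mu> ` ?R" using z by blast
    qed
    have RI: "?R \<subseteq> I" using XI' I' Z(3) by blast
    have finR: "finite ?R" using finX by simp
    show False
    proof (cases "?R = {}")
      \<comment> \<open>Here \<open>X \<inter> Z\<close> is just \<open>u\<close>, which would be
        isolated; this is where it matters that isolated vertices do not enter
        \<open>I'\<close>.\<close>
      case True
      then have "Gam ?Q = {}" using GQ unfolding True by simp
      then show False using Nu u(1) Z(2) unfolding nbrs_def by blast
    next
      case False
      have "?R \<subseteq> I \<inter> same_side q" using RI X(1) by blast
      then have "card ?R < card (Gam ?R)" using False by (rule hindepD[OF P(3)])
      also have "\<dots> \<le> card (\<mu> ` ?R)"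
        using GQ nbrs_mono[of ?R ?Q N] finR by (intro card_mono) auto
      also have "\<dots> \<le> card ?R" using finR by (rule card_image_le)
      finally show False by simp
    qed
  qed
qed

text \<open>The factor 1900 consists of 1000 for \<open>augment\<close>, 800 for
  \<open>probe\<close> and a reserve for the loop itself.\<close>

definition independent_inv :: "nat \<Rightarrow> state \<Rightarrow> nat \<Rightarrow> bool" where
  "independent_inv T s t \<longleftrightarrow>
     base s \<and> s ''root'' 0 \<le> p + n \<and>
     prepared_upto (s ''root'' 0) (s ''mate'') {x. s ''ind'' x = 1} \<and>
     t + 1900 * (m + 1) * (p + n - s ''root'' 0) + 10 \<le> T"

lemma time_step:
  fixes r N t t' T c :: nat
  assumes "t + c * (N - r) + 10 \<le> T" "r < N" "t' \<le> t + c"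
  shows "t' + c * (N - Suc r) + 10 \<le> T"
proof -
  have "N - r = Suc (N - Suc r)" using assms(2) by simp
  then show ?thesis using assms(1,3) by simp
qed

lemma independent_step:
  assumes inv: "independent_inv T s t" and less: "s ''root'' 0 < p + n"
  shows "wp (augment ''ind'' ;; probe ;; incr ''root'') (independent_inv T) s (t + 6)"
proof -
  define r where "r = s ''root'' 0"
  let ?I = "{x. s ''ind'' x = 1}"
  have b: "base s" and pr: "prepared_upto r (s ''mate'') ?I"
    and time: "t + 1900 * (m + 1) * (p + n - r) + 10 \<le> T"
    using inv unfolding independent_inv_def r_def by blast+
  have r: "r < p + n" using less r_def by simp
  have rI: "r \<notin> ?I" using prepared_uptoD(2)[OF pr, of r] by blast
  have "wp (augment ''ind'') (wp probe (wp (incr ''root'') (independent_inv T))) s (t + 6)"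
  proof (rule augment_correct[OF b prepared_uptoD(1)[OF pr] r_def[symmetric] r])
    show "''ind'' \<notin> search_vars" unfolding search_vars_def by simp
    fix s1 t1 assume fr1: "\<forall>v. v \<notin> augment_vars \<longrightarrow> s1 v = s v" and b1: "base s1"
      and m1: "matching (s1 ''mate'')"
      and cov: "\<forall>x<p + n. s ''mate'' x \<noteq> x \<and> (s ''ind'' x = 1 \<or> x \<notin> same_side r) \<longrightarrow> s1 ''mate'' x \<noteq> x"
      and res: "s1 ''mate'' r \<noteq> r \<or> s1 ''mate'' = s ''mate'' \<and>
        (\<exists>X\<subseteq>same_side r. r \<in> X \<and> (\<forall>x\<in>X - {r}. s ''ind'' x = 1 \<and> s ''mate'' x \<noteq> x) \<and> card (Gam X) < card X)"
      and t1: "t1 \<le> t + 6 + 1000 * (m + 1)"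
    have ind1: "s1 ''ind'' = s ''ind''" and root1: "s1 ''root'' 0 = r"
      using fr1 r_def unfolding augment_vars_def search_vars_def flip_vars_def by simp_all
    have pr1: "prepared_upto r (s1 ''mate'') ?I"
    proof (rule prepared_upto_rematch[OF pr m1])
      fix x assume "x \<in> ?I" "s ''mate'' x \<noteq> x"
      then show "s1 ''mate'' x \<noteq> x" using cov prepared_uptoD(2)[OF pr, of x] by blast
    qed
    show "wp probe (wp (incr ''root'') (independent_inv T)) s1 t1"
    proof (rule probe_correct[OF b1 m1 root1 r])
      fix s2 t2 assume fr2: "\<forall>v. v \<notin> insert ''ind'' search_vars \<longrightarrow> s2 v = s1 v" and b2: "base s2"
        and res2: "s1 ''mate'' r = r \<and> s2 ''ind'' = s1 ''ind'' \<or>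
          s1 ''mate'' r \<noteq> r \<and> s2 ''ind'' = (s1 ''ind'')(r := 1) \<and>
            (\<forall>X\<subseteq>same_side r. r \<in> X \<longrightarrow> (\<forall>x\<in>X - {r}. s1 ''ind'' x = 1) \<longrightarrow> \<not> Gam X \<subseteq> s1 ''mate'' ` X) \<or>
          s1 ''mate'' r \<noteq> r \<and> s2 ''ind'' = (s1 ''ind'')(r := 0) \<and>
            (\<exists>X\<subseteq>same_side r. r \<in> X \<and> (\<forall>x\<in>X - {r}. s1 ''ind'' x = 1) \<and> card (Gam X) \<le> card X)"
        and t2: "t2 \<le> t1 + 800 * (m + 1)"
      have mate2: "s2 ''mate'' = s1 ''mate''" and root2: "s2 ''root'' 0 = r"
        using fr2 root1 unfolding search_vars_def by simp_all
      have pr2: "prepared_upto (Suc r) (s1 ''mate'') {x. s2 ''ind'' x = 1}"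
        using res2
      proof (elim disjE conjE)
        assume ex: "s1 ''mate'' r = r" and i2: "s2 ''ind'' = s1 ''ind''"
        from ex res obtain X where X: "X\<subseteq>same_side r" "r \<in> X"
          "\<forall>x\<in>X - {r}. s ''ind'' x = 1 \<and> s ''mate'' x \<noteq> x" "card (Gam X) < card X" by auto
        have "prepared_upto (Suc r) (s1 ''mate'') ?I"
          by (rule prepared_upto_reject[OF pr1 r X(1,2)]) (use X(3,4) in auto)
        then show ?thesis using i2 ind1 by simp
      next
        assume cv: "s1 ''mate'' r \<noteq> r" and i2: "s2 ''ind'' = (s1 ''ind'')(r := 1)"
          and ok: "\<forall>X\<subseteq>same_side r. r \<in> X \<longrightarrow> (\<forall>x\<in>X - {r}. s1 ''ind'' x = 1) \<longrightarrow> \<not> Gam X \<subseteq> s1 ''mate'' ` X"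
        have "prepared_upto (Suc r) (s1 ''mate'') (insert r ?I)"
        proof (rule prepared_upto_accept[OF pr1 r cv])
          fix X assume X: "X \<subseteq> same_side r" "r \<in> X" "X - {r} \<subseteq> ?I"
          then have "\<forall>x\<in>X - {r}. s1 ''ind'' x = 1" using ind1 by auto
          then show "\<not> Gam X \<subseteq> s1 ''mate'' ` X" using ok X(1,2) by blast
        qed
        moreover have "{x. s2 ''ind'' x = 1} = insert r ?I" using i2 ind1 by auto
        ultimately show ?thesis by simp
      next
        assume "s1 ''mate'' r \<noteq> r" and i2: "s2 ''ind'' = (s1 ''ind'')(r := 0)"
          and "\<exists>X\<subseteq>same_side r. r \<in> X \<and> (\<forall>x\<in>X - {r}. s1 ''ind'' x = 1) \<and> card (Gam X) \<le> card X"
        then obtain X where X: "X\<subseteq>same_side r" "r \<in> X"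
          "\<forall>x\<in>X - {r}. s1 ''ind'' x = 1" "card (Gam X) \<le> card X" by auto
        have "prepared_upto (Suc r) (s1 ''mate'') ?I"
          by (rule prepared_upto_reject[OF pr1 r X(1,2)]) (use X(3,4) ind1 in auto)
        moreover have "{x. s2 ''ind'' x = 1} = ?I" using i2 ind1 rI by auto
        ultimately show ?thesis by simp
      qed
      let ?s = "s2(''root'' := (s2 ''root'')(0 := Suc r))"
      have "t2 + 6 + 1900 * (m + 1) * (p + n - Suc r) + 10 \<le> T"
        by (rule time_step[OF time r]) (use t1 t2 in simp)
      then have "independent_inv T ?s (t2 + 6)"
        unfolding independent_inv_def using b2 r pr2 mate2 by (simp add: base_def)
      then show "wp (incr ''root'') (independent_inv T) s2 t2"
        using root2 by (simp add: wp_simps eval_nat_numeral)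
    qed
  qed
  then show ?thesis by (simp add: wp_Seq_fun)
qed

lemma phase_independent_correct:
  assumes b: "base s" and m: "matching (s ''mate'')" and ind: "\<And>x. s ''ind'' x \<noteq> 1"
    and Q: "\<And>s' t'. \<lbrakk>\<forall>v. v \<notin> augment_vars \<union> {''ind'', ''root''} \<longrightarrow> s' v = s v; base s';
      prepared_upto (p + n) (s' ''mate'') {x. s' ''ind'' x = 1};
      t' \<le> t + 1900 * (m + 1) * (p + n) + 30\<rbrakk> \<Longrightarrow> Q s' t'"
  shows "wp phase_independent Q s t"
proof -
  let ?s = "s(''root'' := (s ''root'')(0 := 0))"
  let ?T = "t + 1900 * (m + 1) * (p + n) + 20"
  let ?body = "augment ''ind'' ;; probe ;; incr ''root''"
  have md: "mods ?body \<subseteq> augment_vars \<union> {''ind'', ''root''}"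
    using mods_augment[of "''ind''"] mods_search[of "''ind''"] unfolding probe_def augment_vars_def by auto
  have "wp (While (Less (Var ''root'') (Var ''total'')) ?body) Q ?s (t + 3)"
  proof (rule wp_While_frameI[where I = "independent_inv ?T" and K = ?T])
    have "prepared_upto 0 (s ''mate'') {x. s ''ind'' x = 1}"
      using m ind unfolding prepared_upto_def hindep_def by simp
    then show "independent_inv ?T ?s (t + 3)"
      unfolding independent_inv_def using b by (simp add: base_def)
  next
    fix s1 t1 assume "independent_inv ?T s1 t1"
    then show "t1 \<le> ?T" unfolding independent_inv_def by simp
  next
    fix s1 t1 assume I: "independent_inv ?T s1 t1" and c: "bval (Less (Var ''root'') (Var ''total'')) s1"
    have "s1 ''total'' 0 = p + n" using I unfolding independent_inv_def base_def by blast
    then have "s1 ''root'' 0 < p + n" using c by simp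
    from independent_step[OF I this]
    show "wp ?body (independent_inv ?T) s1 (t1 + (1 + bcost (Less (Var ''root'') (Var ''total''))))"
      by (simp add: eval_nat_numeral)
  next
    fix s1 t1 assume I: "independent_inv ?T s1 t1" and c: "\<not> bval (Less (Var ''root'') (Var ''total'')) s1"
      and fr: "\<forall>x. x \<notin> mods ?body \<longrightarrow> s1 x = ?s x"
    have I': "base s1" "s1 ''root'' 0 \<le> p + n" "t1 + 10 \<le> ?T"
      "prepared_upto (s1 ''root'' 0) (s1 ''mate'') {x. s1 ''ind'' x = 1}"
      using I unfolding independent_inv_def by simp_all
    have "s1 ''total'' 0 = p + n" using I'(1) unfolding base_def by blast
    then have root: "s1 ''root'' 0 = p + n" using c I'(2) by simp
    show "Q s1 (t1 + (1 + bcost (Less (Var ''root'') (Var ''total''))))"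
    proof (rule Q)
      show "\<forall>v. v \<notin> augment_vars \<union> {''ind'', ''root''} \<longrightarrow> s1 v = s v"
      proof (intro allI impI)
        fix v assume v: "v \<notin> augment_vars \<union> {''ind'', ''root''}"
        from frameD[OF fr md v] show "s1 v = s v" using v by simp
      qed
    qed (use I' root in simp_all)
  qed
  then show ?thesis unfolding phase_independent_def by (simp add: wp_Seq wp_Assign eval_nat_numeral)
qed

definition maximum_inv :: "state \<Rightarrow> nat \<Rightarrow> state \<Rightarrow> nat \<Rightarrow> bool" where
  "maximum_inv s0 T s t \<longleftrightarrow>
     base s \<and> s ''root'' 0 \<le> p + n \<and> matching (s ''mate'') \<and>
     (\<forall>x<p + n. s0 ''mate'' x \<noteq> x \<longrightarrow> s ''mate'' x \<noteq> x) \<and> maximum_upto (s ''root'' 0) (s ''mate'') \<and>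
     t + 1100 * (m + 1) * (p + n - s ''root'' 0) + 10 \<le> T"

lemma maximum_step:
  assumes inv: "maximum_inv s0 T s t" and less: "s ''root'' 0 < p + n"
    and one: "\<And>x. x < p + n \<Longrightarrow> s ''cov'' x = 1"
  shows "wp (augment ''cov'' ;; incr ''root'') (maximum_inv s0 T) s (t + 6)"
proof -
  define r where "r = s ''root'' 0"
  have b: "base s" and mt: "matching (s ''mate'')" and mx: "maximum_upto r (s ''mate'')"
    and cov0: "\<forall>x<p + n. s0 ''mate'' x \<noteq> x \<longrightarrow> s ''mate'' x \<noteq> x"
    and time: "t + 1100 * (m + 1) * (p + n - r) + 10 \<le> T"
    using inv unfolding maximum_inv_def r_def by blast+
  have r: "r < p + n" using less r_def by simp
  have "wp (augment ''cov'') (wp (incr ''root'') (maximum_inv s0 T)) s (t + 6)"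
  proof (rule augment_correct[OF b mt r_def[symmetric] r])
    show "''cov'' \<notin> search_vars" unfolding search_vars_def by simp
    fix s1 t1 assume fr1: "\<forall>v. v \<notin> augment_vars \<longrightarrow> s1 v = s v" and b1: "base s1"
      and m1: "matching (s1 ''mate'')"
      and cov: "\<forall>x<p + n. s ''mate'' x \<noteq> x \<and> (s ''cov'' x = 1 \<or> x \<notin> same_side r) \<longrightarrow> s1 ''mate'' x \<noteq> x"
      and res: "s1 ''mate'' r \<noteq> r \<or> s1 ''mate'' = s ''mate'' \<and>
        (\<exists>X\<subseteq>same_side r. r \<in> X \<and> (\<forall>x\<in>X - {r}. s ''cov'' x = 1 \<and> s ''mate'' x \<noteq> x) \<and> card (Gam X) < card X)"
      and t1: "t1 \<le> t + 6 + 1000 * (m + 1)"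
    have root1: "s1 ''root'' 0 = r"
      using fr1 r_def unfolding augment_vars_def search_vars_def flip_vars_def by simp
    have grow: "s1 ''mate'' x \<noteq> x" if "x < p + n" "s ''mate'' x \<noteq> x" for x
      using cov one that by simp
    have "maximum_upto r (s1 ''mate'')"
      by (rule maximum_upto_rematch[OF mx]) (use r grow in simp_all)
    then have mx1: "maximum_upto (Suc r) (s1 ''mate'')"
    proof (rule maximum_upto_Suc)
      show "s1 ''mate'' r \<noteq> r \<or> (\<exists>Z\<subseteq>same_side r. r \<in> Z \<and> (\<forall>z\<in>Z - {r}. s1 ''mate'' z \<noteq> z) \<and>
          card (Gam Z) < card Z)"
        using res
      proof (elim disjE conjE)
        assume eq: "s1 ''mate'' = s ''mate''"
          and "\<exists>X\<subseteq>same_side r. r \<in> X \<and> (\<forall>x\<in>X - {r}. s ''cov'' x = 1 \<and> s ''mate'' x \<noteq> x) \<and> card (Gam X) < card X"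
        then obtain X where "X\<subseteq>same_side r" "r \<in> X" "\<forall>x\<in>X - {r}. s ''mate'' x \<noteq> x" "card (Gam X) < card X"
          by auto
        then show ?thesis unfolding eq by (intro disjI2 exI[of _ X]) simp
      qed simp
    qed
    have cov1: "\<forall>x<p + n. s0 ''mate'' x \<noteq> x \<longrightarrow> s1 ''mate'' x \<noteq> x" using cov0 grow by simp
    let ?s = "s1(''root'' := (s1 ''root'')(0 := Suc r))"
    have "t1 + 6 + 1100 * (m + 1) * (p + n - Suc r) + 10 \<le> T"
      by (rule time_step[OF time r]) (use t1 in simp)
    then have "maximum_inv s0 T ?s (t1 + 6)"
      unfolding maximum_inv_def using b1 r m1 mx1 cov1 by (simp add: base_def)
    then show "wp (incr ''root'') (maximum_inv s0 T) s1 t1"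
      using root1 by (simp add: wp_simps eval_nat_numeral)
  qed
  then show ?thesis by (simp add: wp_Seq_fun)
qed

lemma phase_maximum_correct:
  assumes b: "base s" and pr: "prepared_upto (p + n) (s ''mate'') I"
    and one: "\<And>x. x < p + n \<Longrightarrow> s ''cov'' x = 1"
    and Q: "\<And>s' t'. \<lbrakk>\<forall>v. v \<notin> insert ''root'' augment_vars \<longrightarrow> s' v = s v; base s';
      prepared (s' ''mate'') I; t' \<le> t + 1100 * (m + 1) * (p + n) + 30\<rbrakk> \<Longrightarrow> Q s' t'"
  shows "wp phase_maximum Q s t"
proof -
  let ?s = "s(''root'' := (s ''root'')(0 := 0))"
  let ?T = "t + 1100 * (m + 1) * (p + n) + 20"
  let ?body = "augment ''cov'' ;; incr ''root''"
  have md: "mods ?body \<subseteq> insert ''root'' augment_vars"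
    using mods_augment[of "''cov''"] by auto
  have "wp (While (Less (Var ''root'') (Var ''total'')) ?body) Q ?s (t + 3)"
  proof (rule wp_While_frameI[where I = "maximum_inv s ?T" and K = ?T])
    show "maximum_inv s ?T ?s (t + 3)"
      unfolding maximum_inv_def using b prepared_uptoD(1)[OF pr] by (simp add: base_def maximum_upto_def)
  next
    fix s1 t1 assume "maximum_inv s ?T s1 t1"
    then show "t1 \<le> ?T" unfolding maximum_inv_def by simp
  next
    fix s1 t1 assume I: "maximum_inv s ?T s1 t1" and c: "bval (Less (Var ''root'') (Var ''total'')) s1"
      and fr: "\<forall>x. x \<notin> mods ?body \<longrightarrow> s1 x = ?s x"
    have "s1 ''total'' 0 = p + n" using I unfolding maximum_inv_def base_def by blast
    then have less: "s1 ''root'' 0 < p + n" using c by simp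
    have "''cov'' \<notin> insert ''root'' augment_vars"
      unfolding augment_vars_def search_vars_def flip_vars_def by simp
    from frameD[OF fr md this] have "s1 ''cov'' x = 1" if "x < p + n" for x using one that by simp
    from maximum_step[OF I less this]
    show "wp ?body (maximum_inv s ?T) s1 (t1 + (1 + bcost (Less (Var ''root'') (Var ''total''))))"
      by (simp add: eval_nat_numeral)
  next
    fix s1 t1 assume I: "maximum_inv s ?T s1 t1" and c: "\<not> bval (Less (Var ''root'') (Var ''total'')) s1"
      and fr: "\<forall>x. x \<notin> mods ?body \<longrightarrow> s1 x = ?s x"
    have I': "base s1" "s1 ''root'' 0 \<le> p + n" "t1 + 10 \<le> ?T" "matching (s1 ''mate'')"
      "\<forall>x<p + n. s ''mate'' x \<noteq> x \<longrightarrow> s1 ''mate'' x \<noteq> x" "maximum_upto (s1 ''root'' 0) (s1 ''mate'')"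
      using I unfolding maximum_inv_def by simp_all
    have "s1 ''total'' 0 = p + n" using I'(1) unfolding base_def by blast
    then have root: "s1 ''root'' 0 = p + n" using c I'(2) by simp
    have "prepared_upto (p + n) (s1 ''mate'') I"
    proof (rule prepared_upto_rematch[OF pr I'(4)])
      fix x assume "x \<in> I" "s ''mate'' x \<noteq> x"
      then show "s1 ''mate'' x \<noteq> x" using I'(5) prepared_uptoD(2)[OF pr, of x] by blast
    qed
    then have prep: "prepared (s1 ''mate'') I" unfolding prepared_def using I'(6) root by simp
    show "Q s1 (t1 + (1 + bcost (Less (Var ''root'') (Var ''total''))))"
    proof (rule Q)
      show "\<forall>v. v \<notin> insert ''root'' augment_vars \<longrightarrow> s1 v = s v"
      proof (intro allI impI)
        fix v assume v: "v \<notin> insert ''root'' augment_vars"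
        from frameD[OF fr md v] show "s1 v = s v" using v by simp
      qed
    qed (use I' prep in simp_all)
  qed
  then show ?thesis unfolding phase_maximum_def by (simp add: wp_Seq wp_Assign eval_nat_numeral)
qed

end

section \<open>Pairing off the exposed vertices\<close>

context graph_mem
begin

lemma first_zero_iff: "v < p + n \<Longrightarrow> fs v = 0 \<longleftrightarrow> N v = {}"
  using linked[of v] unfolding N_empty_iff by (cases "AL v") auto

text \<open>Pigeonhole: otherwise \<open>\<mu>\<close> would inject \<open>V^-\<close> into
  \<open>V^+\<close> without \<open>u\<close>. This keeps the pointer \<open>w\<close> of the
  pairing loop within \<open>V^-\<close>.\<close>

lemma exposed_partner_exists:
  assumes \<mu>: "invol \<mu>" and pn: "p \<le> n" and u: "u < p" "\<mu> u = u"
  shows "\<exists>y\<ge>p. y < p + n \<and> \<mu> y = y"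
proof (rule ccontr)
  assume neg: "\<not> ?thesis"
  have "\<mu> ` {p..<p + n} \<subseteq> {..<p} - {u}"
  proof
    fix x assume "x \<in> \<mu> ` {p..<p + n}"
    then obtain y where y: "p \<le> y" "y < p + n" "x = \<mu> y" by auto
    then have "\<mu> y \<noteq> y" using neg by blast
    then have "x < p" using invol_D(3)[OF \<mu> y(2)] y by simp
    moreover have "x \<noteq> u"
    proof
      assume "x = u"
      then have "\<mu> u = y" using invol_D(2)[OF \<mu> y(2)] y(3) by simp
      then show False using u y(1) by simp
    qed
    ultimately show "x \<in> {..<p} - {u}" by simp
  qed
  then have "card (\<mu> ` {p..<p + n}) \<le> card ({..<p} - {u})" by (intro card_mono) simp_all
  moreover have "inj_on \<mu> {p..<p + n}" by (rule inj_on_subset[OF invol_inj_on[OF \<mu>]]) auto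
  then have "card (\<mu> ` {p..<p + n}) = n" by (simp add: card_image)
  moreover have "card ({..<p} - {u}) < p" using u(1) by simp
  ultimately show False using pn by linarith
qed

lemma extensionD:
  assumes "extension \<mu> I \<mu>' I'"
  shows "invol \<mu>'" "\<And>x. x < p + n \<Longrightarrow> \<mu> x \<noteq> x \<Longrightarrow> \<mu>' x = \<mu> x"
    "\<And>x. x \<in> I' \<longleftrightarrow> x \<in> I \<or> x < p + n \<and> \<mu> x = x \<and> \<mu>' x \<noteq> x \<and> N x \<noteq> {}"
  using assms unfolding extension_def by blast+

definition new_pairs :: "(nat \<Rightarrow> nat) \<Rightarrow> (nat \<Rightarrow> nat) \<Rightarrow> nat set" where
  "new_pairs \<mu>0 \<mu> = {x. x < p \<and> \<mu>0 x = x \<and> \<mu> x \<noteq> x}"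

text \<open>The three summands of the time measure belong to the three branches of
  \<open>pair_step\<close>: advance \<open>u\<close>, advance \<open>w\<close>, and pair, which
  removes an exposed vertex of \<open>V^+\<close>.\<close>

definition pair_inv :: "state \<Rightarrow> nat \<Rightarrow> state \<Rightarrow> nat \<Rightarrow> bool" where
  "pair_inv s0 T s t \<longleftrightarrow>
     base s \<and> s ''u'' 0 \<le> p \<and> p \<le> s ''w'' 0 \<and> s ''w'' 0 \<le> p + n \<and>
     extension (s0 ''mate'') {x. s0 ''ind'' x = 1} (s ''mate'') {x. s ''ind'' x = 1} \<and>
     (\<forall>x<s ''u'' 0. s ''mate'' x \<noteq> x) \<and> (\<forall>y<s ''w'' 0. p \<le> y \<longrightarrow> s ''mate'' y \<noteq> y) \<and>
     output_edges s = (\<lambda>x. (x, s ''mate'' x)) ` new_pairs (s0 ''mate'') (s ''mate'') \<and>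
     s ''F_size'' 0 = card (new_pairs (s0 ''mate'') (s ''mate'')) \<and>
     t + 100 * ((p - s ''u'' 0) + (p + n - s ''w'' 0) + card {x. x < p \<and> s ''mate'' x = x}) + 10 \<le> T"

lemma pair_invI:
  assumes "base s" "s ''u'' 0 \<le> p" "p \<le> s ''w'' 0" "s ''w'' 0 \<le> p + n"
    "extension (s0 ''mate'') {x. s0 ''ind'' x = 1} (s ''mate'') {x. s ''ind'' x = 1}"
    "\<And>x. x < s ''u'' 0 \<Longrightarrow> s ''mate'' x \<noteq> x" "\<And>y. y < s ''w'' 0 \<Longrightarrow> p \<le> y \<Longrightarrow> s ''mate'' y \<noteq> y"
    "output_edges s = (\<lambda>x. (x, s ''mate'' x)) ` new_pairs (s0 ''mate'') (s ''mate'')"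
    "s ''F_size'' 0 = card (new_pairs (s0 ''mate'') (s ''mate''))"
    "t + 100 * ((p - s ''u'' 0) + (p + n - s ''w'' 0) + card {x. x < p \<and> s ''mate'' x = x}) + 10 \<le> T"
  shows "pair_inv s0 T s t"
  using assms unfolding pair_inv_def by blast

lemma pair_invD:
  assumes "pair_inv s0 T s t"
  shows "base s" "s ''u'' 0 \<le> p" "p \<le> s ''w'' 0" "s ''w'' 0 \<le> p + n"
    "extension (s0 ''mate'') {x. s0 ''ind'' x = 1} (s ''mate'') {x. s ''ind'' x = 1}"
    "\<And>x. x < s ''u'' 0 \<Longrightarrow> s ''mate'' x \<noteq> x" "\<And>y. y < s ''w'' 0 \<Longrightarrow> p \<le> y \<Longrightarrow> s ''mate'' y \<noteq> y"
    "output_edges s = (\<lambda>x. (x, s ''mate'' x)) ` new_pairs (s0 ''mate'') (s ''mate'')"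
    "s ''F_size'' 0 = card (new_pairs (s0 ''mate'') (s ''mate''))"
    "t + 100 * ((p - s ''u'' 0) + (p + n - s ''w'' 0) + card {x. x < p \<and> s ''mate'' x = x}) + 10 \<le> T"
  using assms unfolding pair_inv_def by blast+

text \<open>Stated for an arbitrary \<open>s'\<close>, because \<open>pair_step\<close> ends in four
  different states depending on which endpoints are isolated.\<close>

lemma pair_link:
  assumes inv: "pair_inv s0 T s t" and u: "s ''u'' 0 = u" "u < p" "s ''mate'' u = u"
    and w: "s ''w'' 0 = w" "w < p + n" "s ''mate'' w = w"
    and base: "base s'"
    and s': "s' ''u'' 0 = u" "s' ''w'' 0 = w" "s' ''mate'' = (s ''mate'')(u := w, w := u)"
      "s' ''F_tail'' = (s ''F_tail'')(s ''F_size'' 0 := u)" "s' ''F_head'' = (s ''F_head'')(s ''F_size'' 0 := w)"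
      "s' ''F_size'' 0 = Suc (s ''F_size'' 0)"
    and ind: "\<And>x. s' ''ind'' x = 1 \<longleftrightarrow> s ''ind'' x = 1 \<or> x = u \<and> N u \<noteq> {} \<or> x = w \<and> N w \<noteq> {}"
    and t': "t' \<le> t + 100"
  shows "pair_inv s0 T s' t'"
proof -
  note I = pair_invD[OF inv]
  let ?\<nu> = "s0 ''mate''" and ?\<mu> = "s ''mate''" and ?\<mu>' = "s' ''mate''"
  have pw: "p \<le> w" using I(3) w by simp
  have uw: "u \<noteq> w" using u pw by simp
  note inv\<mu> = extensionD(1)[OF I(5)] and ext = extensionD(2)[OF I(5)]
    and J = extensionD(3)[OF I(5), unfolded mem_Collect_eq]
  have u0: "?\<nu> u = u" using ext[of u] u by fastforce
  have w0: "?\<nu> w = w" using ext[of w] w by fastforce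
  have ne: "?\<mu> x \<noteq> u" "?\<mu> x \<noteq> w" if "x < p + n" "x \<noteq> u" "x \<noteq> w" for x
    using invol_D(2)[OF inv\<mu> that(1)] that u w by auto
  have inv': "invol ?\<mu>'" unfolding invol_def
  proof (intro allI impI)
    fix x assume x: "x < p + n"
    show "?\<mu>' x < p + n \<and> ?\<mu>' (?\<mu>' x) = x \<and> (?\<mu>' x \<noteq> x \<longrightarrow> (?\<mu>' x < p \<longleftrightarrow> \<not> x < p))"
      using invol_D[OF inv\<mu> x] ne[OF x] u w pw uw unfolding s'(3) by (cases "x = u \<or> x = w") auto
  qed
  have pairs: "new_pairs ?\<nu> ?\<mu>' = insert u (new_pairs ?\<nu> ?\<mu>)"
    using u u0 uw pw unfolding new_pairs_def s'(3) by auto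
  have fin: "finite (new_pairs ?\<nu> ?\<mu>)" unfolding new_pairs_def by simp
  have unew: "u \<notin> new_pairs ?\<nu> ?\<mu>" using u unfolding new_pairs_def by simp
  show ?thesis
  proof (rule pair_invI)
    show "extension ?\<nu> {x. s0 ''ind'' x = 1} ?\<mu>' {x. s' ''ind'' x = 1}"
      unfolding extension_def
    proof (intro conjI allI impI)
      show "invol ?\<mu>'" by (rule inv')
      fix x
      show "?\<mu>' x = ?\<nu> x" if "x < p + n" "?\<nu> x \<noteq> x"
      proof -
        have "x \<noteq> u" "x \<noteq> w" using that u0 w0 by auto
        then show ?thesis using ext[OF that] unfolding s'(3) by simp
      qed
      have "?\<mu>' x \<noteq> x \<longleftrightarrow> ?\<mu> x \<noteq> x \<or> x = u \<or> x = w" using uw unfolding s'(3) by auto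
      then show "x \<in> {x. s' ''ind'' x = 1} \<longleftrightarrow>
         x \<in> {x. s0 ''ind'' x = 1} \<or> x < p + n \<and> ?\<nu> x = x \<and> ?\<mu>' x \<noteq> x \<and> N x \<noteq> {}"
        using ind[of x] J[of x] u0 w0 u(2) w(2) by auto
    qed
    show "?\<mu>' x \<noteq> x" if "x < s' ''u'' 0" for x
      using I(6)[of x] that s'(1) u(1) uw unfolding s'(3) by simp
    show "?\<mu>' y \<noteq> y" if "y < s' ''w'' 0" "p \<le> y" for y
      using I(7)[of y] that s'(2) w(1) uw u(2) unfolding s'(3) by simp
    have "output_edges s' = insert (u, w) (output_edges s)"
      unfolding output_edges_outs s' by (rule outs_Suc)
    also have "\<dots> = insert (u, w) ((\<lambda>x. (x, ?\<mu> x)) ` new_pairs ?\<nu> ?\<mu>)" using I(8) by simp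
    also have "(\<lambda>x. (x, ?\<mu> x)) ` new_pairs ?\<nu> ?\<mu> = (\<lambda>x. (x, ?\<mu>' x)) ` new_pairs ?\<nu> ?\<mu>"
    proof (rule image_cong[OF refl])
      fix x assume "x \<in> new_pairs ?\<nu> ?\<mu>"
      then have "x \<noteq> u" "x \<noteq> w" using unew pw unfolding new_pairs_def by auto
      then show "(x, ?\<mu> x) = (x, ?\<mu>' x)" unfolding s'(3) by simp
    qed
    finally show "output_edges s' = (\<lambda>x. (x, ?\<mu>' x)) ` new_pairs ?\<nu> ?\<mu>'"
      unfolding pairs using uw s'(3) by simp
    show "s' ''F_size'' 0 = card (new_pairs ?\<nu> ?\<mu>')"
      unfolding pairs s'(6) using fin unew I(9) by simp
    have "{x. x < p \<and> ?\<mu> x = x} = insert u {x. x < p \<and> ?\<mu>' x = x}"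
      using u uw pw unfolding s'(3) by auto
    moreover have "u \<notin> {x. x < p \<and> ?\<mu>' x = x}" using uw unfolding s'(3) by simp
    ultimately have "card {x. x < p \<and> ?\<mu> x = x} = Suc (card {x. x < p \<and> ?\<mu>' x = x})" by simp
    then show "t' + 100 * ((p - s' ''u'' 0) + (p + n - s' ''w'' 0) + card {x. x < p \<and> ?\<mu>' x = x}) + 10 \<le> T"
      using I(10) t' unfolding s'(1,2) u(1) w(1) by simp
  qed (use base s' u w pw in simp_all)
qed

lemma pair_step_correct:
  assumes inv: "pair_inv s0 T s t" and less: "s ''u'' 0 < p" and pn: "p \<le> n"
  shows "wp pair_step (pair_inv s0 T) s (t + 6)"
proof -
  note I = pair_invD[OF inv]
  obtain u where u: "s ''u'' 0 = u" by blast
  obtain w where w: "s ''w'' 0 = w" by blast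
  have f: "s ''first'' = fs" using I(1) unfolding base_def by blast
  show ?thesis
  proof (cases "s ''mate'' u = u")
    case False
    have "pair_inv s0 T (s(''u'' := (s ''u'')(0 := Suc u))) (t + 6 + 14)"
    proof (rule pair_invI)
      show "(s(''u'' := (s ''u'')(0 := Suc u))) ''mate'' x \<noteq> x" if "x < (s(''u'' := (s ''u'')(0 := Suc u))) ''u'' 0" for x
        using I(6)[of x] False that u by (cases "x = u") simp_all
    qed (use I u less in \<open>simp_all add: base_def output_edges_def\<close>)
    then show ?thesis unfolding pair_step_def using False u
      by (simp add: wp_simps eval_nat_numeral)
  next
    case ue: True
    have "w < p + n"
    proof (rule ccontr)
      assume "\<not> w < p + n"
      then have "s ''mate'' y \<noteq> y" if "p \<le> y" "y < p + n" for y using I(4) I(7)[of y] that w by simp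
      moreover have "invol (s ''mate'')" using extensionD(1)[OF I(5)] .
      ultimately show False using exposed_partner_exists[OF _ pn, of "s ''mate''" u] less u ue by blast
    qed
    show ?thesis
    proof (cases "s ''mate'' w = w")
      case False
      have "pair_inv s0 T (s(''w'' := (s ''w'')(0 := Suc w))) (t + 6 + 22)"
      proof (rule pair_invI)
        show "(s(''w'' := (s ''w'')(0 := Suc w))) ''mate'' x \<noteq> x"
          if "x < (s(''w'' := (s ''w'')(0 := Suc w))) ''w'' 0" "p \<le> x" for x
          using I(7)[of x] False that w by (cases "x = w") simp_all
      qed (use I w \<open>w < p + n\<close> in \<open>simp_all add: base_def output_edges_def\<close>)
      then show ?thesis unfolding pair_step_def using False u w ue
        by (simp add: wp_simps eval_nat_numeral)
    next
      case True
      note link = pair_link[OF inv u _ ue w \<open>w < p + n\<close> True]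
      have up: "u < p" using less u by simp
      have uw: "u \<noteq> w" "w \<noteq> u" using up I(3) w by simp_all
      have Nu: "fs u = 0 \<longleftrightarrow> N u = {}" and Nw: "fs w = 0 \<longleftrightarrow> N w = {}"
        using first_zero_iff up \<open>w < p + n\<close> by simp_all
      have Nu': "fs u \<noteq> 0 \<longleftrightarrow> N u \<noteq> {}" and Nw': "fs w \<noteq> 0 \<longleftrightarrow> N w \<noteq> {}" using Nu Nw by simp_all
      show ?thesis
        unfolding pair_step_def emit_def using ue u w True up uw f I(1)
        by (cases "fs u = 0"; cases "fs w = 0"; simp add: wp_simps; intro link)
          (simp_all add: base_def Nu Nw Nu'[simplified] Nw'[simplified])
    qed
  qed
qed

lemma phase_pair_correct:
  assumes b: "base s" and pr: "prepared (s ''mate'') {x. s ''ind'' x = 1}" and pn: "p \<le> n"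
    and out: "s ''F_size'' 0 = 0"
    and Q: "\<And>s' t'. \<lbrakk>\<forall>v. v \<notin> {''u'', ''w'', ''F_tail'', ''F_head'', ''F_size'', ''mate'', ''ind''} \<longrightarrow> s' v = s v;
      base s'; extension (s ''mate'') {x. s ''ind'' x = 1} (s' ''mate'') {x. s' ''ind'' x = 1};
      \<forall>x<p. s' ''mate'' x \<noteq> x;
      output_edges s' = (\<lambda>x. (x, s' ''mate'' x)) ` {x. x < p \<and> s ''mate'' x = x};
      s' ''F_size'' 0 = card {x. x < p \<and> s ''mate'' x = x};
      t' \<le> t + 100 * (2 * p + n) + 40\<rbrakk> \<Longrightarrow> Q s' t'"
  shows "wp phase_pair Q s t"
proof -
  let ?s = "s(''u'' := (s ''u'')(0 := 0), ''w'' := (s ''w'')(0 := p))"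
  let ?T = "t + 100 * (2 * p + n) + 20"
  let ?V = "{''u'', ''w'', ''F_tail'', ''F_head'', ''F_size'', ''mate'', ''ind''}"
  have md: "mods pair_step \<subseteq> ?V" unfolding pair_step_def emit_def by auto
  have "wp (While (Less (Var ''u'') (Var ''p'')) pair_step) Q ?s (t + 7)"
  proof (rule wp_While_frameI[where I = "pair_inv s ?T" and K = ?T])
    have "matching (s ''mate'')" using prepared_uptoD(1) pr unfolding prepared_def by blast
    then have ext: "extension (s ''mate'') {x. s ''ind'' x = 1} (s ''mate'') {x. s ''ind'' x = 1}"
      unfolding extension_def matching_def by auto
    have np: "new_pairs (s ''mate'') (s ''mate'') = {}" unfolding new_pairs_def by auto
    have "card {x. x < p \<and> s ''mate'' x = x} \<le> card {..<p}" by (intro card_mono) auto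
    then have "card {x. x < p \<and> s ''mate'' x = x} \<le> p" by simp
    then show "pair_inv s ?T ?s (t + 7)"
      by (intro pair_invI) (use b ext np out in \<open>simp_all add: base_def output_edges_def\<close>)
  next
    fix s1 t1 assume "pair_inv s ?T s1 t1"
    from pair_invD(10)[OF this] show "t1 \<le> ?T" by simp
  next
    fix s1 t1 assume I: "pair_inv s ?T s1 t1" and c: "bval (Less (Var ''u'') (Var ''p'')) s1"
    have "s1 ''p'' 0 = p" using pair_invD(1)[OF I] unfolding base_def by blast
    then have "s1 ''u'' 0 < p" using c by simp
    from pair_step_correct[OF I this pn]
    show "wp pair_step (pair_inv s ?T) s1 (t1 + (1 + bcost (Less (Var ''u'') (Var ''p''))))"
      by (simp add: eval_nat_numeral)
  next
    fix s1 t1 assume I0: "pair_inv s ?T s1 t1" and c: "\<not> bval (Less (Var ''u'') (Var ''p'')) s1"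
      and fr: "\<forall>x. x \<notin> mods pair_step \<longrightarrow> s1 x = ?s x"
    note I = pair_invD[OF I0]
    have "s1 ''p'' 0 = p" using I(1) unfolding base_def by blast
    then have up: "s1 ''u'' 0 = p" using c I(2) by simp
    have cov: "s1 ''mate'' x \<noteq> x" if "x < p" for x using I(6)[of x] that up by simp
    then have np: "new_pairs (s ''mate'') (s1 ''mate'') = {x. x < p \<and> s ''mate'' x = x}"
      unfolding new_pairs_def by blast
    show "Q s1 (t1 + (1 + bcost (Less (Var ''u'') (Var ''p''))))"
    proof (rule Q)
      show "\<forall>v. v \<notin> ?V \<longrightarrow> s1 v = s v"
      proof (intro allI impI)
        fix v assume v: "v \<notin> ?V"
        from frameD[OF fr md v] show "s1 v = s v" using v by simp
      qed
    qed (use I(1,5,8,9) cov np pair_invD(10)[OF I0] in simp_all)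
  qed
  then show ?thesis unfolding phase_pair_def using b by (simp add: wp_simps base_def eval_nat_numeral)
qed

end

section \<open>Destroying closed sets\<close>

text \<open>The scan for \<open>w\<close> stops inside \<open>V^-\<close>, since with
  \<open>p < n\<close> some vertex there remains exposed.\<close>

definition phase_unbalanced :: com where
  "phase_unbalanced =
     set_var ''w'' (Var ''p'') ;;
     While (Not (Equal (Cell ''mate'' (Var ''w'')) (Var ''w''))) (incr ''w'') ;;
     set_var ''u'' (Num 0) ;;
     While (Less (Var ''u'') (Var ''p''))
       (If (Equal (Cell ''ind'' (Var ''u'')) (Num 1)) Skip (emit (Var ''u'') (Var ''w'')) ;; incr ''u'')"

text \<open>An unflagged \<open>root\<close> is a fresh sink for the source \<open>w\<close>. Both
  become flagged, and the edge from the previous sink to \<open>w\<close> links the new pair to the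
  chain; \<open>source\<close> keeps the start of the first pair.\<close>

definition chain_commit :: com where
  "chain_commit =
     If (Equal (Cell ''ind'' (Var ''root'')) (Num 1)) Skip
       (Assign ''ind'' (Var ''root'') (Num 1) ;; Assign ''ind'' (Var ''w'') (Num 1) ;;
        If (Equal (Var ''started'') (Num 1)) (emit (Var ''sink'') (Var ''w''))
          (set_var ''source'' (Var ''w'') ;; set_var ''started'' (Num 1)) ;;
        set_var ''sink'' (Var ''root''))"

text \<open>If the mate of \<open>w\<close> is itself unflagged, it serves as the sink. Otherwise a
  search looks for a reachable unflagged sink, passing through sinks already on the chain because
  these are flagged; a stuck search shows that everything reachable is flagged.\<close>

definition chain_step :: com where
  "chain_step =
     If (Equal (Cell ''ind'' (Var ''w'')) (Num 1)) Skip
       (set_var ''root'' (Cell ''mate'' (Var ''w'')) ;;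
        If (Equal (Cell ''ind'' (Var ''root'')) (Num 1))
          (search ''ind'' ;;
           If (Equal (Var ''found'') (Num 0)) Skip (set_var ''root'' (Cell ''mate'' (Var ''goal''))))
          Skip ;;
        chain_commit) ;;
     incr ''w''"

definition phase_chain :: com where
  "phase_chain =
     set_var ''w'' (Var ''p'') ;; set_var ''started'' (Num 0) ;;
     While (Less (Var ''w'') (Var ''total'')) chain_step"

text \<open>Leftover sinks and sources are joined to each other; once one kind is exhausted, an end
  of the chain takes its place. The number of edges is thus the maximum of the two leftover counts,
  not their sum.\<close>

definition rest_step :: com where
  "rest_step =
     If (And (Less (Var ''u'') (Var ''p'')) (Equal (Cell ''ind'' (Var ''u'')) (Num 1))) (incr ''u'')
       (If (And (Less (Var ''w'') (Var ''total'')) (Equal (Cell ''ind'' (Var ''w'')) (Num 1))) (incr ''w'')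
         (If (Less (Var ''u'') (Var ''p'')) (set_var ''x'' (Var ''u'') ;; incr ''u'') (set_var ''x'' (Var ''sink'')) ;;
          If (Less (Var ''w'') (Var ''total'')) (set_var ''y'' (Var ''w'') ;; incr ''w'') (set_var ''y'' (Var ''source'')) ;;
          emit (Var ''x'') (Var ''y'')))"

definition phase_rest :: com where
  "phase_rest =
     set_var ''u'' (Num 0) ;; set_var ''w'' (Var ''p'') ;;
     While (Not (And (Not (Less (Var ''u'') (Var ''p''))) (Not (Less (Var ''w'') (Var ''total''))))) rest_step"

text \<open>With all flags set, the search from \<open>sink\<close> explores all that it reaches
  along old edges and the matching. If this is all of \<open>V^-\<close>, the edge from
  \<open>sink\<close> to \<open>source\<close> is redundant.\<close>

definition phase_close :: com where
  "phase_close =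
     If (Equal (Var ''started'') (Num 1))
       (set_var ''root'' (Var ''sink'') ;; search ''cov'' ;;
        If (Equal (Var ''count'') (Var ''n'')) Skip (emit (Var ''sink'') (Var ''source'')))
       Skip"

section \<open>Correctness of the phases that destroy closed sets\<close>

context graph_mem
begin

lemma exposed_exists:
  assumes \<mu>: "invol \<mu>" and pn: "p < n"
  shows "\<exists>y\<ge>p. y < p + n \<and> \<mu> y = y"
proof (rule ccontr)
  assume neg: "\<not> ?thesis"
  have "\<mu> ` {p..<p + n} \<subseteq> {..<p}"
  proof
    fix x assume "x \<in> \<mu> ` {p..<p + n}"
    then obtain y where y: "p \<le> y" "y < p + n" "x = \<mu> y" by auto
    then have "\<mu> y \<noteq> y" using neg by blast
    then show "x \<in> {..<p}" using invol_D(3)[OF \<mu> y(2)] y by simp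
  qed
  then have "card (\<mu> ` {p..<p + n}) \<le> card {..<p}" by (intro card_mono) simp_all
  moreover have "inj_on \<mu> {p..<p + n}" by (rule inj_on_subset[OF invol_inj_on[OF \<mu>]]) auto
  then have "card (\<mu> ` {p..<p + n}) = n" by (simp add: card_image)
  ultimately show False using pn by simp
qed

definition sinks_inv where
  "sinks_inv ind w E k T s t \<longleftrightarrow> s ''ind'' = ind \<and> s ''w'' 0 = (w::nat) \<and> s ''p'' 0 = p \<and> s ''u'' 0 \<le> p \<and>
     output_edges s = E \<union> (\<lambda>x. (x, w)) ` {x. x < s ''u'' 0 \<and> ind x \<noteq> (1::nat)} \<and>
     s ''F_size'' 0 = k + card {x. x < s ''u'' 0 \<and> ind x \<noteq> 1} \<and>
     t + 100 * (p - s ''u'' 0) + 10 \<le> (T::nat)"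

lemma sinks_step:
  assumes inv: "sinks_inv ind w E k T s t" and less: "s ''u'' 0 < p"
  shows "wp (If (Equal (Cell ''ind'' (Var ''u'')) (Num 1)) Skip (emit (Var ''u'') (Var ''w'')) ;; incr ''u'')
    (sinks_inv ind w E k T) s (t + 6)"
proof -
  obtain u where u: "s ''u'' 0 = u" by blast
  have f: "s ''ind'' = ind" "s ''w'' 0 = w" "s ''p'' 0 = p" and up: "u < p"
    and E: "output_edges s = E \<union> (\<lambda>x. (x, w)) ` {x. x < u \<and> ind x \<noteq> 1}"
    and k: "s ''F_size'' 0 = k + card {x. x < u \<and> ind x \<noteq> 1}" and t: "t + 100 * (p - u) + 10 \<le> T"
    using inv less u unfolding sinks_inv_def by simp_all
  have pu: "p - u = Suc (p - Suc u)" using up by simp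
  show ?thesis
  proof (cases "ind u = 1")
    case True
    then have *: "{x. x < Suc u \<and> ind x \<noteq> 1} = {x. x < u \<and> ind x \<noteq> 1}" by (auto simp: less_Suc_eq)
    show ?thesis using True u f up E k t pu *
      by (simp add: wp_simps sinks_inv_def output_edges_def)
  next
    case False
    then have *: "{x. x < Suc u \<and> ind x \<noteq> 1} = insert u {x. x < u \<and> ind x \<noteq> 1}" by (auto simp: less_Suc_eq)
    have "outs ((s ''F_tail'')(s ''F_size'' 0 := u)) ((s ''F_head'')(s ''F_size'' 0 := w)) (Suc (s ''F_size'' 0))
        = E \<union> (\<lambda>x. (x, w)) ` {x. x < Suc u \<and> ind x \<noteq> 1}"
      unfolding outs_Suc output_edges_outs[symmetric] E * by auto
    moreover have "card {x. x < Suc u \<and> ind x \<noteq> 1} = Suc (card {x. x < u \<and> ind x \<noteq> 1})"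
      unfolding * by simp
    ultimately show ?thesis using False u f up k t pu unfolding emit_def
      by (simp add: wp_simps sinks_inv_def output_edges_outs)
  qed
qed

definition scan_inv where
  "scan_inv \<mu> E k ind T s t \<longleftrightarrow> s ''mate'' = \<mu> \<and> s ''ind'' = ind \<and> s ''p'' 0 = p \<and> output_edges s = E \<and>
     s ''F_size'' 0 = (k::nat) \<and> p \<le> s ''w'' 0 \<and> s ''w'' 0 < p + n \<and> (\<forall>y<s ''w'' 0. p \<le> y \<longrightarrow> \<mu> y \<noteq> y) \<and>
     t + 100 * (p + n - s ''w'' 0) + 10 \<le> (T::nat)"

lemma phase_unbalanced_correct:
  assumes b: "base s" and \<mu>: "invol (s ''mate'')" and pn: "p < n"
    and Q: "\<And>s' t' w. \<lbrakk>p \<le> w; w < p + n; s ''mate'' w = w;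
      output_edges s' = output_edges s \<union> (\<lambda>x. (x, w)) ` {x. x < p \<and> s ''ind'' x \<noteq> 1};
      s' ''F_size'' 0 = s ''F_size'' 0 + card {x. x < p \<and> s ''ind'' x \<noteq> 1};
      t' \<le> t + 100 * (p + n) + 100\<rbrakk> \<Longrightarrow> Q s' t'"
  shows "wp phase_unbalanced Q s t"
proof -
  let ?s = "s(''w'' := (s ''w'')(0 := p))" and ?\<mu> = "s ''mate''" and ?ind = "s ''ind''"
  let ?E = "output_edges s" and ?k = "s ''F_size'' 0"
  let ?T = "t + 100 * n + 20"
  let ?c1 = "Not (Equal (Cell ''mate'' (Var ''w'')) (Var ''w''))"
  let ?body = "If (Equal (Cell ''ind'' (Var ''u'')) (Num 1)) Skip (emit (Var ''u'') (Var ''w'')) ;; incr ''u''"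
  let ?rest = "set_var ''u'' (Num 0) ;; While (Less (Var ''u'') (Var ''p'')) ?body"
  obtain y0 where y0: "p \<le> y0" "y0 < p + n" "?\<mu> y0 = y0" using exposed_exists[OF \<mu> pn] by blast
  have "wp (While ?c1 (incr ''w'')) (wp ?rest Q) ?s (t + 4)"
  proof (rule wp_WhileI[where I = "scan_inv ?\<mu> ?E ?k ?ind ?T" and K = ?T])
    show "scan_inv ?\<mu> ?E ?k ?ind ?T ?s (t + 4)" using b pn unfolding scan_inv_def
      by (simp add: output_edges_def base_def)
  next
    fix s1 t1 assume "scan_inv ?\<mu> ?E ?k ?ind ?T s1 t1"
    then show "t1 \<le> ?T" unfolding scan_inv_def by simp
  next
    fix s1 t1 assume I: "scan_inv ?\<mu> ?E ?k ?ind ?T s1 t1" and c: "bval ?c1 s1"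
    obtain w where w: "s1 ''w'' 0 = w" by blast
    have f: "s1 ''mate'' = ?\<mu>" "s1 ''ind'' = ?ind" "s1 ''p'' 0 = p" "output_edges s1 = ?E" "s1 ''F_size'' 0 = ?k"
      "p \<le> w" "w < p + n" "\<forall>y<w. p \<le> y \<longrightarrow> ?\<mu> y \<noteq> y" "t1 + 100 * (p + n - w) + 10 \<le> ?T"
      using I w unfolding scan_inv_def by simp_all
    have mw: "?\<mu> w \<noteq> w" using c f(1) w by simp
    have "w \<noteq> y0" using mw y0(3) by auto
    moreover have "w \<le> y0"
    proof (rule ccontr)
      assume "\<not> w \<le> y0"
      then show False using f(8) y0 by simp
    qed
    ultimately have less: "Suc w < p + n" using y0(2) by simp
    have al: "\<forall>y<Suc w. p \<le> y \<longrightarrow> ?\<mu> y \<noteq> y"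
    proof (intro allI impI)
      fix y assume "y < Suc w" "p \<le> y"
      then show "?\<mu> y \<noteq> y" using f(8) mw by (cases "y = w") simp_all
    qed
    have pw: "p + n - w = Suc (p + n - Suc w)" using f(7) by simp
    show "wp (incr ''w'') (scan_inv ?\<mu> ?E ?k ?ind ?T) s1 (t1 + (1 + bcost ?c1))"
      using f less al w pw by (simp add: wp_simps scan_inv_def output_edges_def)
  next
    fix s1 t1 assume I: "scan_inv ?\<mu> ?E ?k ?ind ?T s1 t1" and c: "\<not> bval ?c1 s1"
    obtain w where w: "s1 ''w'' 0 = w" by blast
    have f: "s1 ''mate'' = ?\<mu>" "s1 ''ind'' = ?ind" "s1 ''p'' 0 = p" "output_edges s1 = ?E" "s1 ''F_size'' 0 = ?k"
      "p \<le> w" "w < p + n" "t1 + 10 \<le> ?T"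
      using I w unfolding scan_inv_def by simp_all
    have mw: "?\<mu> w = w" using c f(1) w by simp
    let ?s1 = "s1(''u'' := (s1 ''u'')(0 := 0))"
    let ?T2 = "t1 + 100 * p + 40"
    have "wp (While (Less (Var ''u'') (Var ''p'')) ?body) Q ?s1 (t1 + 11)"
    proof (rule wp_WhileI[where I = "sinks_inv ?ind w ?E ?k ?T2" and K = ?T2])
      show "sinks_inv ?ind w ?E ?k ?T2 ?s1 (t1 + 11)"
        using f w unfolding sinks_inv_def by (simp add: output_edges_def)
    next
      fix s2 t2 assume "sinks_inv ?ind w ?E ?k ?T2 s2 t2"
      then show "t2 \<le> ?T2" unfolding sinks_inv_def by simp
    next
      fix s2 t2 assume I2: "sinks_inv ?ind w ?E ?k ?T2 s2 t2" and c2: "bval (Less (Var ''u'') (Var ''p'')) s2"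
      have "s2 ''p'' 0 = p" using I2 unfolding sinks_inv_def by blast
      then have "s2 ''u'' 0 < p" using c2 by simp
      from sinks_step[OF I2 this]
      show "wp ?body (sinks_inv ?ind w ?E ?k ?T2) s2 (t2 + (1 + bcost (Less (Var ''u'') (Var ''p''))))"
        by (simp add: eval_nat_numeral)
    next
      fix s2 t2 assume I2: "sinks_inv ?ind w ?E ?k ?T2 s2 t2" and c2: "\<not> bval (Less (Var ''u'') (Var ''p'')) s2"
      have "s2 ''p'' 0 = p" "s2 ''u'' 0 \<le> p" using I2 unfolding sinks_inv_def by blast+
      then have u: "s2 ''u'' 0 = p" using c2 by simp
      show "Q s2 (t2 + (1 + bcost (Less (Var ''u'') (Var ''p''))))"
        by (rule Q[OF f(6,7) mw]) (use I2 f(8) in \<open>simp_all add: sinks_inv_def u\<close>)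
    qed
    then show "wp ?rest Q s1 (t1 + (1 + bcost ?c1))" by (simp add: wp_Seq wp_Assign eval_nat_numeral)
  qed
  then show ?thesis unfolding phase_unbalanced_def using b
    by (simp add: wp_Seq_fun wp_Assign base_def eval_nat_numeral)
qed

text \<open>Closed sets of the digraph on \<open>V\<^sup>+\<close> with arcs \<open>(x, \<mu> y)\<close> for the edges \<open>(x, y)\<close>.\<close>

definition fclosed :: "(nat \<Rightarrow> nat) \<Rightarrow> (nat \<times> nat) set \<Rightarrow> nat set \<Rightarrow> bool" where
  "fclosed \<mu> E X \<longleftrightarrow> X \<subseteq> {..<p} \<and> (\<forall>x\<in>X. \<forall>y\<in>N x. \<mu> y \<in> X) \<and> (\<forall>x\<in>X. \<forall>y. (x, y) \<in> E \<longrightarrow> \<mu> y \<in> X)"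

lemma fclosed_mono: "fclosed \<mu> E' X \<Longrightarrow> E \<subseteq> E' \<Longrightarrow> fclosed \<mu> E X"
  unfolding fclosed_def by blast

text \<open>\<open>SC\<close> and \<open>TC\<close> are the ends of the chained source-sink pairs, \<open>d\<close> is the source of the first pair
  and \<open>b\<close> the sink of the last one: everything on the chain is reachable from \<open>d\<close> and reaches \<open>b\<close>.\<close>

definition chain_ok :: "(nat \<Rightarrow> nat) \<Rightarrow> nat set \<Rightarrow> (nat \<times> nat) set \<Rightarrow> nat \<Rightarrow>
    nat set \<Rightarrow> (nat \<times> nat) set \<Rightarrow> nat \<Rightarrow> nat set \<Rightarrow> nat set \<Rightarrow> nat \<Rightarrow> nat \<Rightarrow> nat \<Rightarrow> bool" where
  "chain_ok \<mu> J0 E0 k0 J E k SC TC started d b \<longleftrightarrow>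
     J = J0 \<union> SC \<union> TC \<and> J0 \<inter> (SC \<union> TC) = {} \<and> SC \<subseteq> {p..<p + n} \<and> TC \<subseteq> {..<p} \<and> card SC = card TC \<and>
     E0 \<subseteq> E \<and> E - E0 \<subseteq> {..<p} \<times> {p..<p + n} \<and>
     (started = 0 \<and> TC = {} \<and> E = E0 \<and> k = k0 \<or>
      started = 1 \<and> d \<in> SC \<and> b \<in> TC \<and> Suc k = k0 + card TC \<and>
      (\<forall>X. fclosed \<mu> E X \<longrightarrow> \<mu> d \<in> X \<longrightarrow> \<mu> ` SC \<subseteq> X \<and> TC \<subseteq> X) \<and>
      (\<forall>X. fclosed \<mu> E X \<longrightarrow> TC \<inter> X \<noteq> {} \<longrightarrow> b \<in> X))"

lemma chain_okD:
  assumes "chain_ok \<mu> J0 E0 k0 J E k SC TC started d b"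
  shows "J = J0 \<union> SC \<union> TC" "J0 \<inter> (SC \<union> TC) = {}" "SC \<subseteq> {p..<p + n}" "TC \<subseteq> {..<p}" "card SC = card TC"
    "E0 \<subseteq> E" "E - E0 \<subseteq> {..<p} \<times> {p..<p + n}"
    "started = 0 \<and> TC = {} \<and> E = E0 \<and> k = k0 \<or>
      started = 1 \<and> d \<in> SC \<and> b \<in> TC \<and> Suc k = k0 + card TC \<and>
      (\<forall>X. fclosed \<mu> E X \<longrightarrow> \<mu> d \<in> X \<longrightarrow> \<mu> ` SC \<subseteq> X \<and> TC \<subseteq> X) \<and>
      (\<forall>X. fclosed \<mu> E X \<longrightarrow> TC \<inter> X \<noteq> {} \<longrightarrow> b \<in> X)"
  using assms unfolding chain_ok_def by auto

text \<open>A closed set containing the old last sink \<open>b\<close> contains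
  \<open>\<mu> w\<close> through the new edge and then \<open>b'\<close> by \<open>reach\<close>. So
  what \<open>d\<close> reaches and what reaches the end of the chain both extend to the new
  pair.\<close>

lemma chain_ok_add:
  assumes ok: "chain_ok \<mu> J0 E0 k0 J E k SC TC started d b"
    and w: "p \<le> w" "w < p + n" "w \<notin> J" and b': "b' < p" "b' \<notin> J"
    and reach: "\<And>X. fclosed \<mu> {} X \<Longrightarrow> \<mu> w \<in> X \<Longrightarrow> b' \<in> X"
  shows "if started = 1
    then chain_ok \<mu> J0 E0 k0 (insert w (insert b' J)) (insert (b, w) E) (Suc k) (insert w SC) (insert b' TC) 1 d b'
    else chain_ok \<mu> J0 E0 k0 (insert w (insert b' J)) E k (insert w SC) (insert b' TC) 1 w b'"
proof -
  note C = chain_okD[OF ok]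
  have fin: "finite SC" "finite TC"
    by (rule finite_subset[OF C(3)], simp) (rule finite_subset[OF C(4)], simp)
  have new: "w \<notin> SC" "b' \<notin> TC" using w b' C(1) by auto
  have J: "insert w (insert b' J) = J0 \<union> insert w SC \<union> insert b' TC" using C(1) by blast
  have disj: "J0 \<inter> (insert w SC \<union> insert b' TC) = {}" using C(1,2) w(3) b'(2) by blast
  have sub: "insert w SC \<subseteq> {p..<p + n}" "insert b' TC \<subseteq> {..<p}" using C(3,4) w b' by auto
  have card: "card (insert w SC) = card (insert b' TC)" using fin new C(5) by simp
  show ?thesis
  proof (cases "started = 1")
    case True
    then have S: "d \<in> SC" "b \<in> TC" "Suc k = k0 + card TC"
      and 1: "\<And>X. fclosed \<mu> E X \<Longrightarrow> \<mu> d \<in> X \<Longrightarrow> \<mu> ` SC \<subseteq> X \<and> TC \<subseteq> X"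
      and 2: "\<And>X. fclosed \<mu> E X \<Longrightarrow> TC \<inter> X \<noteq> {} \<Longrightarrow> b \<in> X"
      using C(8) by auto
    let ?E = "insert (b, w) E"
    have bw: "\<mu> w \<in> X \<and> b' \<in> X" if X: "fclosed \<mu> ?E X" "b \<in> X" for X
    proof -
      have "\<mu> w \<in> X" using X unfolding fclosed_def by blast
      moreover have "b' \<in> X" by (rule reach[OF fclosed_mono[OF X(1)] \<open>\<mu> w \<in> X\<close>]) simp
      ultimately show ?thesis by blast
    qed
    have "chain_ok \<mu> J0 E0 k0 (insert w (insert b' J)) ?E (Suc k) (insert w SC) (insert b' TC) 1 d b'"
      unfolding chain_ok_def
    proof (intro conjI disjI2 allI impI)
      show "?E - E0 \<subseteq> {..<p} \<times> {p..<p + n}" using C(4,7) S(2) w by auto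
      show "Suc (Suc k) = k0 + card (insert b' TC)" using S(3) fin new by simp
      fix X assume X: "fclosed \<mu> ?E X"
      have X': "fclosed \<mu> E X" by (rule fclosed_mono[OF X]) blast
      {
        assume d: "\<mu> d \<in> X"
        have old: "\<mu> ` SC \<subseteq> X" "TC \<subseteq> X" using 1[OF X' d] by auto
        then have "b \<in> X" using S(2) by blast
        from bw[OF X this] show "\<mu> ` insert w SC \<subseteq> X" "insert b' TC \<subseteq> X" using old by auto
      }
      {
        assume "insert b' TC \<inter> X \<noteq> {}"
        then consider "b' \<in> X" | "TC \<inter> X \<noteq> {}" by blast
        then show "b' \<in> X" using 2[OF X'] bw[OF X] by cases auto
      }
    qed (use J disj sub card S(1) C(6) in auto)
    then show ?thesis using True by simp
  next
    case False
    then have S: "TC = {}" "E = E0" "k = k0" using C(8) by auto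
    have "SC = {}" using S(1) C(5) fin by simp
    have "chain_ok \<mu> J0 E0 k0 (insert w (insert b' J)) E k (insert w SC) (insert b' TC) 1 w b'"
      unfolding chain_ok_def
    proof (intro conjI disjI2 allI impI)
      show "Suc k = k0 + card (insert b' TC)" using S by simp
      fix X assume X: "fclosed \<mu> E X"
      have X': "fclosed \<mu> {} X" by (rule fclosed_mono[OF X]) blast
      {
        assume "\<mu> w \<in> X"
        with reach[OF X' this] show "\<mu> ` insert w SC \<subseteq> X" "insert b' TC \<subseteq> X"
          using S(1) \<open>SC = {}\<close> by auto
      }
      {
        assume "insert b' TC \<inter> X \<noteq> {}"
        then show "b' \<in> X" using S(1) by auto
      }
    qed (use J disj sub card C(6,7) in auto)
    then show ?thesis using False by simp
  qed
qed

definition chain_state where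
  "chain_state \<mu> J0 E0 k0 s \<longleftrightarrow>
     base s \<and> s ''mate'' = \<mu> \<and> p \<le> s ''w'' 0 \<and> s ''w'' 0 \<le> p + n \<and>
     (\<exists>SC TC. chain_ok \<mu> J0 E0 k0 {x. s ''ind'' x = 1} (output_edges s) (s ''F_size'' 0) SC TC
        (s ''started'' 0) (s ''source'' 0) (s ''sink'' 0)) \<and>
     (\<forall>y<s ''w'' 0. p \<le> y \<longrightarrow> s ''ind'' y \<noteq> 1 \<longrightarrow>
        (\<exists>X. fclosed \<mu> {} X \<and> \<mu> y \<in> X \<and> X \<subseteq> {x. s ''ind'' x = 1}))"

lemma chain_stateI:
  assumes "base s" "s ''mate'' = \<mu>" "p \<le> s ''w'' 0" "s ''w'' 0 \<le> p + n"
    "chain_ok \<mu> J0 E0 k0 {x. s ''ind'' x = 1} (output_edges s) (s ''F_size'' 0) SC TC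
        (s ''started'' 0) (s ''source'' 0) (s ''sink'' 0)"
    "\<And>y. y < s ''w'' 0 \<Longrightarrow> p \<le> y \<Longrightarrow> s ''ind'' y \<noteq> 1 \<Longrightarrow>
        \<exists>X. fclosed \<mu> {} X \<and> \<mu> y \<in> X \<and> X \<subseteq> {x. s ''ind'' x = 1}"
  shows "chain_state \<mu> J0 E0 k0 s"
  using assms unfolding chain_state_def by blast

lemma chain_stateE:
  assumes "chain_state \<mu> J0 E0 k0 s"
  obtains SC TC where "base s" "s ''mate'' = \<mu>" "p \<le> s ''w'' 0" "s ''w'' 0 \<le> p + n"
    "chain_ok \<mu> J0 E0 k0 {x. s ''ind'' x = 1} (output_edges s) (s ''F_size'' 0) SC TC
        (s ''started'' 0) (s ''source'' 0) (s ''sink'' 0)"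
  using assms unfolding chain_state_def by blast

lemma chain_state_fail:
  assumes "chain_state \<mu> J0 E0 k0 s" "y < s ''w'' 0" "p \<le> y" "s ''ind'' y \<noteq> 1"
  shows "\<exists>X. fclosed \<mu> {} X \<and> \<mu> y \<in> X \<and> X \<subseteq> {x. s ''ind'' x = 1}"
  using assms unfolding chain_state_def by simp

lemma chain_state_cong:
  assumes st: "chain_state \<mu> J0 E0 k0 s" and b: "base s'"
    and eq: "\<And>v. v \<notin> insert ''root'' search_vars \<Longrightarrow> s' v = s v"
  shows "chain_state \<mu> J0 E0 k0 s'"
proof -
  have e: "s' ''mate'' = s ''mate''" "s' ''w'' = s ''w''" "s' ''ind'' = s ''ind''"
    "s' ''F_tail'' = s ''F_tail''" "s' ''F_head'' = s ''F_head''" "s' ''F_size'' = s ''F_size''"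
    "s' ''started'' = s ''started''" "s' ''source'' = s ''source''" "s' ''sink'' = s ''sink''"
    by (rule eq, simp add: search_vars_def)+
  have "output_edges s' = output_edges s" unfolding output_edges_def e ..
  with st b show ?thesis unfolding chain_state_def e by simp
qed

definition chain_inv where
  "chain_inv \<mu> J0 E0 k0 T s t \<longleftrightarrow>
     chain_state \<mu> J0 E0 k0 s \<and> t + 1000 * (m + 1) * (p + n - s ''w'' 0) + 10 \<le> (T::nat)"

text \<open>\<open>alt\<close> lists the two outcomes of the choice of \<open>root\<close>: a
  flagged one, with a certificate that no unflagged sink is reachable from \<open>w\<close>, or a
  reachable unflagged sink.\<close>

lemma chain_tail:
  assumes st: "chain_state \<mu> J0 E0 k0 s" and w: "s ''w'' 0 = w" "w < p + n" "s ''ind'' w \<noteq> 1"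
    and root: "s ''root'' 0 = r"
    and time: "t + 200 + 1000 * (m + 1) * (p + n - Suc w) + 10 \<le> T"
    and alt: "s ''ind'' r = 1 \<and> (\<exists>X. fclosed \<mu> {} X \<and> \<mu> w \<in> X \<and> X \<subseteq> {x. s ''ind'' x = 1}) \<or>
      s ''ind'' r \<noteq> 1 \<and> r < p \<and> (\<forall>X. fclosed \<mu> {} X \<longrightarrow> \<mu> w \<in> X \<longrightarrow> r \<in> X)"
  shows "wp chain_commit (wp (incr ''w'') (chain_inv \<mu> J0 E0 k0 T)) s t"
proof -
  let ?J = "{x. s ''ind'' x = 1}"
  obtain SC TC where S: "base s" "s ''mate'' = \<mu>" "p \<le> s ''w'' 0" "s ''w'' 0 \<le> p + n"
    "chain_ok \<mu> J0 E0 k0 ?J (output_edges s) (s ''F_size'' 0) SC TC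
        (s ''started'' 0) (s ''source'' 0) (s ''sink'' 0)"
    using st by (rule chain_stateE)
  note fail = chain_state_fail[OF st]
  have pw: "p \<le> w" using S(3) w(1) by simp
  from alt show ?thesis
  proof (elim disjE conjE)
    assume r: "s ''ind'' r = 1" and cert: "\<exists>X. fclosed \<mu> {} X \<and> \<mu> w \<in> X \<and> X \<subseteq> ?J"
    let ?s = "s(''w'' := (s ''w'')(0 := Suc w))"
    have "chain_state \<mu> J0 E0 k0 ?s"
    proof (rule chain_stateI)
      show "chain_ok \<mu> J0 E0 k0 {x. ?s ''ind'' x = 1} (output_edges ?s) (?s ''F_size'' 0) SC TC
        (?s ''started'' 0) (?s ''source'' 0) (?s ''sink'' 0)"
        using S(5) by (simp add: output_edges_def)
      fix y assume "y < ?s ''w'' 0" "p \<le> y" "?s ''ind'' y \<noteq> 1"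
      then show "\<exists>X. fclosed \<mu> {} X \<and> \<mu> y \<in> X \<and> X \<subseteq> {x. ?s ''ind'' x = 1}"
        using fail[of y] cert w(1) by (cases "y = w") simp_all
    qed (use S pw w in \<open>simp_all add: base_def\<close>)
    then show ?thesis unfolding chain_commit_def using r root w time by (simp add: wp_simps chain_inv_def)
  next
    assume r: "s ''ind'' r \<noteq> 1" "r < p"
      and reach: "\<forall>X. fclosed \<mu> {} X \<longrightarrow> \<mu> w \<in> X \<longrightarrow> r \<in> X"
    have add: "if s ''started'' 0 = 1
      then chain_ok \<mu> J0 E0 k0 (insert w (insert r ?J)) (insert (s ''sink'' 0, w) (output_edges s))
        (Suc (s ''F_size'' 0)) (insert w SC) (insert r TC) 1 (s ''source'' 0) r
      else chain_ok \<mu> J0 E0 k0 (insert w (insert r ?J)) (output_edges s) (s ''F_size'' 0)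
        (insert w SC) (insert r TC) 1 w r"
      by (rule chain_ok_add[OF S(5) pw w(2) _ r(2)]) (use w(3) r(1) reach in simp_all)
    have J: "{x. ((s ''ind'')(r := 1, w := 1)) x = 1} = insert w (insert r ?J)" by auto
    have fail': "\<exists>X. fclosed \<mu> {} X \<and> \<mu> y \<in> X \<and> X \<subseteq> insert w (insert r ?J)"
      if y: "y < Suc w" "p \<le> y" "((s ''ind'')(r := 1, w := 1)) y \<noteq> 1" for y
    proof -
      have "y \<noteq> w" "s ''ind'' y \<noteq> 1" using y(3) by (auto split: if_splits)
      then obtain X where "fclosed \<mu> {} X" "\<mu> y \<in> X" "X \<subseteq> ?J" using fail[of y] y w(1) by auto
      then show ?thesis by (intro exI[of _ X]) blast
    qed
    have rw: "r \<noteq> w" "w \<noteq> r" using r(2) pw by simp_all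
    have state: "chain_state \<mu> J0 E0 k0 s'" if b: "base s'" and e: "s' ''mate'' = \<mu>" "s' ''w'' 0 = Suc w"
       "s' ''ind'' = (s ''ind'')(r := 1, w := 1)"
      and ok: "chain_ok \<mu> J0 E0 k0 (insert w (insert r ?J)) (output_edges s') (s' ''F_size'' 0)
        (insert w SC) (insert r TC) (s' ''started'' 0) (s' ''source'' 0) (s' ''sink'' 0)" for s'
    proof (rule chain_stateI)
      show "chain_ok \<mu> J0 E0 k0 {x. s' ''ind'' x = 1} (output_edges s') (s' ''F_size'' 0) (insert w SC) (insert r TC)
        (s' ''started'' 0) (s' ''source'' 0) (s' ''sink'' 0)"
        unfolding e(3) J by (rule ok)
      fix y assume "y < s' ''w'' 0" "p \<le> y" "s' ''ind'' y \<noteq> 1"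
      then show "\<exists>X. fclosed \<mu> {} X \<and> \<mu> y \<in> X \<and> X \<subseteq> {x. s' ''ind'' x = 1}"
        unfolding e(2,3) J by (rule fail')
    qed (use b e pw w in simp_all)
    have base: "base s" by (rule S(1))
    show ?thesis
    proof (cases "s ''started'' 0 = 1")
      case True
      then have ok: "chain_ok \<mu> J0 E0 k0 (insert w (insert r ?J)) (insert (s ''sink'' 0, w) (output_edges s))
        (Suc (s ''F_size'' 0)) (insert w SC) (insert r TC) 1 (s ''source'' 0) r" using add by simp
      show ?thesis using r root w rw time True unfolding emit_def chain_commit_def
        by (simp add: wp_simps chain_inv_def, intro state)
          (use base S(2) ok in \<open>simp_all add: base_def output_edges_outs outs_Suc\<close>)
    next
      case False
      then have ok: "chain_ok \<mu> J0 E0 k0 (insert w (insert r ?J)) (output_edges s) (s ''F_size'' 0)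
        (insert w SC) (insert r TC) 1 w r" using add by simp
      show ?thesis using r root w rw time False unfolding emit_def chain_commit_def
        by (simp add: wp_simps chain_inv_def, intro state)
          (use base S(2) ok in \<open>simp_all add: base_def output_edges_outs\<close>)
    qed
  qed
qed

lemma stuck_fclosed:
  assumes post: "search_post \<phi> \<mu> r s vis" and found: "s ''found'' 0 = 0"
    and \<mu>: "invol \<mu>" and r: "r < p"
  shows "fclosed \<mu> {} (reached \<phi> \<mu> r vis)"
proof -
  have rn: "r < p + n" using r by simp
  note S = search_stuck[OF post found \<mu> rn]
  have "reached \<phi> \<mu> r vis \<subseteq> {..<p}" using S(2) r unfolding same_side_def by auto
  moreover have "\<mu> y \<in> reached \<phi> \<mu> r vis" if "x \<in> reached \<phi> \<mu> r vis" "y \<in> N x" for x y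
  proof -
    have "y \<in> vis" using S(3) that unfolding nbrs_def by blast
    then show ?thesis using S(4) by blast
  qed
  ultimately show ?thesis unfolding fclosed_def by blast
qed

lemma fclosed_reaches:
  assumes post: "search_post \<phi> \<mu> r s vis" and X: "fclosed \<mu> {} X" "r \<in> X" and y: "y \<in> vis"
  shows "\<mu> y \<in> X"
proof -
  have "vis \<subseteq> Gam X"
    using search_postD(1)[OF post] X(2) by (rule tree_sound) (use X(1) in \<open>auto simp: fclosed_def\<close>)
  then show ?thesis using y X(1) unfolding nbrs_def fclosed_def by blast
qed

lemma chain_step_correct:
  assumes inv: "chain_inv \<mu> J0 E0 k0 T s t" and less: "s ''w'' 0 < p + n"
    and \<mu>: "invol \<mu>" and perfect: "\<And>x. x < p + n \<Longrightarrow> \<mu> x \<noteq> x"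
  shows "wp chain_step (chain_inv \<mu> J0 E0 k0 T) s (t + 6)"
proof -
  obtain w where w: "s ''w'' 0 = w" by blast
  have st: "chain_state \<mu> J0 E0 k0 s" and time: "t + 1000 * (m + 1) * (p + n - w) + 10 \<le> T"
    using inv w unfolding chain_inv_def by simp_all
  have wn: "w < p + n" using less w by simp
  have time': "t + 1000 * (m + 1) + 1000 * (m + 1) * (p + n - Suc w) + 10 \<le> T"
  proof -
    have "p + n - w = Suc (p + n - Suc w)" using wn by simp
    then show ?thesis using time by simp
  qed
  obtain SC TC where S: "base s" "s ''mate'' = \<mu>" "p \<le> s ''w'' 0" "s ''w'' 0 \<le> p + n"
    "chain_ok \<mu> J0 E0 k0 {x. s ''ind'' x = 1} (output_edges s) (s ''F_size'' 0) SC TC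
        (s ''started'' 0) (s ''source'' 0) (s ''sink'' 0)"
    using st by (rule chain_stateE)
  note fail = chain_state_fail[OF st]
  have pw: "p \<le> w" using S(3) w by simp
  show ?thesis
  proof (cases "s ''ind'' w = 1")
    case True
    let ?s = "s(''w'' := (s ''w'')(0 := Suc w))"
    have "chain_state \<mu> J0 E0 k0 ?s"
    proof (rule chain_stateI)
      show "chain_ok \<mu> J0 E0 k0 {x. ?s ''ind'' x = 1} (output_edges ?s) (?s ''F_size'' 0) SC TC
        (?s ''started'' 0) (?s ''source'' 0) (?s ''sink'' 0)"
        using S(5) by (simp add: output_edges_def)
      fix y assume "y < ?s ''w'' 0" "p \<le> y" "?s ''ind'' y \<noteq> 1"
      then show "\<exists>X. fclosed \<mu> {} X \<and> \<mu> y \<in> X \<and> X \<subseteq> {x. ?s ''ind'' x = 1}"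
        using fail[of y] True w by (cases "y = w") simp_all
    qed (use S pw w wn in \<open>simp_all add: base_def\<close>)
    then show ?thesis unfolding chain_step_def using True w time'
      by (simp add: wp_simps chain_inv_def)
  next
    case False
    define r where "r = \<mu> w"
    have r: "r < p" using invol_D(3)[OF \<mu> wn perfect[OF wn]] pw unfolding r_def by simp
    let ?s = "s(''root'' := (s ''root'')(0 := r))"
    let ?R = "wp chain_commit (wp (incr ''w'') (chain_inv \<mu> J0 E0 k0 T))"
    let ?find = "If (Equal (Cell ''ind'' (Var ''root'')) (Num 1))
          (search ''ind'' ;;
           If (Equal (Var ''found'') (Num 0)) Skip (set_var ''root'' (Cell ''mate'' (Var ''goal''))))
          Skip"
    have bs: "base ?s" using S(1) unfolding base_def by simp
    have st': "chain_state \<mu> J0 E0 k0 ?s" by (rule chain_state_cong[OF st bs]) simp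
    have "wp ?find ?R ?s (t + 17)"
    proof (cases "s ''ind'' r = 1")
      case unflagged: False
      have "?R ?s (t + 24)"
        by (rule chain_tail[OF st', of w r]) (use w wn False unflagged r time' r_def in simp_all)
      then show ?thesis using unflagged by (simp add: wp_Skip wp_If eval_nat_numeral)
    next
      case flagged: True
      have "wp (search ''ind'') (wp (If (Equal (Var ''found'') (Num 0)) Skip
           (set_var ''root'' (Cell ''mate'' (Var ''goal'')))) ?R) ?s (t + 23)"
      proof (rule search_correct[OF bs])
        show "invol (?s ''mate'')" using \<mu> S(2) by simp
        show "?s ''root'' 0 < p + n" using r by simp
        show "''ind'' \<notin> search_vars" unfolding search_vars_def by simp
        fix s1 t1 vis assume fr: "\<forall>v. v \<notin> search_vars \<longrightarrow> s1 v = ?s v" and b1: "base s1"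
          and post0: "search_post (?s ''ind'') (?s ''mate'') (?s ''root'' 0) s1 vis"
          and t1: "t1 \<le> t + 23 + 700 * (m + 1)"
        have post: "search_post (s ''ind'') \<mu> r s1 vis" using post0 S(2) by simp
        have f: "s1 ''ind'' = s ''ind''" "s1 ''w'' 0 = w" "s1 ''root'' 0 = r" "s1 ''mate'' = \<mu>"
          using fr w S(2) unfolding search_vars_def by simp_all
        have st1: "chain_state \<mu> J0 E0 k0 s1"
          by (rule chain_state_cong[OF st b1]) (use fr in simp)
        show "wp (If (Equal (Var ''found'') (Num 0)) Skip
           (set_var ''root'' (Cell ''mate'' (Var ''goal'')))) ?R s1 t1"
        proof (cases "s1 ''found'' 0 = 0")
          case True
          have rn: "r < p + n" using r by simp
          note SS = search_stuck[OF post True \<mu> rn]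
          let ?X = "reached (s ''ind'') \<mu> r vis"
          have "?X \<subseteq> {x. s ''ind'' x = 1}" using SS(4,7) flagged by auto
          moreover have "fclosed \<mu> {} ?X" by (rule stuck_fclosed[OF post True \<mu> r])
          moreover have "\<mu> w \<in> ?X" using SS(1) r_def by simp
          ultimately have cert: "\<exists>X. fclosed \<mu> {} X \<and> \<mu> w \<in> X \<and> X \<subseteq> {x. s ''ind'' x = 1}" by blast
          have "?R s1 (t1 + 6)"
            by (rule chain_tail[OF st1, of w r]) (use f wn False flagged cert time' t1 in simp_all)
          then show ?thesis using True by (simp add: wp_Skip wp_If eval_nat_numeral)
        next
          case fnd: False
          let ?g = "s1 ''goal'' 0"
          let ?s2 = "s1(''root'' := (s1 ''root'')(0 := \<mu> ?g))"
          have g: "?g \<in> vis" "\<not> pass (s ''ind'') \<mu> ?g" using search_postD(4)[OF post fnd] by auto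
          note gs = treeD(1,2)[OF search_postD(1)[OF post] g(1)]
          have "\<mu> ?g \<noteq> ?g" by (rule perfect[OF gs(1)])
          then have gi: "s ''ind'' (\<mu> ?g) \<noteq> 1" and gp: "\<mu> ?g < p"
            using g(2) invol_D(3)[OF \<mu> gs(1)] gs(2) r unfolding pass_def by auto
          have b2: "base ?s2" using b1 unfolding base_def by simp
          have st2: "chain_state \<mu> J0 E0 k0 ?s2" by (rule chain_state_cong[OF st1 b2]) simp
          have "?R ?s2 (t1 + 10)"
          proof (rule chain_tail[OF st2, of w "\<mu> ?g"])
            show "?s2 ''ind'' (\<mu> ?g) = 1 \<and>
              (\<exists>X. fclosed \<mu> {} X \<and> \<mu> w \<in> X \<and> X \<subseteq> {x. ?s2 ''ind'' x = 1}) \<or>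
              ?s2 ''ind'' (\<mu> ?g) \<noteq> 1 \<and> \<mu> ?g < p \<and> (\<forall>X. fclosed \<mu> {} X \<longrightarrow> \<mu> w \<in> X \<longrightarrow> \<mu> ?g \<in> X)"
              using gi gp f(1) fclosed_reaches[OF post _ _ g(1)] r_def by simp
          qed (use f wn False time' t1 in simp_all)
          then show ?thesis using fnd f(4) by (simp add: wp_Assign wp_If eval_nat_numeral)
        qed
      qed
      then show ?thesis using flagged by (simp add: wp_Seq_fun wp_If eval_nat_numeral)
    qed
    then show ?thesis unfolding chain_step_def using False w S(2) r_def
      by (simp add: wp_Seq_fun wp_If wp_Assign eval_nat_numeral)
  qed
qed

lemma phase_chain_correct:
  assumes b: "base s" and mate: "s ''mate'' = \<mu>" and \<mu>: "invol \<mu>" and perfect: "\<And>x. x < p + n \<Longrightarrow> \<mu> x \<noteq> x"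
    and Q: "\<And>s' t'. \<lbrakk>s' ''cov'' = s ''cov''; s' ''w'' 0 = p + n;
      chain_state \<mu> {x. s ''ind'' x = 1} (output_edges s) (s ''F_size'' 0) s';
      t' \<le> t + 1000 * (m + 1) * (p + n) + 40\<rbrakk> \<Longrightarrow> Q s' t'"
  shows "wp phase_chain Q s t"
proof -
  let ?s = "s(''w'' := (s ''w'')(0 := p), ''started'' := (s ''started'')(0 := 0))"
  let ?T = "t + 1000 * (m + 1) * (p + n) + 30"
  let ?I = "chain_inv \<mu> {x. s ''ind'' x = 1} (output_edges s) (s ''F_size'' 0) ?T"
  have "wp (While (Less (Var ''w'') (Var ''total'')) chain_step) Q ?s (t + 7)"
  proof (rule wp_While_frameI[where I = ?I and K = ?T])
    have "chain_state \<mu> {x. s ''ind'' x = 1} (output_edges s) (s ''F_size'' 0) ?s"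
      by (rule chain_stateI[where SC = "{}" and TC = "{}"])
        (use b mate in \<open>simp_all add: base_def chain_ok_def output_edges_def\<close>)
    moreover have "1000 * (m + 1) * (p + n - ?s ''w'' 0) \<le> 1000 * (m + 1) * (p + n)"
      by (rule mult_le_mono2) simp
    then have "t + 7 + 1000 * (m + 1) * (p + n - ?s ''w'' 0) + 10 \<le> ?T" by linarith
    ultimately show "?I ?s (t + 7)" unfolding chain_inv_def by blast
  next
    fix s1 t1 assume "?I s1 t1"
    then show "t1 \<le> ?T" unfolding chain_inv_def by simp
  next
    fix s1 t1 assume I: "?I s1 t1" and c: "bval (Less (Var ''w'') (Var ''total'')) s1"
    have "base s1" using I unfolding chain_inv_def chain_state_def by blast
    then have "s1 ''w'' 0 < p + n" using c unfolding base_def by simp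
    from chain_step_correct[OF I this \<mu> perfect]
    show "wp chain_step ?I s1 (t1 + (1 + bcost (Less (Var ''w'') (Var ''total''))))"
      by (simp add: eval_nat_numeral)
  next
    fix s1 t1 assume I: "?I s1 t1" and c: "\<not> bval (Less (Var ''w'') (Var ''total'')) s1"
      and fr: "\<forall>x. x \<notin> mods chain_step \<longrightarrow> s1 x = ?s x"
    have st: "chain_state \<mu> {x. s ''ind'' x = 1} (output_edges s) (s ''F_size'' 0) s1" "t1 + 10 \<le> ?T"
      using I unfolding chain_inv_def by simp_all
    then have "base s1" "s1 ''w'' 0 \<le> p + n" unfolding chain_state_def by blast+
    then have w: "s1 ''w'' 0 = p + n" using c unfolding base_def by simp
    have "''cov'' \<notin> mods chain_step" unfolding chain_step_def chain_commit_def emit_def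
      by (simp add: mods_search search_vars_def)
    then have "s1 ''cov'' = s ''cov''" using fr by simp
    then show "Q s1 (t1 + (1 + bcost (Less (Var ''w'') (Var ''total''))))"
      by (rule Q) (use st w in simp_all)
  qed
  then show ?thesis unfolding phase_chain_def using b
    by (simp add: wp_simps base_def eval_nat_numeral)
qed

definition unflagged :: "nat set \<Rightarrow> nat \<Rightarrow> nat \<Rightarrow> nat set" where
  "unflagged J u v = {x. u \<le> x \<and> x < v \<and> x \<notin> J}"

lemma finite_unflagged: "finite (unflagged J u v)"
  unfolding unflagged_def by simp

lemma unflagged_flagged: "u \<in> J \<Longrightarrow> unflagged J u v = unflagged J (Suc u) v"
  unfolding unflagged_def by (auto simp: Suc_le_eq le_less)

lemma card_unflagged_Suc:
  assumes "u < v" "u \<notin> J"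
  shows "card (unflagged J u v) = Suc (card (unflagged J (Suc u) v))"
proof -
  have "unflagged J u v = insert u (unflagged J (Suc u) v)"
    using assms unfolding unflagged_def by (auto simp: Suc_le_eq le_less)
  moreover have "u \<notin> unflagged J (Suc u) v" unfolding unflagged_def by simp
  ultimately show ?thesis using finite_unflagged by simp
qed

lemma unflagged_empty: "v \<le> u \<Longrightarrow> unflagged J u v = {}"
  unfolding unflagged_def by auto

text \<open>An emitted edge lowers each positive one of the two leftover counts by one, hence also
  their maximum, so \<open>F_size\<close> plus the maximum never exceeds \<open>K\<close>.\<close>

definition rest_inv where
  "rest_inv J b d E1 K T s t \<longleftrightarrow>
     s ''p'' 0 = p \<and> s ''total'' 0 = p + n \<and> {x. s ''ind'' x = (1::nat)} = J \<and> s ''sink'' 0 = b \<and> s ''source'' 0 = d \<and>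
     s ''u'' 0 \<le> p \<and> p \<le> s ''w'' 0 \<and> s ''w'' 0 \<le> p + n \<and>
     E1 \<subseteq> output_edges s \<and> output_edges s - E1 \<subseteq> {..<p} \<times> {p..<p + n} \<and>
     (\<forall>x\<in>unflagged J 0 (s ''u'' 0). \<exists>y. (x, y) \<in> output_edges s \<and> (y = d \<or> y \<in> unflagged J p (p + n))) \<and>
     (\<forall>y\<in>unflagged J p (s ''w'' 0). \<exists>x. (x, y) \<in> output_edges s \<and> (x = b \<or> x \<in> unflagged J 0 p)) \<and>
     s ''F_size'' 0 + max (card (unflagged J (s ''u'' 0) p)) (card (unflagged J (s ''w'' 0) (p + n))) \<le> (K::nat) \<and>
     t + 100 * ((p - s ''u'' 0) + (p + n - s ''w'' 0)) + 10 \<le> (T::nat)"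

lemma rest_invI:
  assumes "s ''p'' 0 = p" "s ''total'' 0 = p + n" "{x. s ''ind'' x = 1} = J" "s ''sink'' 0 = b" "s ''source'' 0 = d"
    "s ''u'' 0 \<le> p" "p \<le> s ''w'' 0" "s ''w'' 0 \<le> p + n"
    "E1 \<subseteq> output_edges s" "output_edges s - E1 \<subseteq> {..<p} \<times> {p..<p + n}"
    "\<And>x. x \<in> unflagged J 0 (s ''u'' 0) \<Longrightarrow> \<exists>y. (x, y) \<in> output_edges s \<and> (y = d \<or> y \<in> unflagged J p (p + n))"
    "\<And>y. y \<in> unflagged J p (s ''w'' 0) \<Longrightarrow> \<exists>x. (x, y) \<in> output_edges s \<and> (x = b \<or> x \<in> unflagged J 0 p)"
    "s ''F_size'' 0 + max (card (unflagged J (s ''u'' 0) p)) (card (unflagged J (s ''w'' 0) (p + n))) \<le> K"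
    "t + 100 * ((p - s ''u'' 0) + (p + n - s ''w'' 0)) + 10 \<le> T"
  shows "rest_inv J b d E1 K T s t"
  using assms unfolding rest_inv_def by blast

lemma rest_invD:
  assumes "rest_inv J b d E1 K T s t"
  shows "s ''p'' 0 = p" "s ''total'' 0 = p + n" "{x. s ''ind'' x = 1} = J" "s ''sink'' 0 = b" "s ''source'' 0 = d"
    "s ''u'' 0 \<le> p" "p \<le> s ''w'' 0" "s ''w'' 0 \<le> p + n"
    "E1 \<subseteq> output_edges s" "output_edges s - E1 \<subseteq> {..<p} \<times> {p..<p + n}"
    "\<And>x. x \<in> unflagged J 0 (s ''u'' 0) \<Longrightarrow> \<exists>y. (x, y) \<in> output_edges s \<and> (y = d \<or> y \<in> unflagged J p (p + n))"
    "\<And>y. y \<in> unflagged J p (s ''w'' 0) \<Longrightarrow> \<exists>x. (x, y) \<in> output_edges s \<and> (x = b \<or> x \<in> unflagged J 0 p)"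
    "s ''F_size'' 0 + max (card (unflagged J (s ''u'' 0) p)) (card (unflagged J (s ''w'' 0) (p + n))) \<le> K"
    "t + 100 * ((p - s ''u'' 0) + (p + n - s ''w'' 0)) + 10 \<le> T"
  using assms unfolding rest_inv_def by blast+

lemma rest_inv_mono:
  assumes "rest_inv J b d E1 K T s t" "t' \<le> t"
  shows "rest_inv J b d E1 K T s t'"
proof -
  note I = rest_invD[OF assms(1)]
  have "t' + 100 * ((p - s ''u'' 0) + (p + n - s ''w'' 0)) + 10 \<le> T" using I(14) assms(2) by linarith
  then show ?thesis by (intro rest_invI I)
qed

lemma unflagged_below_Suc:
  "x \<in> unflagged J v (Suc u) \<Longrightarrow> x \<in> unflagged J v u \<or> x = u \<and> u \<notin> J"
  unfolding unflagged_def by (auto simp: less_Suc_eq)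

lemma rest_emit:
  assumes inv: "rest_inv J b d E1 K T s t" and u: "s ''u'' 0 = u" and w: "s ''w'' 0 = w"
    and more: "u < p \<or> w < p + n" and bd: "b < p" "p \<le> d" "d < p + n"
    and uJ: "u < p \<Longrightarrow> u \<notin> J" and wJ: "w < p + n \<Longrightarrow> w \<notin> J"
    and eq: "\<And>v. v \<in> {''p'', ''total'', ''ind'', ''sink'', ''source''} \<Longrightarrow> s' v = s v"
    and x: "x = (if u < p then u else b)" and y: "y = (if w < p + n then w else d)"
    and u': "s' ''u'' 0 = (if u < p then Suc u else u)" and w': "s' ''w'' 0 = (if w < p + n then Suc w else w)"
    and out: "output_edges s' = insert (x, y) (output_edges s)" and k: "s' ''F_size'' 0 = Suc (s ''F_size'' 0)"
    and t': "t' \<le> t + 100"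
  shows "rest_inv J b d E1 K T s' t'"
proof -
  note I = rest_invD[OF inv]
  have up: "u \<le> p" and wn: "p \<le> w" "w \<le> p + n" using I(6,7,8) u w by simp_all
  have cu: "card (unflagged J u p) = (if u < p then Suc (card (unflagged J (Suc u) p)) else 0)"
    using card_unflagged_Suc[of u p J] uJ unflagged_empty[of p u J] by simp
  have cw: "card (unflagged J w (p + n)) = (if w < p + n then Suc (card (unflagged J (Suc w) (p + n))) else 0)"
    using card_unflagged_Suc[of w "p + n" J] wJ unflagged_empty[of "p + n" w J] by simp
  have max: "s ''F_size'' 0 + max (card (unflagged J u p)) (card (unflagged J w (p + n))) \<le> K"
    using I(13) u w by simp
  have xp: "x < p" "x = b \<or> x \<in> unflagged J 0 p" using x bd(1) uJ unfolding unflagged_def by auto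
  have yp: "p \<le> y" "y < p + n" "y = d \<or> y \<in> unflagged J p (p + n)"
    using y bd wJ wn unfolding unflagged_def by auto
  show ?thesis
  proof (rule rest_invI)
    show "output_edges s' - E1 \<subseteq> {..<p} \<times> {p..<p + n}" using I(10) xp yp unfolding out by auto
    show "s' ''F_size'' 0 + max (card (unflagged J (s' ''u'' 0) p)) (card (unflagged J (s' ''w'' 0) (p + n))) \<le> K"
    proof -
      have "unflagged J (s' ''u'' 0) p = {}" if "\<not> u < p" using that u' unflagged_empty[of p u J] by simp
      moreover have "unflagged J (s' ''w'' 0) (p + n) = {}" if "\<not> w < p + n"
        using that w' unflagged_empty[of "p + n" w J] by simp
      ultimately show ?thesis using max more cu cw u' w' k by (auto split: if_splits)
    qed
    show "t' + 100 * ((p - s' ''u'' 0) + (p + n - s' ''w'' 0)) + 10 \<le> T"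
    proof -
      have "(p - s' ''u'' 0) + (p + n - s' ''w'' 0) + 1 \<le> (p - u) + (p + n - w)"
        using more u' w' by (auto split: if_splits)
      then show ?thesis using I(14) t' u w by simp
    qed
  next
    fix z assume z: "z \<in> unflagged J 0 (s' ''u'' 0)"
    have "z \<in> unflagged J 0 u \<or> z = u \<and> u < p"
      using z u' unflagged_below_Suc[of z J 0 u] by (auto split: if_splits)
    then show "\<exists>y. (z, y) \<in> output_edges s' \<and> (y = d \<or> y \<in> unflagged J p (p + n))"
    proof
      assume "z \<in> unflagged J 0 u"
      then show ?thesis using I(11)[of z] u out by auto
    next
      assume "z = u \<and> u < p"
      then have "z = x" using x by simp
      then show ?thesis using yp(3) out by blast
    qed
  next
    fix z assume z: "z \<in> unflagged J p (s' ''w'' 0)"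
    have "z \<in> unflagged J p w \<or> z = w \<and> w < p + n"
      using z w' unflagged_below_Suc[of z J p w] by (auto split: if_splits)
    then show "\<exists>x. (x, z) \<in> output_edges s' \<and> (x = b \<or> x \<in> unflagged J 0 p)"
    proof
      assume "z \<in> unflagged J p w"
      then show ?thesis using I(12)[of z] w out by auto
    next
      assume "z = w \<and> w < p + n"
      then have "z = y" using y by simp
      then show ?thesis using xp(2) out by blast
    qed
  qed (use I(1,2,3,4,5,9) eq up wn u' w' out in \<open>auto split: if_splits\<close>)
qed

lemma rest_step_correct:
  assumes inv: "rest_inv J b d E1 K T s t" and more: "s ''u'' 0 < p \<or> s ''w'' 0 < p + n"
    and bd: "b < p" "p \<le> d" "d < p + n"
  shows "wp rest_step (rest_inv J b d E1 K T) s (t + 15)"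
proof -
  note I = rest_invD[OF inv]
  obtain u where u: "s ''u'' 0 = u" by blast
  obtain w where w: "s ''w'' 0 = w" by blast
  have J: "s ''ind'' x = 1 \<longleftrightarrow> x \<in> J" for x using I(3) by blast
  have J': "s ''ind'' x = Suc 0 \<longleftrightarrow> x \<in> J" for x using J[of x] by simp
  consider (a) "u < p" "u \<in> J" | (b) "\<not> (u < p \<and> u \<in> J)" "w < p + n" "w \<in> J" |
    (c) "u < p \<Longrightarrow> u \<notin> J" "w < p + n \<Longrightarrow> w \<notin> J" by blast
  then show ?thesis
  proof cases
    case a
    let ?s = "s(''u'' := (s ''u'')(0 := Suc u))"
    have 1: "unflagged J u p = unflagged J (Suc u) p" by (rule unflagged_flagged[OF a(2)])
    have 2: "p - u = Suc (p - Suc u)" using a(1) by simp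
    have o: "output_edges ?s = output_edges s" by (simp add: output_edges_def)
    have "rest_inv J b d E1 K T ?s (t + 50)"
    proof (rule rest_invI, unfold o)
      fix x assume "x \<in> unflagged J 0 (?s ''u'' 0)"
      then have "x \<in> unflagged J 0 u" using unflagged_below_Suc[of x J 0 u] a(2) by auto
      then show "\<exists>y. (x, y) \<in> output_edges s \<and> (y = d \<or> y \<in> unflagged J p (p + n))"
        using I(11)[of x] u by simp
    next
      fix y assume "y \<in> unflagged J p (?s ''w'' 0)"
      then show "\<exists>x. (x, y) \<in> output_edges s \<and> (x = b \<or> x \<in> unflagged J 0 p)"
        using I(12)[of y] by simp
    qed (use I(1-10,13,14) u a 1 2 in simp_all)
    note k = rest_inv_mono[OF this]
    show ?thesis unfolding rest_step_def using a u I(1) J'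
      by (simp add: wp_simps) (rule k, simp)
  next
    case b
    let ?s = "s(''w'' := (s ''w'')(0 := Suc w))"
    have 1: "unflagged J w (p + n) = unflagged J (Suc w) (p + n)" by (rule unflagged_flagged[OF b(3)])
    have 2: "p + n - w = Suc (p + n - Suc w)" using b(2) by simp
    have o: "output_edges ?s = output_edges s" by (simp add: output_edges_def)
    have "rest_inv J b d E1 K T ?s (t + 70)"
    proof (rule rest_invI, unfold o)
      fix x assume "x \<in> unflagged J 0 (?s ''u'' 0)"
      then show "\<exists>y. (x, y) \<in> output_edges s \<and> (y = d \<or> y \<in> unflagged J p (p + n))"
        using I(11)[of x] by simp
    next
      fix y assume "y \<in> unflagged J p (?s ''w'' 0)"
      then have "y \<in> unflagged J p w" using unflagged_below_Suc[of y J p w] b(3) by auto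
      then show "\<exists>x. (x, y) \<in> output_edges s \<and> (x = b \<or> x \<in> unflagged J 0 p)"
        using I(12)[of y] w by simp
    qed (use I(1-10,13,14) w b 1 2 in simp_all)
    note k = rest_inv_mono[OF this]
    show ?thesis
    proof (cases "u < p")
      case True
      then have "u \<notin> J" using b(1) by blast
      then show ?thesis unfolding rest_step_def using b True u w I(1,2) J'
        by (simp add: wp_simps) (rule k, simp)
    next
      case False
      then show ?thesis unfolding rest_step_def using b u w I(1,2) J'
        by (simp add: wp_simps) (rule k, simp)
    qed
  next
    case c
    have mr: "u < p \<or> w < p + n" using more u w by simp
    have em: "rest_inv J b d E1 K T s' t'"
      if "\<And>v. v \<in> {''p'', ''total'', ''ind'', ''sink'', ''source''} \<Longrightarrow> s' v = s v"
        "x = (if u < p then u else b)" "y = (if w < p + n then w else d)"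
        "s' ''u'' 0 = (if u < p then Suc u else u)" "s' ''w'' 0 = (if w < p + n then Suc w else w)"
        "output_edges s' = insert (x, y) (output_edges s)" "s' ''F_size'' 0 = Suc (s ''F_size'' 0)"
        "t' \<le> t + 100" for s' x y t'
      by (rule rest_emit[OF inv u w mr bd c that])
    consider (1) "u < p" "w < p + n" | (2) "u < p" "\<not> w < p + n" | (3) "\<not> u < p" "w < p + n" using mr by blast
    then show ?thesis
    proof cases
      case 1
      then show ?thesis unfolding rest_step_def emit_def using u w I(1,2) J' c
        by (simp add: wp_simps) (rule em[OF _ refl refl], auto simp: output_edges_outs outs_Suc)
    next
      case 2
      then show ?thesis unfolding rest_step_def emit_def using u w I(1,2,5) J' c
        by (simp add: wp_simps) (rule em[OF _ refl refl], auto simp: output_edges_outs outs_Suc)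
    next
      case 3
      then show ?thesis unfolding rest_step_def emit_def using u w I(1,2,4) J' c
        by (simp add: wp_simps) (rule em[OF _ refl refl], auto simp: output_edges_outs outs_Suc)
    qed
  qed
qed

lemma phase_rest_correct:
  assumes b: "base s" and J: "{x. s ''ind'' x = 1} = J"
    and bd: "0 < p + n \<Longrightarrow> s ''sink'' 0 < p \<and> p \<le> s ''source'' 0 \<and> s ''source'' 0 < p + n"
    and Q: "\<And>s' t'. \<lbrakk>\<forall>v. v \<notin> {''u'', ''w'', ''x'', ''y'', ''F_tail'', ''F_head'', ''F_size''} \<longrightarrow> s' v = s v;
      output_edges s \<subseteq> output_edges s'; output_edges s' - output_edges s \<subseteq> {..<p} \<times> {p..<p + n};
      \<And>x. x \<in> unflagged J 0 p \<Longrightarrow>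
        \<exists>y. (x, y) \<in> output_edges s' \<and> (y = s ''source'' 0 \<or> y \<in> unflagged J p (p + n));
      \<And>y. y \<in> unflagged J p (p + n) \<Longrightarrow>
        \<exists>x. (x, y) \<in> output_edges s' \<and> (x = s ''sink'' 0 \<or> x \<in> unflagged J 0 p);
      s' ''F_size'' 0 \<le> s ''F_size'' 0 + max (card (unflagged J 0 p)) (card (unflagged J p (p + n)));
      t' \<le> t + 100 * (p + n) + 40\<rbrakk> \<Longrightarrow> Q s' t'"
  shows "wp phase_rest Q s t"
proof -
  let ?s = "s(''u'' := (s ''u'')(0 := 0), ''w'' := (s ''w'')(0 := p))"
  let ?T = "t + 100 * (p + n) + 20"
  let ?V = "{''u'', ''w'', ''x'', ''y'', ''F_tail'', ''F_head'', ''F_size''}"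
  let ?I = "rest_inv J (s ''sink'' 0) (s ''source'' 0) (output_edges s)
    (s ''F_size'' 0 + max (card (unflagged J 0 p)) (card (unflagged J p (p + n)))) ?T"
  let ?c = "Not (And (Not (Less (Var ''u'') (Var ''p''))) (Not (Less (Var ''w'') (Var ''total''))))"
  have md: "mods rest_step \<subseteq> ?V" unfolding rest_step_def emit_def by auto
  have "wp (While ?c rest_step) Q ?s (t + 7)"
  proof (rule wp_While_frameI[where I = ?I and K = ?T])
    show "?I ?s (t + 7)"
      by (rule rest_invI) (use b J in \<open>simp_all add: base_def output_edges_def unflagged_def\<close>)
  next
    fix s1 t1 assume "?I s1 t1"
    from rest_invD(14)[OF this] show "t1 \<le> ?T" by simp
  next
    fix s1 t1 assume I: "?I s1 t1" and c: "bval ?c s1"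
    have more: "s1 ''u'' 0 < p \<or> s1 ''w'' 0 < p + n" using c rest_invD(1,2)[OF I] by auto
    then have "0 < p + n" by linarith
    note bd' = bd[OF this]
    have "wp rest_step ?I s1 (t1 + 15)" by (rule rest_step_correct[OF I more]) (use bd' in simp_all)
    moreover have "1 + bcost ?c = 15" by simp
    ultimately show "wp rest_step ?I s1 (t1 + (1 + bcost ?c))" by (simp only:)
  next
    fix s1 t1 assume I0: "?I s1 t1" and c: "\<not> bval ?c s1"
      and fr: "\<forall>x. x \<notin> mods rest_step \<longrightarrow> s1 x = ?s x"
    note I = rest_invD[OF I0]
    have uw: "s1 ''u'' 0 = p" "s1 ''w'' 0 = p + n" using c I(1,2,6,7,8) by simp_all
    show "Q s1 (t1 + (1 + bcost ?c))"
    proof (rule Q)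
      show "\<forall>v. v \<notin> ?V \<longrightarrow> s1 v = s v"
      proof (intro allI impI)
        fix v assume v: "v \<notin> ?V"
        from frameD[OF fr md v] show "s1 v = s v" using v by simp
      qed
    qed (use I(9-14) uw in simp_all)
  qed
  then show ?thesis unfolding phase_rest_def using b
    by (simp add: wp_simps base_def eval_nat_numeral)
qed

text \<open>If the closing edge is emitted, the outcome records a closed set through
  \<open>b\<close> whose neighbours do not exhaust \<open>V^-\<close>. It is used later to show that
  \<open>G\<close> itself was not DM-irreducible.\<close>

lemma phase_close_correct:
  assumes bs: "base s" and mate: "s ''mate'' = \<mu>" and \<mu>: "invol \<mu>" and perfect: "\<And>x. x < p + n \<Longrightarrow> \<mu> x \<noteq> x"
    and one: "\<And>x. x < p + n \<Longrightarrow> s ''cov'' x = 1"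
    and b: "s ''sink'' 0 = b" and d: "s ''source'' 0 = d"
    and bd: "s ''started'' 0 = 1 \<Longrightarrow> b < p \<and> p \<le> d \<and> d < p + n"
    and Q: "\<And>s' t'. \<lbrakk>
      s ''started'' 0 \<noteq> 1 \<and> output_edges s' = output_edges s \<and> s' ''F_size'' 0 = s ''F_size'' 0 \<or>
      s ''started'' 0 = 1 \<and> output_edges s' = insert (b, d) (output_edges s) \<and>
        s' ''F_size'' 0 = Suc (s ''F_size'' 0) \<and> (\<exists>X. fclosed \<mu> {} X \<and> b \<in> X \<and> (p = n \<longrightarrow> \<not> {p..<p + n} \<subseteq> Gam X)) \<or>
      s ''started'' 0 = 1 \<and> output_edges s' = output_edges s \<and> s' ''F_size'' 0 = s ''F_size'' 0 \<and>
        (\<forall>X. fclosed \<mu> {} X \<longrightarrow> b \<in> X \<longrightarrow> \<mu> d \<in> X);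
      t' \<le> t + 800 * (m + 1)\<rbrakk> \<Longrightarrow> Q s' t'"
  shows "wp phase_close Q s t"
proof (cases "s ''started'' 0 = 1")
  case False
  have "Q s (t + 6)" by (rule Q) (use False in simp_all)
  then show ?thesis unfolding phase_close_def using False by (simp add: wp_simps eval_nat_numeral)
next
  case True
  note bd' = bd[OF True]
  have bn: "b < p + n" using bd' by simp
  let ?s = "s(''root'' := (s ''root'')(0 := b))"
  let ?fin = "If (Equal (Var ''count'') (Var ''n'')) Skip (emit (Var ''sink'') (Var ''source''))"
  have "wp (search ''cov'') (wp ?fin Q) ?s (t + 9)"
  proof (rule search_correct)
    show "base ?s" using bs unfolding base_def by simp
    show "invol (?s ''mate'')" using \<mu> mate by simp
    show "?s ''root'' 0 < p + n" using bn by simp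
    show "''cov'' \<notin> search_vars" unfolding search_vars_def by simp
    fix s1 t1 vis assume fr: "\<forall>v. v \<notin> search_vars \<longrightarrow> s1 v = ?s v" and b1: "base s1"
      and post0: "search_post (?s ''cov'') (?s ''mate'') (?s ''root'' 0) s1 vis"
      and t1: "t1 \<le> t + 9 + 700 * (m + 1)"
    have post: "search_post (s ''cov'') \<mu> b s1 vis" using post0 mate by simp
    note P = search_postD[OF post]
    have f: "s1 ''sink'' 0 = b" "s1 ''source'' 0 = d" "s1 ''F_size'' = s ''F_size''"
      "s1 ''F_tail'' = s ''F_tail''" "s1 ''F_head'' = s ''F_head''" "s1 ''n'' 0 = n"
      using fr b d bs unfolding search_vars_def base_def by simp_all
    have o: "output_edges s1 = output_edges s" unfolding output_edges_def f(3-5) ..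
    have vis: "vis \<subseteq> {p..<p + n}" using P(1) bd' unfolding tree_def by auto
    \<comment> \<open>All flags are set and the matching is perfect, so every visited vertex
      passes.\<close>
    have found: "s1 ''found'' 0 = 0"
    proof (rule ccontr)
      assume "s1 ''found'' 0 \<noteq> 0"
      then have g: "s1 ''goal'' 0 \<in> vis" "\<not> pass (s ''cov'') \<mu> (s1 ''goal'' 0)" using P(4) by auto
      then have "s1 ''goal'' 0 < p + n" using vis by auto
      then show False using g(2) one invol_D(1)[OF \<mu>] perfect unfolding pass_def by simp
    qed
    show "wp ?fin Q s1 t1"
    proof (cases "card vis = n")
      case all: True
      have "vis = {p..<p + n}" by (rule card_subset_eq) (use vis all in simp_all)
      then have dv: "d \<in> vis" using bd' by simp
      have "\<forall>X. fclosed \<mu> {} X \<longrightarrow> b \<in> X \<longrightarrow> \<mu> d \<in> X" using fclosed_reaches[OF post _ _ dv] by blast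
      then have "Q s1 (t1 + 7)" by (intro Q) (use True o f t1 in simp_all)
      then show ?thesis using all P(5) f by (simp add: wp_simps eval_nat_numeral)
    next
      case False
      let ?X = "reached (s ''cov'') \<mu> b vis"
      have "b < p" using bd' by blast
      have "fclosed \<mu> {} ?X" by (rule stuck_fclosed[OF post found \<mu> \<open>b < p\<close>])
      moreover have "b \<in> ?X" by (rule search_stuck(1)[OF post found \<mu> bn])
      moreover have "\<not> {p..<p + n} \<subseteq> Gam ?X"
      proof
        assume "{p..<p + n} \<subseteq> Gam ?X"
        then have "vis = {p..<p + n}" using search_stuck(3)[OF post found \<mu> bn] vis by blast
        then show False using False by simp
      qed
      ultimately have X: "\<exists>X. fclosed \<mu> {} X \<and> b \<in> X \<and> (p = n \<longrightarrow> \<not> {p..<p + n} \<subseteq> Gam X)" by blast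
      have fin: "Q s2 t2" if "output_edges s2 = insert (b, d) (output_edges s)"
        "s2 ''F_size'' 0 = Suc (s ''F_size'' 0)" "t2 \<le> t1 + 60" for s2 t2
        by (rule Q) (use that True X t1 in simp_all)
      show ?thesis using False P(5) f unfolding emit_def
        by (simp add: wp_simps) (rule fin, simp_all add: output_edges_outs outs_Suc)
    qed
  qed
  then show ?thesis unfolding phase_close_def using True b
    by (simp add: wp_Seq_fun wp_If wp_Assign eval_nat_numeral)
qed

end

section \<open>Optimality\<close>

text \<open>Apply the condition to the complement of the neighbourhood of \<open>Y\<close>: its
  neighbours avoid \<open>Y\<close>. If that complement is empty, \<open>Y\<close> is adjacent to
  all of \<open>P\<close>, which is larger than the proper subset \<open>Y\<close> of
  \<open>Q\<close>.\<close>

lemma hall_dual: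
  assumes fin: "finite P" "finite Q" and eq: "card P = card Q" and R: "R \<subseteq> P \<times> Q"
    and hall: "\<And>X. X \<subseteq> P \<Longrightarrow> X \<noteq> {} \<Longrightarrow> X \<noteq> P \<Longrightarrow> card X < card (R `` X)"
    and all: "Q \<subseteq> R `` P" and Y: "Y \<subseteq> Q" "Y \<noteq> {}" "Y \<noteq> Q"
  shows "card Y < card (R\<inverse> `` Y)"
proof -
  let ?X = "P - R\<inverse> `` Y"
  have sub: "R\<inverse> `` Y \<subseteq> P" using R by blast
  have finY: "finite Y" by (rule finite_subset[OF Y(1) fin(2)])
  have cX: "card ?X + card (R\<inverse> `` Y) = card P"
    using fin(1) sub by (metis card_Diff_subset card_mono finite_subset le_add_diff_inverse2)
  have cY: "card (Q - Y) + card Y = card Q"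
    using fin(2) finY Y(1) by (metis card_Diff_subset card_mono le_add_diff_inverse2)
  have img: "R `` ?X \<subseteq> Q - Y" using R by blast
  have "R\<inverse> `` Y \<noteq> {}" using Y all by blast
  then have neP: "?X \<noteq> P" using sub by blast
  show ?thesis
  proof (cases "?X = {}")
    case True
    then have "card ?X = 0" by (metis card.empty)
    then have "card (R\<inverse> `` Y) = card Q" using cX eq by linarith
    moreover have "card Y < card Q" using Y fin(2) by (intro psubset_card_mono) auto
    ultimately show ?thesis by linarith
  next
    case False
    have "card ?X < card (R `` ?X)" using False neP by (intro hall) auto
    also have "\<dots> \<le> card (Q - Y)" using img fin(2) by (intro card_mono) auto
    finally show ?thesis using cX cY eq by linarith
  qed
qed

section \<open>Closed sets of the contracted digraph and the count of added edges\<close>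

context graph_mem
begin

lemma same_side_plus: "q < p \<Longrightarrow> same_side q = {..<p}"
  unfolding same_side_def by auto

lemma same_side_minus: "p \<le> q \<Longrightarrow> same_side q = {p..<p + n}"
  unfolding same_side_def by auto

context
  fixes \<mu> I \<mu>' I'
  assumes pr: "prepared \<mu> I" and ex: "extension \<mu> I \<mu>' I'"
begin

lemma plus_meets:
  assumes "X \<subseteq> {..<p}" "X \<noteq> {}" "\<And>x y. x \<in> X \<Longrightarrow> y \<in> N x \<Longrightarrow> \<mu>' y \<in> X"
  shows "\<exists>x\<in>X. x \<notin> I'"
proof -
  obtain q where "q \<in> X" using assms(2) by blast
  then have "X \<subseteq> same_side q" using assms(1) same_side_plus by auto
  then have "\<not> X \<subseteq> I'" by (rule closed_meets_complement[OF pr ex _ assms(2)]) (rule assms(3))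
  then show ?thesis by blast
qed

text \<open>On this side closure follows the arcs of the contracted digraph backwards. Applied to
  the mates of the complement of a closed set, it provides a source outside
  \<open>I'\<close>.\<close>

lemma minus_meets:
  assumes "Y \<subseteq> {p..<p + n}" "Y \<noteq> {}" "\<And>x y. y \<in> Y \<Longrightarrow> x \<in> N y \<Longrightarrow> \<mu>' x \<in> Y"
  shows "\<exists>y\<in>Y. y \<notin> I'"
proof -
  obtain q where "q \<in> Y" using assms(2) by blast
  then have "p \<le> q" using assms(1) by auto
  then have "Y \<subseteq> same_side q" using assms(1) same_side_minus by simp
  then have "\<not> Y \<subseteq> I'" by (rule closed_meets_complement[OF pr ex _ assms(2)]) (rule assms(3))
  then show ?thesis by blast
qed

lemma perfect_minus:
  assumes "p = n" "\<And>x. x < p \<Longrightarrow> \<mu>' x \<noteq> x" "y < p + n"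
  shows "\<mu>' y \<noteq> y"
proof (cases "y < p")
  case False
  note inv' = extensionD(1)[OF ex]
  have "\<mu>' ` {..<p} \<subseteq> {p..<p + n}"
  proof
    fix z assume "z \<in> \<mu>' ` {..<p}"
    then obtain x where x: "x < p" "z = \<mu>' x" by auto
    then show "z \<in> {p..<p + n}" using invol_D(1,3)[OF inv', of x] assms(2)[OF x(1)] by simp
  qed
  moreover have "inj_on \<mu>' {..<p}" by (rule inj_on_subset[OF invol_inj_on[OF inv']]) auto
  then have "card (\<mu>' ` {..<p}) = p" by (simp add: card_image)
  ultimately have "\<mu>' ` {..<p} = {p..<p + n}" using assms(1) by (intro card_subset_eq) simp_all
  then obtain x where x: "x < p" "y = \<mu>' x" using False assms(3) by force
  then have "\<mu>' y = x" using invol_D(2)[OF inv', of x] by simp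
  then show ?thesis using x False by simp
qed (use assms in simp)

text \<open>This identity makes the number of new edges meet the lower bound: \<open>S - I\<close>
  splits into the exposed vertices and \<open>?C\<close>, while \<open>S - I'\<close> splits into
  \<open>?C\<close> and the isolated vertices, all of which were exposed.\<close>

lemma card_complement:
  assumes fin: "finite S" "S \<subseteq> {..<p + n}" and cov: "\<And>x. x \<in> S \<Longrightarrow> \<mu>' x \<noteq> x"
  shows "card {x \<in> S. \<mu> x = x} + card (S - I') = card (S - I) + card {x \<in> S. N x = {}}"
proof -
  note P = prepared_uptoD[OF pr[unfolded prepared_def, THEN conjunct1]]
  let ?U = "{x \<in> S. \<mu> x = x}" and ?C = "{x \<in> S. \<mu> x \<noteq> x \<and> x \<notin> I}" and ?Z = "{x \<in> S. N x = {}}"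
  have iso: "\<mu> x = x" if "x \<in> S" "N x = {}" for x
    using P(1) that fin(2) unfolding matching_def by blast
  have nI: "x \<notin> I" if "\<mu> x = x" for x using P(2)[of x] that by blast
  have I': "x \<in> I' \<longleftrightarrow> x \<in> I \<or> \<mu> x = x \<and> N x \<noteq> {}" if "x \<in> S" for x
    using extensionD(3)[OF ex, of x] cov[OF that] that fin(2) by blast
  have "S - I' = ?C \<union> ?Z" using I' iso nI by auto
  moreover have "?C \<inter> ?Z = {}" using iso by auto
  ultimately have 1: "card (S - I') = card ?C + card ?Z" using fin(1) by (simp add: card_Un_disjoint)
  have "S - I = ?U \<union> ?C" using nI by auto
  moreover have "?U \<inter> ?C = {}" by auto
  ultimately have 2: "card (S - I) = card ?U + card ?C" using fin(1) by (simp add: card_Un_disjoint)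
  show ?thesis using 1 2 by simp
qed

lemma card_exposed_minus:
  assumes "p = n"
  shows "card {y \<in> {p..<p + n}. \<mu> y = y} = card {x \<in> {..<p}. \<mu> x = x}"
proof -
  note P = prepared_uptoD[OF pr[unfolded prepared_def, THEN conjunct1]]
  have inv: "invol \<mu>" using P(1) unfolding matching_def by blast
  let ?A = "{x \<in> {..<p}. \<mu> x \<noteq> x}" and ?B = "{y \<in> {p..<p + n}. \<mu> y \<noteq> y}"
  have "\<mu> x \<in> ?B \<and> \<mu> (\<mu> x) = x" if "x \<in> ?A" for x
    using invol_D[OF inv, of x] that by auto
  moreover have "\<mu> y \<in> ?A \<and> \<mu> (\<mu> y) = y" if "y \<in> ?B" for y
    using invol_D[OF inv, of y] that by auto
  ultimately have "bij_betw \<mu> ?A ?B" by (intro bij_betw_byWitness[where f' = \<mu>]) auto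
  then have AB: "card ?A = card ?B" by (rule bij_betw_same_card)
  have "{..<p} = ?A \<union> {x \<in> {..<p}. \<mu> x = x}" by auto
  then have "card {..<p} = card ?A + card {x \<in> {..<p}. \<mu> x = x}"
    by (metis (no_types, lifting) card_Un_disjoint disjoint_iff finite_Un finite_lessThan mem_Collect_eq)
  moreover have "{p..<p + n} = ?B \<union> {y \<in> {p..<p + n}. \<mu> y = y}" by auto
  then have "card {p..<p + n} = card ?B + card {y \<in> {p..<p + n}. \<mu> y = y}"
    by (metis (no_types, lifting) card_Un_disjoint disjoint_iff finite_Un finite_atLeastLessThan mem_Collect_eq)
  ultimately show ?thesis using AB assms by simp
qed

text \<open>If no pair was ever found, the flagged set is still \<open>I'\<close>. Some source lies
  outside it, and the certificate of that source is a closed subset of \<open>I'\<close>, which does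
  not exist.\<close>

lemma started_balanced:
  assumes pn: "p = n" "0 < p" and perfect: "\<And>x. x < p \<Longrightarrow> \<mu>' x \<noteq> x"
    and ok: "chain_ok \<mu>' I' E0 k0 J E1 k1 SC TC st d b"
    and fail: "\<And>y. p \<le> y \<Longrightarrow> y < p + n \<Longrightarrow> y \<notin> J \<Longrightarrow> \<exists>X. fclosed \<mu>' {} X \<and> \<mu>' y \<in> X \<and> X \<subseteq> J"
  shows "st = 1"
proof (rule ccontr)
  assume "st \<noteq> 1"
  note C = chain_okD[OF ok]
  note inv' = extensionD(1)[OF ex]
  have TC: "TC = {}" using C(8) \<open>st \<noteq> 1\<close> by blast
  have "finite SC" by (rule finite_subset[OF C(3)]) simp
  then have "SC = {}" using C(5) TC by simp
  then have J: "J = I'" using C(1) TC by simp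
  have "\<exists>y\<in>{p..<p + n}. y \<notin> I'"
  proof (rule minus_meets)
    show "{p..<p + n} \<noteq> {}" using pn by simp
    fix x y assume "y \<in> {p..<p + n}" "x \<in> N y"
    then have "x < p" using N_D(1,3)[of x y] by simp
    then show "\<mu>' x \<in> {p..<p + n}" using invol_D(1,3)[OF inv', of x] perfect[of x] by simp
  qed simp
  then obtain y where "p \<le> y" "y < p + n" "y \<notin> J" using J by auto
  from fail[OF this] obtain X where "fclosed \<mu>' {} X" "\<mu>' y \<in> X" "X \<subseteq> I'" using J by blast
  moreover from this have "\<exists>x\<in>X. x \<notin> I'" by (intro plus_meets) (auto simp: fclosed_def)
  ultimately show False by blast
qed

text \<open>Strong connectivity in terms of closed sets. A nonempty closed \<open>X\<close> contains
  a sink outside \<open>I'\<close> and therefore reaches the last sink \<open>b\<close>, from there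
  \<open>d\<close>, and so the whole chain. The remaining sinks, and through their edges the
  remaining sources, are then shown to lie in \<open>X\<close> as well.\<close>

lemma balanced_connected:
  assumes pn: "p = n" and perfect: "\<And>x. x < p \<Longrightarrow> \<mu>' x \<noteq> x"
    and ok: "chain_ok \<mu>' I' E0 k0 J E1 k1 SC TC st d b"
    and fail: "\<And>y. p \<le> y \<Longrightarrow> y < p + n \<Longrightarrow> y \<notin> J \<Longrightarrow> \<exists>X. fclosed \<mu>' {} X \<and> \<mu>' y \<in> X \<and> X \<subseteq> J"
    and E: "E1 \<subseteq> E" "E2 \<subseteq> E"
    and restT: "\<And>x. x \<in> unflagged J 0 p \<Longrightarrow> \<exists>y. (x, y) \<in> E2 \<and> (y = d \<or> y \<in> unflagged J p (p + n))"
    and restS: "\<And>y. y \<in> unflagged J p (p + n) \<Longrightarrow> \<exists>x. (x, y) \<in> E2 \<and> (x = b \<or> x \<in> unflagged J 0 p)"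
    and close: "st = 1 \<Longrightarrow> (b, d) \<in> E \<or> (\<forall>X. fclosed \<mu>' {} X \<longrightarrow> b \<in> X \<longrightarrow> \<mu>' d \<in> X)"
    and X: "fclosed \<mu>' E X" "X \<noteq> {}"
  shows "X = {..<p}"
proof -
  note C = chain_okD[OF ok]
  note inv' = extensionD(1)[OF ex]
  have XP: "X \<subseteq> {..<p}" using X(1) unfolding fclosed_def by blast
  then have "0 < p" using X(2) by auto
  have st: "st = 1"
    by (rule started_balanced[OF pn \<open>0 < p\<close> _ ok]) (simp add: perfect, rule fail)
  then have d: "d \<in> SC" and b: "b \<in> TC"
    and 1: "\<And>X. fclosed \<mu>' E1 X \<Longrightarrow> \<mu>' d \<in> X \<Longrightarrow> \<mu>' ` SC \<subseteq> X \<and> TC \<subseteq> X"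
    and 2: "\<And>X. fclosed \<mu>' E1 X \<Longrightarrow> TC \<inter> X \<noteq> {} \<Longrightarrow> b \<in> X"
    using C(8) by auto
  have X1: "fclosed \<mu>' E1 X" by (rule fclosed_mono[OF X(1) E(1)])
  have X0: "fclosed \<mu>' {} X" by (rule fclosed_mono[OF X(1)]) simp
  have edge: "\<mu>' y \<in> X" if "(x, y) \<in> E" "x \<in> X" for x y using X(1) that unfolding fclosed_def by blast
  have meets: "\<exists>x\<in>Z. x \<notin> I'" if "fclosed \<mu>' {} Z" "Z \<noteq> {}" for Z
    by (rule plus_meets) (use that in \<open>auto simp: fclosed_def\<close>)
  have SCp: "x \<notin> SC" if "x < p" for x using C(3) that by auto
  \<comment> \<open>A closed set contains a vertex outside \<open>I'\<close>, and a flagged such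
    vertex of \<open>V^+\<close> is a sink of the chain.\<close>
  have core: "TC \<inter> Z \<noteq> {}" if Z: "fclosed \<mu>' {} Z" "Z \<noteq> {}" "Z \<subseteq> J" for Z
  proof -
    obtain x where x: "x \<in> Z" "x \<notin> I'" using meets[OF Z(1,2)] by blast
    then have "x < p" using Z(1) unfolding fclosed_def by blast
    then show ?thesis using x Z(3) C(1) SCp by blast
  qed
  have int: "fclosed \<mu>' {} (Y \<inter> Z)" if "fclosed \<mu>' {} Y" "fclosed \<mu>' {} Z" for Y Z
    using that unfolding fclosed_def by blast
  obtain t where t: "t \<in> X" "t \<notin> I'" using meets[OF X0 X(2)] by blast
  have tp: "t < p" using t XP by blast
  have bX: "b \<in> X"
  proof (cases "t \<in> J")
    case True
    then have "t \<in> TC" using C(1) t(2) SCp tp by blast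
    then show ?thesis using 2[OF X1] t(1) by blast
  next
    case False
    then have "t \<in> unflagged J 0 p" using tp unfolding unflagged_def by simp
    then obtain y where y: "(t, y) \<in> E2" "y = d \<or> y \<in> unflagged J p (p + n)" using restT by blast
    have yX: "\<mu>' y \<in> X" using edge y(1) E(2) t(1) by blast
    from y(2) show ?thesis
    proof
      assume "y = d"
      then show ?thesis using 1[OF X1] yX b by blast
    next
      assume "y \<in> unflagged J p (p + n)"
      then have "p \<le> y" "y < p + n" "y \<notin> J" unfolding unflagged_def by simp_all
      then obtain Z where Z: "fclosed \<mu>' {} Z" "\<mu>' y \<in> Z" "Z \<subseteq> J" using fail by blast
      have "TC \<inter> (X \<inter> Z) \<noteq> {}" by (rule core[OF int[OF X0 Z(1)]]) (use Z yX in auto)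
      then show ?thesis using 2[OF X1] by blast
    qed
  qed
  have dX: "\<mu>' d \<in> X" using close[OF st] edge bX X0 by blast
  have SX: "\<mu>' y \<in> X" if "y \<in> SC" for y using 1[OF X1 dX] that by blast
  have TX: "TC \<subseteq> X" using 1[OF X1 dX] by blast
  \<comment> \<open>If \<open>W\<close> missed a vertex, the mates of its complement would be closed
    on the minus side and contain a vertex outside \<open>I'\<close>, whose mate belongs to
    \<open>W\<close> by \<open>all\<close>.\<close>
  have co: "W = {..<p}" if W: "fclosed \<mu>' {} W" and all: "\<And>y. y \<in> {p..<p + n} \<Longrightarrow> y \<notin> I' \<Longrightarrow> \<mu>' y \<in> W" for W
  proof (rule ccontr)
    assume ne: "W \<noteq> {..<p}"
    have WP: "W \<subseteq> {..<p}" using W unfolding fclosed_def by blast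
    let ?Y = "\<mu>' ` ({..<p} - W)"
    have "\<exists>y\<in>?Y. y \<notin> I'"
    proof (rule minus_meets)
      show "?Y \<subseteq> {p..<p + n}"
      proof
        fix y assume "y \<in> ?Y"
        then obtain x where x: "x < p" "y = \<mu>' x" by auto
        then show "y \<in> {p..<p + n}" using invol_D(1,3)[OF inv', of x] perfect[of x] by simp
      qed
      show "?Y \<noteq> {}" using ne WP by auto
      fix x y assume y: "y \<in> ?Y" and xy: "x \<in> N y"
      then obtain z where z: "z < p" "z \<notin> W" "y = \<mu>' z" by auto
      have yn: "y < p + n" "\<not> y < p" using z invol_D(1,3)[OF inv', of z] perfect[of z] by simp_all
      then have x: "x < p" "y \<in> N x" using N_D[OF xy] by simp_all
      have "x \<notin> W"
      proof
        assume "x \<in> W"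
        then have "\<mu>' y \<in> W" using W x(2) unfolding fclosed_def by blast
        then show False using z invol_D(2)[OF inv', of z] by simp
      qed
      then show "\<mu>' x \<in> ?Y" using x(1) by blast
    qed
    then obtain z where z: "z < p" "z \<notin> W" "\<mu>' z \<notin> I'" by auto
    have "\<mu>' z \<in> {p..<p + n}" using z invol_D(1,3)[OF inv', of z] perfect[of z] by simp
    from all[OF this z(3)] show False using z invol_D(2)[OF inv', of z] by simp
  qed
  let ?R = "unflagged J p (p + n)"
  have "\<forall>y\<in>?R. \<exists>Z. fclosed \<mu>' {} Z \<and> \<mu>' y \<in> Z \<and> Z \<subseteq> J"
    using fail unfolding unflagged_def by simp
  then obtain Z where Z: "\<And>y. y \<in> ?R \<Longrightarrow> fclosed \<mu>' {} (Z y) \<and> \<mu>' y \<in> Z y \<and> Z y \<subseteq> J"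
    by metis
  have rem: "y \<in> SC \<or> y \<in> ?R" if "y \<in> {p..<p + n}" "y \<notin> I'" for y
    using that C(1,4) unfolding unflagged_def by auto
  \<comment> \<open>The certificates of the leftover sources enlarge \<open>X\<close> to a closed
    set to which \<open>co\<close> applies, so it is all of \<open>V^+\<close>. Leftover sinks lie
    in no certificate, since these are flagged, and must therefore come from
    \<open>X\<close>.\<close>
  let ?W = "X \<union> (\<Union>y\<in>?R. Z y)"
  have W: "?W = {..<p}"
  proof (rule co)
    show "fclosed \<mu>' {} ?W"
      unfolding fclosed_def
    proof (intro conjI ballI allI impI)
      show "?W \<subseteq> {..<p}" using XP Z unfolding fclosed_def by blast
      fix x y assume x: "x \<in> ?W" and y: "y \<in> N x"
      from x consider "x \<in> X" | z where "z \<in> ?R" "x \<in> Z z" by blast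
      then show "\<mu>' y \<in> ?W"
      proof cases
        case 1
        then show ?thesis using X0 y unfolding fclosed_def by blast
      next
        case 2
        then have "\<mu>' y \<in> Z z" using Z[of z] y unfolding fclosed_def by blast
        then show ?thesis using 2 by blast
      qed
    qed simp
    fix y assume "y \<in> {p..<p + n}" "y \<notin> I'"
    from rem[OF this] show "\<mu>' y \<in> ?W" using SX Z by blast
  qed
  have sinks: "x \<in> X" if x: "x \<in> unflagged J 0 p" for x
  proof -
    have "x \<in> ?W" using W x unfolding unflagged_def by auto
    moreover have "x \<notin> Z y" if "y \<in> ?R" for y using Z[OF that] x unfolding unflagged_def by blast
    ultimately show ?thesis by blast
  qed
  show ?thesis
  proof (rule co[OF X0])
    fix y assume "y \<in> {p..<p + n}" "y \<notin> I'"
    from rem[OF this] show "\<mu>' y \<in> X"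
    proof
      assume "y \<in> ?R"
      then obtain x where "(x, y) \<in> E2" "x = b \<or> x \<in> unflagged J 0 p" using restS by blast
      then show ?thesis using edge E(2) bX sinks by blast
    qed (rule SX)
  qed
qed

end

end

definition phases :: com where
  "phases =
     phase_independent ;; phase_maximum ;; phase_pair ;;
     If (Less (Var ''p'') (Var ''n'')) phase_unbalanced (phase_chain ;; phase_rest ;; phase_close)"

section \<open>From closed sets to the Hall conditions and the attained bound\<close>

context graph_mem
begin

definition aug :: "(nat \<times> nat) set \<Rightarrow> nat \<Rightarrow> nat set" where
  "aug F x = N x \<union> F `` {x}"

definition max_hindep :: "nat set \<Rightarrow> nat set \<Rightarrow> bool" where
  "max_hindep S I \<longleftrightarrow> I \<subseteq> S \<and> (\<forall>B\<subseteq>S. hindep N B \<longrightarrow> card B \<le> card I)"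

definition lower_bound_attained :: "nat set \<Rightarrow> nat \<Rightarrow> bool" where
  "lower_bound_attained S k \<longleftrightarrow> (\<exists>I. max_hindep S I \<and> k \<le> card (S - I) + card {x \<in> S. N x = {}})"

text \<open>The last conjunct serves the comparison with \<open>F' = {}\<close>, to which the lower
  bound does not apply: its premises say that a balanced graph is already irreducible.\<close>

definition good_output :: "(nat \<times> nat) set \<Rightarrow> bool" where
  "good_output F \<longleftrightarrow> F \<subseteq> {..<p} \<times> {p..<p + n} \<and>
     (\<forall>X\<subseteq>{..<p}. X \<noteq> {} \<longrightarrow> (p < n \<or> X \<noteq> {..<p}) \<longrightarrow> card X < card (nbrs (aug F) X)) \<and>
     (p = n \<longrightarrow> nbrs (aug F) {..<p} = {p..<p + n}) \<and>
     (p < n \<longrightarrow> lower_bound_attained {..<p} (card F)) \<and>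
     (p = n \<longrightarrow> lower_bound_attained {..<p} (card F) \<or> lower_bound_attained {p..<p + n} (card F)) \<and>
     (p = n \<longrightarrow> (\<forall>X\<subseteq>{..<p}. X \<noteq> {} \<longrightarrow> X \<noteq> {..<p} \<longrightarrow> card X < card (Gam X)) \<longrightarrow>
        Gam {..<p} = {p..<p + n} \<longrightarrow> F = {})"

lemma max_hindep_prepared:
  assumes pr: "prepared \<mu> I"
  shows "max_hindep {..<p} (I \<inter> {..<p})" "max_hindep {p..<p + n} (I \<inter> {p..<p + n})"
proof -
  note P = prepared_uptoD[OF pr[unfolded prepared_def, THEN conjunct1]]
  have side: "max_hindep (same_side q) (I \<inter> same_side q)" for q
  proof -
    interpret maximal_hindep N "same_side q" "I \<inter> same_side q"
    proof
      fix r assume r: "r \<in> same_side q - I \<inter> same_side q"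
      then have "r < p + n" "r \<notin> I" "same_side r = same_side q"
        using same_side_eq unfolding same_side_def by auto
      then show "\<exists>X\<subseteq>insert r (I \<inter> same_side q). r \<in> X \<and> card (Gam X) \<le> card X"
        using P(4)[of r] by simp
    qed (use finite_same_side finite_N P(3) in auto)
    show ?thesis unfolding max_hindep_def using card_le by blast
  qed
  show "max_hindep {p..<p + n} (I \<inter> {p..<p + n})" using side[of p] same_side_minus[of p] by simp
  show "max_hindep {..<p} (I \<inter> {..<p})"
  proof (cases "0 < p")
    case True
    then show ?thesis using side[of 0] same_side_plus[of 0] by simp
  next
    case False
    then show ?thesis unfolding max_hindep_def by simp
  qed
qed

text \<open>The mates of \<open>X\<close> are \<open>card X\<close> neighbours of \<open>X\<close>
  in the augmented graph. A set violating strict Hall has no others, which is closedness.\<close>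

lemma deficient_fclosed:
  assumes \<mu>: "invol \<mu>" and perfect: "\<And>x. x < p \<Longrightarrow> \<mu> x \<noteq> x"
    and edge: "\<And>x. x < p \<Longrightarrow> \<mu> x \<in> aug F x"
    and F: "F \<subseteq> {..<p} \<times> {p..<p + n}" and X: "X \<subseteq> {..<p}" "card (nbrs (aug F) X) \<le> card X"
  shows "fclosed \<mu> F X"
proof -
  have finX: "finite X" by (rule finite_subset[OF X(1)]) simp
  have "inj_on \<mu> X" by (rule inj_on_subset[OF invol_inj_on[OF \<mu>]]) (use X(1) in auto)
  then have card: "card (\<mu> ` X) = card X" by (rule card_image)
  have finF: "finite F" by (rule finite_subset[OF F]) simp
  have fin: "finite (nbrs (aug F) X)"
    unfolding nbrs_def aug_def using finX finite_N finite_Image[OF finF] by simp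
  have "\<mu> ` X \<subseteq> nbrs (aug F) X" using edge X(1) unfolding nbrs_def by auto
  then have eq: "\<mu> ` X = nbrs (aug F) X" by (rule card_seteq[OF fin]) (use X(2) card in linarith)
  have mem: "\<mu> y \<in> X" if x: "x \<in> X" "y \<in> aug F x" for x y
  proof -
    have "y \<in> \<mu> ` X" unfolding eq nbrs_def using x by blast
    then obtain z where z: "z \<in> X" "y = \<mu> z" by blast
    then have "z < p + n" using X(1) by auto
    then show ?thesis using z invol_D(2)[OF \<mu>] by simp
  qed
  show ?thesis unfolding fclosed_def using X(1) mem unfolding aug_def by blast
qed

lemma aug_image:
  assumes F: "F \<subseteq> {..<p} \<times> {p..<p + n}"
  shows "nbrs (aug F) {..<p} \<subseteq> {p..<p + n}"
  using F N_D(1,3) unfolding nbrs_def aug_def by fastforce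

context
  fixes \<mu> I \<mu>' I' E0
  assumes pr: "prepared \<mu> I" and ex: "extension \<mu> I \<mu>' I'"
    and cov: "\<And>x. x < p \<Longrightarrow> \<mu>' x \<noteq> x"
    and E0: "E0 = (\<lambda>x. (x, \<mu>' x)) ` {x. x < p \<and> \<mu> x = x}"
begin

lemma E0_sub: "E0 \<subseteq> {..<p} \<times> {p..<p + n}"
proof
  fix e assume "e \<in> E0"
  then obtain x where x: "x < p" "e = (x, \<mu>' x)" using E0 by auto
  then show "e \<in> {..<p} \<times> {p..<p + n}"
    using invol_D(1,3)[OF extensionD(1)[OF ex], of x] cov[of x] by simp
qed

lemma mate_edge:
  assumes "E0 \<subseteq> F" "x < p"
  shows "\<mu>' x \<in> aug F x"
proof (cases "\<mu> x = x")
  case True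
  then have "(x, \<mu>' x) \<in> F" using E0 assms by blast
  then show ?thesis unfolding aug_def by blast
next
  case False
  have "matching \<mu>" using prepared_uptoD(1) pr unfolding prepared_def by blast
  then have "\<mu> x \<in> N x" using False assms(2) unfolding matching_def by simp
  then show ?thesis using extensionD(2)[OF ex, of x] False assms(2) unfolding aug_def by simp
qed

text \<open>A closed set would contain a vertex outside \<open>I'\<close>, which is joined to
  \<open>w\<close>. As an exposed vertex, \<open>w\<close> is its own mate, so it would belong to a
  subset of \<open>V^+\<close>.\<close>

lemma good_unbalanced:
  assumes pn: "p < n" and w: "p \<le> w" "w < p + n" "\<mu>' w = w"
    and F: "F = E0 \<union> (\<lambda>x. (x, w)) ` {x. x < p \<and> x \<notin> I'}"
    and card: "card F \<le> card {x. x < p \<and> \<mu> x = x} + card {x. x < p \<and> x \<notin> I'}"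
  shows "good_output F"
proof -
  note inv' = extensionD(1)[OF ex]
  have sub: "F \<subseteq> {..<p} \<times> {p..<p + n}" using E0_sub w unfolding F by auto
  have hall: "card X < card (nbrs (aug F) X)" if X: "X \<subseteq> {..<p}" "X \<noteq> {}" for X
  proof (rule ccontr)
    assume "\<not> ?thesis"
    then have "card (nbrs (aug F) X) \<le> card X" by simp
    then have cl: "fclosed \<mu>' F X"
      by (intro deficient_fclosed[OF inv' cov mate_edge sub X(1)]) (use F in auto)
    have "\<exists>x\<in>X. x \<notin> I'"
      by (rule plus_meets[OF pr ex X]) (use cl in \<open>auto simp: fclosed_def\<close>)
    then obtain x where "x \<in> X" "(x, w) \<in> F" using X(1) F by auto
    then have "\<mu>' w \<in> X" using cl unfolding fclosed_def by blast
    then show False using w X(1) by auto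
  qed
  have "card {x \<in> {..<p}. \<mu> x = x} + card ({..<p} - I') = card ({..<p} - I) + card {x \<in> {..<p}. N x = {}}"
    by (rule card_complement[OF pr ex]) (use cov in auto)
  moreover have "{x. x < p \<and> x \<notin> I'} = {..<p} - I'" by auto
  moreover have "{x \<in> {..<p}. \<mu> x = x} = {x. x < p \<and> \<mu> x = x}" by auto
  moreover have "{..<p} - I \<inter> {..<p} = {..<p} - I" by auto
  ultimately have "lower_bound_attained {..<p} (card F)"
    unfolding lower_bound_attained_def using card max_hindep_prepared(1)[OF pr] by (intro exI[of _ "I \<inter> {..<p}"]) simp
  then show ?thesis unfolding good_output_def using sub hall pn by simp
qed

lemma good_balanced:
  assumes pn: "p = n"
    and ok: "chain_ok \<mu>' I' E0 (card {x. x < p \<and> \<mu> x = x}) J E1 k1 SC TC st d b"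
    and fail: "\<And>y. p \<le> y \<Longrightarrow> y < p + n \<Longrightarrow> y \<notin> J \<Longrightarrow> \<exists>X. fclosed \<mu>' {} X \<and> \<mu>' y \<in> X \<and> X \<subseteq> J"
    and E2: "E1 \<subseteq> E2" "E2 - E1 \<subseteq> {..<p} \<times> {p..<p + n}"
    and k2: "k2 \<le> k1 + max (card (unflagged J 0 p)) (card (unflagged J p (p + n)))"
    and restT: "\<And>x. x \<in> unflagged J 0 p \<Longrightarrow> \<exists>y. (x, y) \<in> E2 \<and> (y = d \<or> y \<in> unflagged J p (p + n))"
    and restS: "\<And>y. y \<in> unflagged J p (p + n) \<Longrightarrow> \<exists>x. (x, y) \<in> E2 \<and> (x = b \<or> x \<in> unflagged J 0 p)"
    and close: "st \<noteq> 1 \<and> F = E2 \<and> k = k2 \<or>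
      st = 1 \<and> F = insert (b, d) E2 \<and> k = Suc k2 \<and> (\<exists>X. fclosed \<mu>' {} X \<and> b \<in> X \<and> (p = n \<longrightarrow> \<not> {p..<p + n} \<subseteq> Gam X)) \<or>
      st = 1 \<and> F = E2 \<and> k = k2 \<and> (\<forall>X. fclosed \<mu>' {} X \<longrightarrow> b \<in> X \<longrightarrow> \<mu>' d \<in> X)"
    and card: "card F \<le> k"
  shows "good_output F"
proof -
  note inv' = extensionD(1)[OF ex]
  note C = chain_okD[OF ok]
  let ?P = "{..<p}" and ?Q = "{p..<p + n}" and ?k0 = "card {x. x < p \<and> \<mu> x = x}"
  have E2F: "E2 \<subseteq> F" using close by blast
  have bd: "(b, d) \<in> ?P \<times> ?Q" if "st = 1" using C(3,4,8) that by auto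
  have "E2 \<subseteq> ?P \<times> ?Q" using E0_sub C(7) E2(2) by blast
  then have sub: "F \<subseteq> ?P \<times> ?Q" using close bd by blast
  have E0F: "E0 \<subseteq> F" using C(6) E2(1) E2F by blast
  have conn: "X = ?P" if X: "X \<subseteq> ?P" "X \<noteq> {}" "card (nbrs (aug F) X) \<le> card X" for X
  proof (rule balanced_connected[OF pr ex pn _ ok _ _ E2F])
    show "fclosed \<mu>' F X" by (rule deficient_fclosed[OF inv' cov mate_edge[OF E0F] sub X(1,3)])
    show "E1 \<subseteq> F" using E2(1) E2F by blast
    show "st = 1 \<Longrightarrow> (b, d) \<in> F \<or> (\<forall>X. fclosed \<mu>' {} X \<longrightarrow> b \<in> X \<longrightarrow> \<mu>' d \<in> X)" using close by blast
  qed (use X(2) cov fail restT restS in auto)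
  have all: "nbrs (aug F) ?P = ?Q"
  proof -
    have "\<mu>' ` ?P \<subseteq> nbrs (aug F) ?P" using mate_edge[OF E0F] unfolding nbrs_def by auto
    then have "card (\<mu>' ` ?P) \<le> card (nbrs (aug F) ?P)"
      using finite_subset[OF aug_image[OF sub]] by (intro card_mono) simp_all
    moreover have "inj_on \<mu>' ?P" by (rule inj_on_subset[OF invol_inj_on[OF inv']]) auto
    then have "card (\<mu>' ` ?P) = p" by (simp add: card_image)
    ultimately show ?thesis using aug_image[OF sub] pn by (intro card_seteq) simp_all
  qed
  have hall: "card X < card (nbrs (aug F) X)" if "X \<subseteq> ?P" "X \<noteq> {}" "X \<noteq> ?P" for X
    using conn[of X] that by (meson not_less)
  have full: "\<mu>' y \<noteq> y" if "y < p + n" for y using perfect_minus[OF pr ex pn cov that] .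
  have exposed: "{x \<in> ?P. \<mu> x = x} = {x. x < p \<and> \<mu> x = x}" by auto
  have cP: "?k0 + card (?P - I') = card (?P - I) + card {x \<in> ?P. N x = {}}"
    using card_complement[OF pr ex, of ?P] full unfolding exposed by auto
  have cQ: "?k0 + card (?Q - I') = card (?Q - I) + card {x \<in> ?Q. N x = {}}"
  proof -
    have "?Q \<subseteq> {..<p + n}" by auto
    then have "card {x \<in> ?Q. \<mu> x = x} + card (?Q - I') = card (?Q - I) + card {x \<in> ?Q. N x = {}}"
      by (intro card_complement[OF pr ex]) (use full in auto)
    then show ?thesis using card_exposed_minus[OF pr ex pn] unfolding exposed by linarith
  qed
  have finSC: "finite SC" by (rule finite_subset[OF C(3)]) simp
  have finTC: "finite TC" by (rule finite_subset[OF C(4)]) simp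
  have uT: "card (unflagged J 0 p) + card TC = card (?P - I')"
  proof -
    have "?P - I' = unflagged J 0 p \<union> TC" using C(1-4) unfolding unflagged_def by auto
    moreover have "unflagged J 0 p \<inter> TC = {}" using C(1) unfolding unflagged_def by auto
    ultimately show ?thesis using finite_unflagged finTC by (simp add: card_Un_disjoint)
  qed
  have uS: "card (unflagged J p (p + n)) + card TC = card (?Q - I')"
  proof -
    have "?Q - I' = unflagged J p (p + n) \<union> SC" using C(1-4) unfolding unflagged_def by auto
    moreover have "unflagged J p (p + n) \<inter> SC = {}" using C(1) unfolding unflagged_def by auto
    ultimately show ?thesis using finite_unflagged finSC C(5) by (simp add: card_Un_disjoint)
  qed
  \<comment> \<open>A chain of \<open>card TC\<close> pairs uses one edge fewer than it has pairs.
    The closing edge makes up for it, and its omission leaves one unit to spare.\<close>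
  have k: "k \<le> ?k0 + max (card (?P - I')) (card (?Q - I'))"
    and k_open: "st = 1 \<Longrightarrow> k = k2 \<Longrightarrow> Suc k \<le> ?k0 + max (card (?P - I')) (card (?Q - I'))"
    using close C(8) k2 uT uS by auto
  have empty0: "F = {}" if "p = 0" using sub that by auto
  have IP: "?P - I \<inter> ?P = ?P - I" "?Q - I \<inter> ?Q = ?Q - I" by auto
  have lb: "lower_bound_attained ?P (card F) \<or> lower_bound_attained ?Q (card F)"
  proof (cases "card (?Q - I') \<le> card (?P - I')")
    case True
    then have "card F \<le> card (?P - I) + card {x \<in> ?P. N x = {}}" using card k cP by simp
    then have "lower_bound_attained ?P (card F)" unfolding lower_bound_attained_def
      using max_hindep_prepared(1)[OF pr] IP by (intro exI[of _ "I \<inter> ?P"]) simp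
    then show ?thesis ..
  next
    case False
    then have "card F \<le> card (?Q - I) + card {x \<in> ?Q. N x = {}}" using card k cQ by simp
    then have "lower_bound_attained ?Q (card F)" unfolding lower_bound_attained_def
      using max_hindep_prepared(2)[OF pr] IP by (intro exI[of _ "I \<inter> ?Q"]) simp
    then show ?thesis ..
  qed
  \<comment> \<open>If \<open>G\<close> is already irreducible, no vertex is exposed, both coranks
    are at most 1 and the closing edge is omitted; the spare unit in \<open>k_open\<close> then
    leaves no edge at all.\<close>
  have irr: "F = {}" if G: "\<forall>X\<subseteq>?P. X \<noteq> {} \<longrightarrow> X \<noteq> ?P \<longrightarrow> card X < card (Gam X)" "Gam ?P = ?Q"
  proof (cases "p = 0")
    case False
    have weak: "card X \<le> card (Gam X)" if "X \<subseteq> ?P" for X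
      using G that pn by (cases "X = {} \<or> X = ?P") (auto simp: less_imp_le)
    have noexp: "\<mu> x \<noteq> x" if "x < p" for x
    proof
      assume "\<mu> x = x"
      moreover have "maximum_upto (p + n) \<mu>" using pr unfolding prepared_def by blast
      moreover have "x < p + n" using that by simp
      ultimately obtain Z where "Z \<subseteq> same_side x" "card (Gam Z) < card Z" by (metis maximum_uptoD)
      then show False using weak[of Z] same_side_plus[OF that] by simp
    qed
    then have k0: "?k0 = 0" by simp
    have "{x \<in> ?P. N x = {}} = {}"
    proof -
      have "matching \<mu>" using prepared_uptoD(1) pr unfolding prepared_def by blast
      then have "N x \<noteq> {}" if "x < p" for x
        using noexp[OF that] that unfolding matching_def by (metis empty_iff trans_less_add1)
      then show ?thesis by auto
    qed
    then have isoP: "card {x \<in> ?P. N x = {}} = 0" by (metis card.empty)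
    \<comment> \<open>Removing any single vertex leaves an independent set, because only
      \<open>S\<close> itself may fail the strict condition.\<close>
    have one: "card (S - I) \<le> 1" if S: "max_hindep S (I \<inter> S)" "finite S"
      "\<And>X. X \<subseteq> S \<Longrightarrow> X \<noteq> {} \<Longrightarrow> X \<noteq> S \<Longrightarrow> card X < card (Gam X)" for S
    proof (cases "S = {}")
      case False
      then obtain x where x: "x \<in> S" by blast
      have "hindep N (S - {x})" unfolding hindep_def using S(3) x by blast
      then have "card (S - {x}) \<le> card (I \<inter> S)" using S(1) unfolding max_hindep_def by blast
      moreover have "card (S - {x}) = card S - 1" using x by simp
      moreover have "card (S - I) = card S - card (I \<inter> S)"
        using S(2) by (metis Int_commute card_Diff_subset_Int finite_Int)
      ultimately show ?thesis by simp
    qed simp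
    have P1: "card (?P - I) \<le> 1" by (rule one[OF max_hindep_prepared(1)[OF pr]]) (use G(1) in auto)
    let ?R = "{(x, y). x < p \<and> y \<in> N x}"
    have RX: "?R `` X = Gam X" if "X \<subseteq> ?P" for X using that unfolding nbrs_def by auto
    have RY: "?R\<inverse> `` Y = Gam Y" if Y: "Y \<subseteq> ?Q" for Y
    proof (intro equalityI subsetI)
      fix x assume "x \<in> ?R\<inverse> `` Y"
      then obtain y where "x < p" "y \<in> Y" "y \<in> N x" by auto
      then show "x \<in> Gam Y" using N_D(2)[of y x] unfolding nbrs_def by auto
    next
      fix x assume "x \<in> Gam Y"
      then obtain y where y: "y \<in> Y" "x \<in> N y" unfolding nbrs_def by blast
      then have "p \<le> y" "y < p + n" using Y by auto
      then show "x \<in> ?R\<inverse> `` Y" using N_D[OF y(2)] y(1) by auto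
    qed
    have GQ: "card Y < card (Gam Y)" if Y: "Y \<subseteq> ?Q" "Y \<noteq> {}" "Y \<noteq> ?Q" for Y
    proof -
      have "card Y < card (?R\<inverse> `` Y)"
      proof (rule hall_dual[of ?P ?Q])
        show "?R \<subseteq> ?P \<times> ?Q" using N_D(1,3) by fastforce
        show "?Q \<subseteq> ?R `` ?P" using RX[of ?P] G(2) by simp
        show "card X < card (?R `` X)" if "X \<subseteq> ?P" "X \<noteq> {}" "X \<noteq> ?P" for X
          using RX[OF that(1)] G(1) that by simp
      qed (use pn Y in simp_all)
      then show ?thesis using RY[OF Y(1)] by simp
    qed
    have Q1: "card (?Q - I) \<le> 1" by (rule one[OF max_hindep_prepared(2)[OF pr]]) (use GQ in auto)
    have isoQ: "card {x \<in> ?Q. N x = {}} = 0"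
    proof -
      have "N y \<noteq> {}" if y: "y \<in> ?Q" for y
      proof -
        have "y \<in> Gam ?P" using y G(2) by simp
        then obtain x where "x < p" "y \<in> N x" unfolding nbrs_def by auto
        then show ?thesis using N_D(2)[of y x] by auto
      qed
      then have "{x \<in> ?Q. N x = {}} = {}" by auto
      then show ?thesis by (metis card.empty)
    qed
    have st: "st = 1" by (rule started_balanced[OF pr ex pn _ _ ok]) (use False cov fail in auto)
    \<comment> \<open>The set recorded with an emitted closing edge is closed, so it has at most
      \<open>card X\<close> neighbours. By the assumption on \<open>G\<close> it is all of
      \<open>V^+\<close>, whose neighbours do exhaust \<open>V^-\<close>.\<close>
    have "k = k2"
    proof (rule ccontr)
      assume "k \<noteq> k2"
      then obtain X where X: "fclosed \<mu>' {} X" "b \<in> X" "\<not> ?Q \<subseteq> Gam X" using close pn by blast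
      have XP: "X \<subseteq> ?P" using X(1) unfolding fclosed_def by blast
      have "Gam X \<subseteq> \<mu>' ` X"
      proof
        fix y assume "y \<in> Gam X"
        then obtain x where x: "x \<in> X" "y \<in> N x" unfolding nbrs_def by blast
        then have "y < p + n" using N_D(1)[of y x] XP by auto
        then have "y = \<mu>' (\<mu>' y)" using invol_D(2)[OF inv'] by simp
        then show "y \<in> \<mu>' ` X" using X(1) x unfolding fclosed_def by blast
      qed
      moreover have "finite X" by (rule finite_subset[OF XP]) simp
      ultimately have "card (Gam X) \<le> card X" using surj_card_le by blast
      then have "X = ?P" using G(1) XP X(2) by (metis empty_iff not_less)
      then show False using X(3) G(2) by simp
    qed
    then have "Suc k \<le> max (card (?P - I')) (card (?Q - I'))" using k_open[OF st] k0 by simp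
    moreover have "card (?P - I') \<le> 1" using cP P1 isoP k0 by linarith
    moreover have "card (?Q - I') \<le> 1" using cQ Q1 isoQ k0 by linarith
    ultimately have "k = 0" by linarith
    then have "card F = 0" using card by simp
    then show "F = {}" using finite_subset[OF sub] by simp
  qed (rule empty0)
  show ?thesis unfolding good_output_def using sub hall all lb irr pn by simp
qed

end

lemma time_bound:
  "1900 * (m + 1) * (p + n) + 30 + (1100 * (m + 1) * (p + n) + 30) + (100 * (2 * p + n) + 40) + 10 +
    (1000 * (m + 1) * (p + n) + 40) + (100 * (p + n) + 140) + 800 * (m + 1) \<le> 6000 * (m + 1) * (p + n + 1)"
proof -
  define q where "q = (m + 1) * (p + n)"
  have le: "p + n \<le> q" unfolding q_def by simp
  have eqs: "6000 * (m + 1) * (p + n + 1) = 6000 * q + 6000 * (m + 1)"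
    "1900 * (m + 1) * (p + n) = 1900 * q" "1100 * (m + 1) * (p + n) = 1100 * q"
    "1000 * (m + 1) * (p + n) = 1000 * q"
    unfolding q_def by (simp_all add: algebra_simps)
  show ?thesis unfolding eqs using le by simp
qed

lemma phases_correct:
  assumes b: "base s" and mate: "\<And>x. x < p + n \<Longrightarrow> s ''mate'' x = x"
    and one: "\<And>x. x < p + n \<Longrightarrow> s ''cov'' x = 1" and ind: "\<And>x. s ''ind'' x = 0"
    and out: "s ''F_size'' 0 = 0" and pn: "p \<le> n"
    and Q: "\<And>s' t'. good_output (output_edges s') \<Longrightarrow> t' \<le> t + 6000 * (m + 1) * (p + n + 1) \<Longrightarrow> Q s' t'"
  shows "wp phases Q s t"
proof -
  let ?R1 = "wp (If (Less (Var ''p'') (Var ''n'')) phase_unbalanced (phase_chain ;; phase_rest ;; phase_close)) Q"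
  have "matching (s ''mate'')" using mate unfolding matching_def invol_def by simp
  have "wp phase_independent (wp phase_maximum (wp phase_pair ?R1)) s t"
  proof (rule phase_independent_correct[OF b \<open>matching _\<close>])
    show "s ''ind'' x \<noteq> 1" for x using ind by simp
    fix s1 t1 assume fr1: "\<forall>v. v \<notin> augment_vars \<union> {''ind'', ''root''} \<longrightarrow> s1 v = s v" and b1: "base s1"
      and pr1: "prepared_upto (p + n) (s1 ''mate'') {x. s1 ''ind'' x = 1}"
      and t1: "t1 \<le> t + 1900 * (m + 1) * (p + n) + 30"
    have f1: "s1 ''cov'' = s ''cov''" "s1 ''F_size'' = s ''F_size''"
      using fr1 unfolding augment_vars_def search_vars_def flip_vars_def by simp_all
    show "wp phase_maximum (wp phase_pair ?R1) s1 t1"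
    proof (rule phase_maximum_correct[OF b1 pr1])
      show "s1 ''cov'' x = 1" if "x < p + n" for x using one[OF that] f1 by simp
      fix s2 t2 assume fr2: "\<forall>v. v \<notin> insert ''root'' augment_vars \<longrightarrow> s2 v = s1 v" and b2: "base s2"
        and pr2: "prepared (s2 ''mate'') {x. s1 ''ind'' x = 1}"
        and t2: "t2 \<le> t1 + 1100 * (m + 1) * (p + n) + 30"
      have f2: "s2 ''cov'' = s ''cov''" "s2 ''F_size'' = s ''F_size''" "s2 ''ind'' = s1 ''ind''"
        using fr2 f1 unfolding augment_vars_def search_vars_def flip_vars_def by simp_all
      have pr: "prepared (s2 ''mate'') {x. s2 ''ind'' x = 1}" using pr2 f2(3) by simp
      show "wp phase_pair ?R1 s2 t2"
      proof (rule phase_pair_correct[OF b2 pr pn])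
        show "s2 ''F_size'' 0 = 0" using f2 out by simp
        fix s3 t3 assume fr3: "\<forall>v. v \<notin> {''u'', ''w'', ''F_tail'', ''F_head'', ''F_size'', ''mate'', ''ind''} \<longrightarrow> s3 v = s2 v"
          and b3: "base s3"
          and ex: "extension (s2 ''mate'') {x. s2 ''ind'' x = 1} (s3 ''mate'') {x. s3 ''ind'' x = 1}"
          and cov3: "\<forall>x<p. s3 ''mate'' x \<noteq> x"
          and E0: "output_edges s3 = (\<lambda>x. (x, s3 ''mate'' x)) ` {x. x < p \<and> s2 ''mate'' x = x}"
          and k0: "s3 ''F_size'' 0 = card {x. x < p \<and> s2 ''mate'' x = x}"
          and t3: "t3 \<le> t2 + 100 * (2 * p + n) + 40"
        note inv3 = extensionD(1)[OF ex]
        have cov: "\<And>x. x < p \<Longrightarrow> s3 ''mate'' x \<noteq> x" using cov3 by blast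
        have one3: "s3 ''cov'' x = 1" if "x < p + n" for x using fr3 f2(1) one[OF that] by simp
        have cmp: "s3 ''p'' 0 = p" "s3 ''n'' 0 = n" using b3 unfolding base_def by blast+
        show "?R1 s3 t3"
        proof (cases "p < n")
          case True
          have "wp phase_unbalanced Q s3 (t3 + 6)"
          proof (rule phase_unbalanced_correct[OF b3 inv3 True])
            fix s4 t4 w assume w: "p \<le> w" "w < p + n" "s3 ''mate'' w = w"
              and o4: "output_edges s4 = output_edges s3 \<union> (\<lambda>x. (x, w)) ` {x. x < p \<and> s3 ''ind'' x \<noteq> 1}"
              and k4: "s4 ''F_size'' 0 = s3 ''F_size'' 0 + card {x. x < p \<and> s3 ''ind'' x \<noteq> 1}"
              and t4: "t4 \<le> t3 + 6 + 100 * (p + n) + 100"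
            have "card (output_edges s4) \<le> s4 ''F_size'' 0" unfolding output_edges_outs by (rule card_outs_le)
            then have "good_output (output_edges s4)"
              by (intro good_unbalanced[OF pr ex cov E0 True w]) (simp_all add: o4 k4 k0)
            then show "Q s4 t4" by (rule Q) (use t1 t2 t3 t4 time_bound in linarith)
          qed
          then show ?thesis using True cmp by (simp add: wp_If eval_nat_numeral)
        next
          case False
          then have eq: "p = n" using pn by simp
          have full: "s3 ''mate'' x \<noteq> x" if "x < p + n" for x using perfect_minus[OF pr ex eq cov that] .
          have "wp phase_chain (wp phase_rest (wp phase_close Q)) s3 (t3 + 6)"
          proof (rule phase_chain_correct[OF b3 refl inv3 full])
            fix s4 t4 assume c4: "s4 ''cov'' = s3 ''cov''" and w4: "s4 ''w'' 0 = p + n"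
              and st4: "chain_state (s3 ''mate'') {x. s3 ''ind'' x = 1} (output_edges s3) (s3 ''F_size'' 0) s4"
              and t4: "t4 \<le> t3 + 6 + 1000 * (m + 1) * (p + n) + 40"
            let ?J = "{x. s4 ''ind'' x = 1}"
            obtain SC TC where b4: "base s4" and m4: "s4 ''mate'' = s3 ''mate''"
              and ok: "chain_ok (s3 ''mate'') {x. s3 ''ind'' x = 1} (output_edges s3) (s3 ''F_size'' 0) ?J
                (output_edges s4) (s4 ''F_size'' 0) SC TC (s4 ''started'' 0) (s4 ''source'' 0) (s4 ''sink'' 0)"
              using st4 by (rule chain_stateE)
            have fail: "\<exists>X. fclosed (s3 ''mate'') {} X \<and> s3 ''mate'' y \<in> X \<and> X \<subseteq> ?J"
              if "p \<le> y" "y < p + n" "y \<notin> ?J" for y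
              using chain_state_fail[OF st4, of y] that w4 by simp
            have bd: "s4 ''sink'' 0 < p \<and> p \<le> s4 ''source'' 0 \<and> s4 ''source'' 0 < p + n" if "s4 ''started'' 0 = 1"
              using chain_okD(3,4,8)[OF ok] that by auto
            have started: "s4 ''started'' 0 = 1" if "0 < p"
              by (rule started_balanced[OF pr ex eq that _ ok]) (use cov fail in auto)
            show "wp phase_rest (wp phase_close Q) s4 t4"
            proof (rule phase_rest_correct[OF b4 refl])
              show "s4 ''sink'' 0 < p \<and> p \<le> s4 ''source'' 0 \<and> s4 ''source'' 0 < p + n" if "0 < p + n"
                using bd started that eq by simp
              fix s5 t5 assume fr5: "\<forall>v. v \<notin> {''u'', ''w'', ''x'', ''y'', ''F_tail'', ''F_head'', ''F_size''} \<longrightarrow> s5 v = s4 v"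
                and E5: "output_edges s4 \<subseteq> output_edges s5"
                  "output_edges s5 - output_edges s4 \<subseteq> {..<p} \<times> {p..<p + n}"
                and restT: "\<And>x. x \<in> unflagged ?J 0 p \<Longrightarrow>
                  \<exists>y. (x, y) \<in> output_edges s5 \<and> (y = s4 ''source'' 0 \<or> y \<in> unflagged ?J p (p + n))"
                and restS: "\<And>y. y \<in> unflagged ?J p (p + n) \<Longrightarrow>
                  \<exists>x. (x, y) \<in> output_edges s5 \<and> (x = s4 ''sink'' 0 \<or> x \<in> unflagged ?J 0 p)"
                and k5: "s5 ''F_size'' 0 \<le> s4 ''F_size'' 0 + max (card (unflagged ?J 0 p)) (card (unflagged ?J p (p + n)))"
                and t5: "t5 \<le> t4 + 100 * (p + n) + 40"
              have f5: "s5 ''mate'' = s3 ''mate''" "s5 ''cov'' = s3 ''cov''" "s5 ''sink'' = s4 ''sink''"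
                "s5 ''source'' = s4 ''source''" "s5 ''started'' = s4 ''started''"
                using fr5 m4 c4 by simp_all
              have b5: "base s5" using b4 fr5 unfolding base_def by simp
              show "wp phase_close Q s5 t5"
              proof (rule phase_close_correct[OF b5 f5(1) inv3 full])
                show "s5 ''cov'' x = 1" if "x < p + n" for x using one3[OF that] f5(2) by simp
                show "s5 ''sink'' 0 = s4 ''sink'' 0" "s5 ''source'' 0 = s4 ''source'' 0" using f5 by simp_all
                show "s4 ''sink'' 0 < p \<and> p \<le> s4 ''source'' 0 \<and> s4 ''source'' 0 < p + n"
                  if "s5 ''started'' 0 = 1" using bd that f5(5) by simp
                fix s6 t6 assume cl: "s5 ''started'' 0 \<noteq> 1 \<and> output_edges s6 = output_edges s5 \<and> s6 ''F_size'' 0 = s5 ''F_size'' 0 \<or>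
                  s5 ''started'' 0 = 1 \<and> output_edges s6 = insert (s4 ''sink'' 0, s4 ''source'' 0) (output_edges s5) \<and>
                    s6 ''F_size'' 0 = Suc (s5 ''F_size'' 0) \<and>
                    (\<exists>X. fclosed (s3 ''mate'') {} X \<and> s4 ''sink'' 0 \<in> X \<and> (p = n \<longrightarrow> \<not> {p..<p + n} \<subseteq> Gam X)) \<or>
                  s5 ''started'' 0 = 1 \<and> output_edges s6 = output_edges s5 \<and> s6 ''F_size'' 0 = s5 ''F_size'' 0 \<and>
                    (\<forall>X. fclosed (s3 ''mate'') {} X \<longrightarrow> s4 ''sink'' 0 \<in> X \<longrightarrow> s3 ''mate'' (s4 ''source'' 0) \<in> X)"
                  and t6: "t6 \<le> t5 + 800 * (m + 1)"
                have "card (output_edges s6) \<le> s6 ''F_size'' 0" unfolding output_edges_outs by (rule card_outs_le)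
                then have "good_output (output_edges s6)"
                  by (rule good_balanced[OF pr ex cov E0 eq ok[unfolded k0] fail E5 k5 restT restS cl[unfolded f5(5)], rotated -1])
                then show "Q s6 t6" by (rule Q) (use t1 t2 t3 t4 t5 t6 time_bound in linarith)
              qed
            qed
          qed
          then show ?thesis using False cmp by (simp add: wp_If wp_Seq_fun eval_nat_numeral)
        qed
      qed
    qed
  qed
  then show ?thesis unfolding phases_def by (simp only: wp_Seq_fun)
qed

end

lemma card_Image_sum:
  assumes "finite P" "finite Q" "F \<subseteq> P \<times> Q"
  shows "card F = (\<Sum>x\<in>P. card (F `` {x}))"
proof -
  have "F = Sigma P (\<lambda>x. F `` {x})" using assms(3) by auto
  moreover have "finite (F `` {x})" for x
    by (rule finite_subset[OF _ assms(2)]) (use assms(3) in auto)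
  ultimately show ?thesis using card_SigmaI[OF assms(1), of "\<lambda>x. F `` {x}"] by metis
qed

section \<open>Optimality among all augmentations\<close>

context graph_mem
begin

lemma good_output_minimum:
  assumes G: "bipartite_graph G" "vplus G = {..<p}" "vminus G = {p..<p + n}" and pn: "p \<le> n"
    and N: "\<And>v. v < p + n \<Longrightarrow> N v = {y. (v, y) \<in> edges G \<or> (y, v) \<in> edges G}"
    and good: "good_output F"
  shows "min_DM_augmentation G F"
proof -
  let ?P = "{..<p}" and ?Q = "{p..<p + n}"
  have E: "edges G \<subseteq> ?P \<times> ?Q" using G unfolding bipartite_graph_def by auto
  have NP: "N x = {y. (x, y) \<in> edges G}" if "x < p" for x
  proof -
    have "(y, x) \<notin> edges G" for y using E that by auto
    then show ?thesis using N[of x] that by simp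
  qed
  have NQ: "N y = {x. (x, y) \<in> edges G}" if "p \<le> y" "y < p + n" for y
  proof -
    have "(y, x) \<notin> edges G" for x using E that by auto
    then show ?thesis using N[of y] that by simp
  qed
  have F: "F \<subseteq> ?P \<times> ?Q"
    and g1: "\<And>X. X \<subseteq> ?P \<Longrightarrow> X \<noteq> {} \<Longrightarrow> p < n \<or> X \<noteq> ?P \<Longrightarrow> card X < card (nbrs (aug F) X)"
    and g2: "p = n \<Longrightarrow> nbrs (aug F) ?P = ?Q"
    and g3: "p < n \<Longrightarrow> lower_bound_attained ?P (card F)"
    and g4: "p = n \<Longrightarrow> lower_bound_attained ?P (card F) \<or> lower_bound_attained ?Q (card F)"
    and g5: "p = n \<Longrightarrow> (\<forall>X\<subseteq>?P. X \<noteq> {} \<longrightarrow> X \<noteq> ?P \<longrightarrow> card X < card (Gam X)) \<Longrightarrow> Gam ?P = ?Q \<Longrightarrow> F = {}"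
    using good unfolding good_output_def by blast+
  have H: "bipartite_graph (add_edges G F')" "vplus (add_edges G F') = ?P" "vminus (add_edges G F') = ?Q"
    if "F' \<subseteq> ?P \<times> ?Q" for F'
    using that G unfolding bipartite_graph_def add_edges_def by auto
  have nb: "nbhd (add_edges G F') X = nbrs (aug F') X" if F': "F' \<subseteq> ?P \<times> ?Q" and X: "X \<subseteq> ?P" for F' X
  proof -
    have "aug F' x = {y \<in> ?Q. (x, y) \<in> edges G \<union> F'}" if "x \<in> X" for x
    proof -
      have "x < p" using that X by auto
      from NP[OF this] show ?thesis using E F' unfolding aug_def by auto
    qed
    then show ?thesis using G(3) unfolding nbhd_def nbrs_def add_edges_def by auto
  qed
  have irr: "DM_irreducible (add_edges G F)"
  \<comment> \<open>For the graph without vertices the strict condition holds vacuously, and it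
    counts as irreducible through the last part.\<close>
  proof (cases "p < n \<or> p = 0")
    case True
    show ?thesis
      by (rule DM_irreducibleI_strict) (use True g1 nb[OF F] H(2)[OF F] in auto)
  next
    case False
    then have eq: "p = n" "0 < p" using pn by auto
    show ?thesis
    proof (rule DM_irreducibleI_balanced[OF H(1)[OF F]])
      show "nbhd (add_edges G F) (vplus (add_edges G F)) = vminus (add_edges G F)"
        using nb[OF F, of ?P] g2[OF eq(1)] H(2,3)[OF F] by simp
      show "vplus (add_edges G F) \<noteq> {}" using eq(2) H(2)[OF F] by auto
      fix X assume "X \<subseteq> vplus (add_edges G F)" "X \<noteq> {}" "X \<noteq> vplus (add_edges G F)"
      then show "card X < card (nbhd (add_edges G F) X)" using nb[OF F, of X] g1[of X] H(2)[OF F] by simp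
    qed (use H(2,3)[OF F] eq in simp)
  qed
  have lower: "card F \<le> card F'" if F': "F' \<subseteq> ?P \<times> ?Q" and ir': "DM_irreducible (add_edges G F')" for F'
  proof -
    have finF': "finite F'" by (rule finite_subset[OF F']) simp
    have le: "card (vplus (add_edges G F')) \<le> card (vminus (add_edges G F'))" using H(2,3)[OF F'] pn by simp
    have hall1: "card X \<le> card (nbrs (aug F') X)" if "X \<subseteq> ?P" "X \<noteq> {}" for X
      using DM_irreducible_hall(1)[OF H(1)[OF F'] le ir', of X] that nb[OF F' that(1)] H(2)[OF F'] by simp
    have hall2: "card X < card (nbrs (aug F') X)" if "X \<subseteq> ?P" "X \<noteq> {}" "X \<noteq> ?P \<or> p < n" for X
      using DM_irreducible_hall(2)[OF H(1)[OF F'] le ir', of X] that nb[OF F' that(1)] H(2,3)[OF F'] by simp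
    have sumP: "card F' = (\<Sum>x\<in>?P. card (F' `` {x}))" by (rule card_Image_sum[OF _ _ F']) simp_all
    have aug_eq: "aug F' = (\<lambda>x. N x \<union> F' `` {x})" unfolding aug_def by (rule ext) simp
    have bound: "card F \<le> card F'"
      if lb: "lower_bound_attained ?P (card F)" and proper: "p < n \<or> 2 \<le> card ?P \<and> (\<exists>x\<in>?P. F' `` {x} \<noteq> {})"
    proof -
      obtain I where I: "max_hindep ?P I" "card F \<le> card (?P - I) + card {x \<in> ?P. N x = {}}"
        using lb unfolding lower_bound_attained_def by blast
      have "card (?P - I) + card {x \<in> ?P. N x = {}} \<le> (\<Sum>x\<in>?P. card (F' `` {x}))"
      proof (rule added_edges_lower_bound[OF _ _ _ proper])
        show "finite (F' `` {x})" for x using finF' by (rule finite_Image)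
        show "card Y < card (nbrs (\<lambda>x. N x \<union> F' `` {x}) Y)" if "Y \<subseteq> ?P" "Y \<noteq> {}" "Y \<noteq> ?P \<or> p < n" for Y
          using hall2[OF that] unfolding aug_eq .
        show "I \<subseteq> ?P" "\<And>B. B \<subseteq> ?P \<Longrightarrow> hindep N B \<Longrightarrow> card B \<le> card I"
          using I(1) unfolding max_hindep_def by simp_all
      qed simp
      then show ?thesis using I(2) sumP by simp
    qed
    show ?thesis
    proof (cases "p < n")
      case True
      then show ?thesis using bound[OF g3] by blast
    next
      case False
      then have eq: "p = n" using pn by simp
      have all: "nbrs (aug F') ?P = ?Q"
      proof (cases "p = 0")
        case True
        then show ?thesis using eq unfolding nbrs_def by simp
      next
        case False
        have sub: "nbrs (aug F') ?P \<subseteq> ?Q" by (rule aug_image[OF F'])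
        have "card ?Q \<le> card (nbrs (aug F') ?P)" using hall1[of ?P] False eq by auto
        then show ?thesis using sub by (intro card_seteq) simp_all
      qed
      show ?thesis
      \<comment> \<open>Without added edges the lower bound is false; here \<open>G\<close> itself
        satisfies the Hall conditions, and \<open>g5\<close> gives \<open>F = {}\<close>.\<close>
      proof (cases "F' = {}")
        case True
        have "aug F' = N" unfolding aug_def True by (rule ext) simp
        then have "F = {}" using g5[OF eq] hall2 all by simp
        then show ?thesis by simp
      next
        case ne: False
        then obtain a b where ab: "(a, b) \<in> F'" by auto
        show ?thesis
        \<comment> \<open>The lower bound presupposes two vertices per side. For
          \<open>p = 1\<close> there is only one possible edge, which the nonempty \<open>F'\<close>
          contains.\<close>
        proof (cases "p = 1")
          case True
          have "card F \<le> card (?P \<times> ?Q)" using F by (intro card_mono) simp_all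
          also have "\<dots> = 1" using True eq by (simp add: card_cartesian_product)
          also have "\<dots> \<le> card F'" using ne finF' by (simp add: Suc_le_eq card_gt_0_iff)
          finally show ?thesis .
        next
          case False
          have "p \<noteq> 0" using ab F' by auto
          then have p2: "2 \<le> p" using False by simp
          from g4[OF eq] show ?thesis
          proof
            assume "lower_bound_attained ?P (card F)"
            then show ?thesis using bound p2 ab F' by auto
          next
            assume "lower_bound_attained ?Q (card F)"
            then obtain I where I: "max_hindep ?Q I" "card F \<le> card (?Q - I) + card {x \<in> ?Q. N x = {}}"
              unfolding lower_bound_attained_def by blast
            let ?R = "edges G \<union> F'"
            have R: "?R \<subseteq> ?P \<times> ?Q" using E F' by blast
            have RX: "?R `` X = nbrs (aug F') X" if X: "X \<subseteq> ?P" for X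
            proof -
              have "aug F' x = {y. (x, y) \<in> ?R}" if "x \<in> X" for x
                using NP[of x] that X unfolding aug_def by auto
              then show ?thesis unfolding nbrs_def by auto
            qed
            have RY: "?R\<inverse> `` Y = nbrs (\<lambda>y. N y \<union> F'\<inverse> `` {y}) Y" if Y: "Y \<subseteq> ?Q" for Y
            proof -
              have "N y \<union> F'\<inverse> `` {y} = {x. (x, y) \<in> ?R}" if "y \<in> Y" for y
                using NQ[of y] that Y by auto
              then show ?thesis unfolding nbrs_def by auto
            qed
            \<comment> \<open>The same lower bound for the transposed graph; its Hall condition on
              \<open>V^-\<close> comes from \<open>hall_dual\<close>.\<close>
            have "card (?Q - I) + card {x \<in> ?Q. N x = {}} \<le> (\<Sum>y\<in>?Q. card (F'\<inverse> `` {y}))"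
            proof (rule added_edges_lower_bound[where strict = False])
              show "finite (F'\<inverse> `` {y})" for y using finF' by (intro finite_Image) simp
              show "card Y < card (nbrs (\<lambda>y. N y \<union> F'\<inverse> `` {y}) Y)"
                if Y: "Y \<subseteq> ?Q" "Y \<noteq> {}" "Y \<noteq> ?Q \<or> False" for Y
              proof -
                have "card Y < card (?R\<inverse> `` Y)"
                proof (rule hall_dual[of ?P ?Q])
                  show "?R \<subseteq> ?P \<times> ?Q" by (rule R)
                  show "card X < card (?R `` X)" if "X \<subseteq> ?P" "X \<noteq> {}" "X \<noteq> ?P" for X
                    using RX[OF that(1)] hall2[of X] that by simp
                  show "?Q \<subseteq> ?R `` ?P" using RX[of ?P] all by simp
                qed (use eq Y in simp_all)
                then show ?thesis using RY[OF Y(1)] by simp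
              qed
              show "False \<or> 2 \<le> card ?Q \<and> (\<exists>y\<in>?Q. F'\<inverse> `` {y} \<noteq> {})" using p2 eq ab F' by auto
              show "I \<subseteq> ?Q" "\<And>B. B \<subseteq> ?Q \<Longrightarrow> hindep N B \<Longrightarrow> card B \<le> card I"
                using I(1) unfolding max_hindep_def by simp_all
            qed simp
            also have "\<dots> = card (F'\<inverse>)"
              by (rule card_Image_sum[symmetric, of _ ?P]) (use F' in auto)
            also have "\<dots> = card F'" by simp
            finally show ?thesis using I(2) by simp
          qed
        qed
      qed
    qed
  qed
  have "F - edges G \<subseteq> ?P \<times> ?Q" using F by blast
  moreover have "add_edges G (F - edges G) = add_edges G F" unfolding add_edges_def by simp
  ultimately have "card F \<le> card (F - edges G)" using lower irr by metis
  moreover have "finite F" by (rule finite_subset[OF F]) simp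
  ultimately have "F - edges G = F" by (metis Diff_subset card_seteq)
  then have "F \<subseteq> vplus G \<times> vminus G - edges G" using F G by auto
  moreover have "card F \<le> card F'" if "F' \<subseteq> vplus G \<times> vminus G - edges G" "DM_irreducible (add_edges G F')" for F'
    by (rule lower) (use that G(2,3) in auto)
  ultimately show ?thesis
    unfolding min_DM_augmentation_def DM_augmentation_def using irr by blast
qed

end

section \<open>Input conversion and the complete program\<close>

text \<open>\<open>total\<close> is obtained by counting up from \<open>p\<close>, because
  \<open>tame\<close> admits only the addition of 1.\<close>

definition setup_vertices :: com where
  "setup_vertices =
     set_var ''total'' (Var ''p'') ;; set_var ''u'' (Num 0) ;;
     While (Less (Var ''u'') (Var ''n'')) (incr ''total'' ;; incr ''u'') ;;
     set_var ''u'' (Num 0) ;;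
     While (Less (Var ''u'') (Var ''total''))
       (Assign ''mate'' (Var ''u'') (Var ''u'') ;; Assign ''cov'' (Var ''u'') (Num 1) ;; incr ''u'')"

definition arc_step :: com where
  "arc_step =
     incr ''arc'' ;;
     Assign ''dst'' (Var ''arc'') (Cell ''head'' (Var ''edge'')) ;;
     Assign ''next'' (Var ''arc'') (Cell ''first'' (Cell ''tail'' (Var ''edge''))) ;;
     Assign ''first'' (Cell ''tail'' (Var ''edge'')) (Var ''arc'') ;;
     incr ''arc'' ;;
     Assign ''dst'' (Var ''arc'') (Cell ''tail'' (Var ''edge'')) ;;
     Assign ''next'' (Var ''arc'') (Cell ''first'' (Cell ''head'' (Var ''edge''))) ;;
     Assign ''first'' (Cell ''head'' (Var ''edge'')) (Var ''arc'') ;;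
     incr ''edge''"

definition setup_arcs :: com where
  "setup_arcs =
     set_var ''edge'' (Num 0) ;; set_var ''arc'' (Num 0) ;;
     While (Less (Var ''edge'') (Var ''m'')) arc_step"

text \<open>The edge with index \<open>i\<close> yields the arcs \<open>2i + 1\<close> and \<open>2i + 2\<close>, so that \<open>0\<close> can terminate lists.\<close>

primrec arcs :: "(nat \<times> nat) list \<Rightarrow> nat \<Rightarrow> nat \<Rightarrow> nat list" where
  "arcs es 0 v = []"
| "arcs es (Suc e) v =
     (if v = snd (es ! e) then [2 * e + 2] else []) @ (if v = fst (es ! e) then [2 * e + 1] else []) @ arcs es e v"

lemma set_arcs:
  "a \<in> set (arcs es e v) \<longleftrightarrow>
   (\<exists>i<e. a = 2 * i + 1 \<and> v = fst (es ! i) \<or> a = 2 * i + 2 \<and> v = snd (es ! i))"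
  by (induction e) (auto simp: less_Suc_eq)

lemma sum_length_arcs:
  "(\<And>i. i < e \<Longrightarrow> fst (es ! i) < K \<and> snd (es ! i) < K) \<Longrightarrow> (\<Sum>v<K. length (arcs es e v)) = 2 * e"
proof (induction e)
  case (Suc e)
  have "(\<Sum>v<K. length (arcs es (Suc e) v)) =
      (\<Sum>v<K. if v = snd (es ! e) then 1 else 0) + (\<Sum>v<K. if v = fst (es ! e) then 1 else 0) +
      (\<Sum>v<K. length (arcs es e v))"
    unfolding sum.distrib[symmetric] by (rule sum.cong) auto
  also have "\<dots> = 1 + 1 + 2 * e" using Suc by (simp add: sum.delta)
  finally show ?case by simp
qed simp

lemma linked_upd: "b \<notin> set as \<Longrightarrow> linked (nx(b := c)) a as \<longleftrightarrow> linked nx a as"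
  by (induction as arbitrary: a) auto

definition arcs_inv where
  "arcs_inv es T s t \<longleftrightarrow>
     s ''m'' 0 = length es \<and> (\<forall>i<length es. s ''tail'' i = fst (es ! i) \<and> s ''head'' i = snd (es ! i)) \<and>
     s ''edge'' 0 \<le> length es \<and> s ''arc'' 0 = 2 * s ''edge'' 0 \<and>
     (\<forall>v. linked (s ''next'') (s ''first'' v) (arcs es (s ''edge'' 0) v)) \<and>
     (\<forall>i<s ''edge'' 0. s ''dst'' (2 * i + 1) = snd (es ! i) \<and> s ''dst'' (2 * i + 2) = fst (es ! i)) \<and>
     t + 100 * (length es - s ''edge'' 0) + 10 \<le> (T::nat)"

lemma arc_step_correct:
  assumes inv: "arcs_inv es T s t" and less: "s ''edge'' 0 < length es"
    and ne: "fst (es ! (s ''edge'' 0)) \<noteq> snd (es ! (s ''edge'' 0))"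
  shows "wp arc_step (arcs_inv es T) s (t + 6)"
proof -
  obtain e where e: "s ''edge'' 0 = e" by blast
  define u w where "u = fst (es ! e)" and "w = snd (es ! e)"
  have I: "s ''m'' 0 = length es" "\<forall>i<length es. s ''tail'' i = fst (es ! i) \<and> s ''head'' i = snd (es ! i)"
    "s ''arc'' 0 = 2 * e" "\<And>v. linked (s ''next'') (s ''first'' v) (arcs es e v)"
    "\<forall>i<e. s ''dst'' (2 * i + 1) = snd (es ! i) \<and> s ''dst'' (2 * i + 2) = fst (es ! i)"
    "t + 100 * (length es - e) + 10 \<le> T"
    using inv e unfolding arcs_inv_def by simp_all
  have el: "e < length es" using less e by simp
  have uw: "u \<noteq> w" "w \<noteq> u" using ne e unfolding u_def w_def by simp_all
  have tl: "s ''tail'' e = u" "s ''head'' e = w" using I(2) el unfolding u_def w_def by simp_all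
  let ?nx = "(s ''next'')(Suc (2 * e) := s ''first'' u, Suc (Suc (2 * e)) := s ''first'' w)"
  let ?fs = "(s ''first'')(u := Suc (2 * e), w := Suc (Suc (2 * e)))"
  have "a \<le> 2 * e" if "a \<in> set (arcs es e v)" for a v using that unfolding set_arcs by auto
  then have fresh: "Suc (2 * e) \<notin> set (arcs es e v)" "Suc (Suc (2 * e)) \<notin> set (arcs es e v)" for v
    by fastforce+
  have old: "linked ?nx a (arcs es e v) \<longleftrightarrow> linked (s ''next'') a (arcs es e v)" for a v
    using fresh by (simp add: linked_upd del: fun_upd_apply)
  have lk: "linked ?nx (?fs v) (arcs es (Suc e) v)" for v
  proof -
    consider "v = u" | "v = w" | "v \<noteq> u" "v \<noteq> w" by blast
    then show ?thesis
    proof cases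
      case 1
      then show ?thesis using uw old I(4)[of u] unfolding u_def[symmetric] w_def[symmetric] arcs.simps by simp
    next
      case 2
      then show ?thesis using uw old I(4)[of w] unfolding u_def[symmetric] w_def[symmetric] arcs.simps by simp
    next
      case 3
      then show ?thesis using old I(4)[of v] unfolding u_def[symmetric] w_def[symmetric] arcs.simps by simp
    qed
  qed
  have dst: "((s ''dst'')(Suc (2 * e) := w, Suc (Suc (2 * e)) := u)) (2 * i + 1) = snd (es ! i) \<and>
      ((s ''dst'')(Suc (2 * e) := w, Suc (Suc (2 * e)) := u)) (2 * i + 2) = fst (es ! i)" if "i < Suc e" for i
  proof (cases "i = e")
    case False
    then have "i < e" using that by simp
    moreover have "2 * i \<noteq> Suc (2 * e)" "Suc (2 * i) \<noteq> 2 * e" by arith+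
    ultimately show ?thesis using I(5) by simp
  qed (simp add: u_def w_def)
  have le: "length es - e = Suc (length es - Suc e)" using el by simp
  have fin: "arcs_inv es T s' t'" if "s' ''m'' = s ''m''" "s' ''tail'' = s ''tail''" "s' ''head'' = s ''head''"
     "s' ''edge'' 0 = Suc e" "s' ''arc'' 0 = Suc (Suc (2 * e))" "s' ''next'' = ?nx" "s' ''first'' = ?fs"
     "s' ''dst'' = (s ''dst'')(Suc (2 * e) := w, Suc (Suc (2 * e)) := u)" "t' \<le> t + 100" for s' t'
    unfolding arcs_inv_def that(1-8) using I(1,2,6) el lk dst le that(9) by (simp del: fun_upd_apply arcs.simps)
  show ?thesis unfolding arc_step_def
    using e I(3) tl uw by (simp add: wp_simps) (rule fin, simp_all)
qed

lemma setup_arcs_correct: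
  assumes m: "s ''m'' 0 = length es"
    and es: "\<And>i. i < length es \<Longrightarrow> s ''tail'' i = fst (es ! i) \<and> s ''head'' i = snd (es ! i)"
    and ne: "\<And>i. i < length es \<Longrightarrow> fst (es ! i) \<noteq> snd (es ! i)"
    and first: "\<And>v. s ''first'' v = 0"
    and Q: "\<And>s' t'. \<lbrakk>\<forall>v. v \<notin> {''edge'', ''arc'', ''dst'', ''next'', ''first''} \<longrightarrow> s' v = s v;
      \<And>v. linked (s' ''next'') (s' ''first'' v) (arcs es (length es) v);
      \<And>i. i < length es \<Longrightarrow> s' ''dst'' (2 * i + 1) = snd (es ! i) \<and> s' ''dst'' (2 * i + 2) = fst (es ! i);
      t' \<le> t + 100 * length es + 40\<rbrakk> \<Longrightarrow> Q s' t'"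
  shows "wp setup_arcs Q s t"
proof -
  let ?s = "s(''edge'' := (s ''edge'')(0 := 0), ''arc'' := (s ''arc'')(0 := 0))"
  let ?T = "t + 100 * length es + 20"
  let ?V = "{''edge'', ''arc'', ''dst'', ''next'', ''first''}"
  have md: "mods arc_step \<subseteq> ?V" unfolding arc_step_def by auto
  have "wp (While (Less (Var ''edge'') (Var ''m'')) arc_step) Q ?s (t + 6)"
  proof (rule wp_While_frameI[where I = "arcs_inv es ?T" and K = ?T])
    show "arcs_inv es ?T ?s (t + 6)" unfolding arcs_inv_def using m es first by simp
  next
    fix s1 t1 assume "arcs_inv es ?T s1 t1"
    then show "t1 \<le> ?T" unfolding arcs_inv_def by simp
  next
    fix s1 t1 assume I: "arcs_inv es ?T s1 t1" and c: "bval (Less (Var ''edge'') (Var ''m'')) s1"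
    have "s1 ''m'' 0 = length es" using I unfolding arcs_inv_def by blast
    then have less: "s1 ''edge'' 0 < length es" using c by simp
    from arc_step_correct[OF I less ne[OF less]]
    show "wp arc_step (arcs_inv es ?T) s1 (t1 + (1 + bcost (Less (Var ''edge'') (Var ''m''))))"
      by (simp add: eval_nat_numeral)
  next
    fix s1 t1 assume I: "arcs_inv es ?T s1 t1" and c: "\<not> bval (Less (Var ''edge'') (Var ''m'')) s1"
      and fr: "\<forall>x. x \<notin> mods arc_step \<longrightarrow> s1 x = ?s x"
    have "s1 ''m'' 0 = length es" "s1 ''edge'' 0 \<le> length es" using I unfolding arcs_inv_def by blast+
    then have e: "s1 ''edge'' 0 = length es" using c by simp
    show "Q s1 (t1 + (1 + bcost (Less (Var ''edge'') (Var ''m''))))"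
    proof (rule Q)
      show "\<forall>v. v \<notin> ?V \<longrightarrow> s1 v = s v"
      proof (intro allI impI)
        fix v assume v: "v \<notin> ?V"
        from frameD[OF fr md v] show "s1 v = s v" using v by simp
      qed
    qed (use I e in \<open>simp_all add: arcs_inv_def\<close>)
  qed
  then show ?thesis unfolding setup_arcs_def by (simp add: wp_simps eval_nat_numeral)
qed

definition count_inv where
  "count_inv p n T s t \<longleftrightarrow> s ''n'' 0 = n \<and> s ''u'' 0 \<le> n \<and> s ''total'' 0 = p + s ''u'' 0 \<and>
     t + 40 * (n - s ''u'' 0) + 10 \<le> (T::nat)"

definition init_inv where
  "init_inv N T s t \<longleftrightarrow> s ''total'' 0 = N \<and> s ''u'' 0 \<le> N \<and>
     (\<forall>x<s ''u'' 0. s ''mate'' x = x \<and> s ''cov'' x = 1) \<and> t + 40 * (N - s ''u'' 0) + 10 \<le> (T::nat)"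

lemma setup_vertices_correct:
  assumes pn: "s ''p'' 0 = p" "s ''n'' 0 = n"
    and Q: "\<And>s' t'. \<lbrakk>\<forall>v. v \<notin> {''total'', ''u'', ''mate'', ''cov''} \<longrightarrow> s' v = s v; s' ''total'' 0 = p + n;
      \<And>x. x < p + n \<Longrightarrow> s' ''mate'' x = x \<and> s' ''cov'' x = 1;
      t' \<le> t + 40 * n + 40 * (p + n) + 100\<rbrakk> \<Longrightarrow> Q s' t'"
  shows "wp setup_vertices Q s t"
proof -
  let ?s = "s(''total'' := (s ''total'')(0 := p), ''u'' := (s ''u'')(0 := 0))"
  let ?T = "t + 40 * n + 20"
  let ?b1 = "incr ''total'' ;; incr ''u''"
  let ?b2 = "Assign ''mate'' (Var ''u'') (Var ''u'') ;; Assign ''cov'' (Var ''u'') (Num 1) ;; incr ''u''"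
  let ?R = "wp (set_var ''u'' (Num 0)) (wp (While (Less (Var ''u'') (Var ''total'')) ?b2) Q)"
  have "wp (While (Less (Var ''u'') (Var ''n'')) ?b1) ?R ?s (t + 7)"
  proof (rule wp_While_frameI[where I = "count_inv p n ?T" and K = ?T])
    show "count_inv p n ?T ?s (t + 7)" unfolding count_inv_def using pn by simp
  next
    fix s1 t1 assume "count_inv p n ?T s1 t1"
    then show "t1 \<le> ?T" unfolding count_inv_def by simp
  next
    fix s1 t1 assume I: "count_inv p n ?T s1 t1" and c: "bval (Less (Var ''u'') (Var ''n'')) s1"
    obtain u where u: "s1 ''u'' 0 = u" by blast
    have "n - u = Suc (n - Suc u)" if "u < n" using that by simp
    then show "wp ?b1 (count_inv p n ?T) s1 (t1 + (1 + bcost (Less (Var ''u'') (Var ''n''))))"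
      using I c u by (simp add: wp_simps count_inv_def)
  next
    fix s1 t1 assume I: "count_inv p n ?T s1 t1" and c: "\<not> bval (Less (Var ''u'') (Var ''n'')) s1"
      and fr1: "\<forall>x. x \<notin> mods ?b1 \<longrightarrow> s1 x = ?s x"
    have tot: "s1 ''total'' 0 = p + n" and t1: "t1 + 10 \<le> ?T" using I c unfolding count_inv_def by simp_all
    have f1: "s1 v = s v" if "v \<notin> {''total'', ''u''}" for v using fr1 that by simp
    let ?s1 = "s1(''u'' := (s1 ''u'')(0 := 0))"
    let ?T2 = "t1 + 40 * (p + n) + 40"
    have "wp (While (Less (Var ''u'') (Var ''total'')) ?b2) Q ?s1 (t1 + 9)"
    proof (rule wp_While_frameI[where I = "init_inv (p + n) ?T2" and K = ?T2])
      show "init_inv (p + n) ?T2 ?s1 (t1 + 9)" unfolding init_inv_def using tot by simp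
    next
      fix s2 t2 assume "init_inv (p + n) ?T2 s2 t2"
      then show "t2 \<le> ?T2" unfolding init_inv_def by simp
    next
      fix s2 t2 assume I2: "init_inv (p + n) ?T2 s2 t2" and c2: "bval (Less (Var ''u'') (Var ''total'')) s2"
      obtain u where u: "s2 ''u'' 0 = u" by blast
      have up: "u < p + n" using I2 c2 u unfolding init_inv_def by simp
      then have "p + n - u = Suc (p + n - Suc u)" by simp
      then show "wp ?b2 (init_inv (p + n) ?T2) s2 (t2 + (1 + bcost (Less (Var ''u'') (Var ''total''))))"
        using I2 u up by (simp add: wp_simps init_inv_def less_Suc_eq)
    next
      fix s2 t2 assume I2: "init_inv (p + n) ?T2 s2 t2" and c2: "\<not> bval (Less (Var ''u'') (Var ''total'')) s2"
        and fr2: "\<forall>x. x \<notin> mods ?b2 \<longrightarrow> s2 x = ?s1 x"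
      have u: "s2 ''u'' 0 = p + n" "s2 ''total'' 0 = p + n" "t2 + 10 \<le> ?T2"
        "\<forall>x<p + n. s2 ''mate'' x = x \<and> s2 ''cov'' x = 1"
        using I2 c2 unfolding init_inv_def by simp_all
      show "Q s2 (t2 + (1 + bcost (Less (Var ''u'') (Var ''total''))))"
      proof (rule Q)
        show "\<forall>v. v \<notin> {''total'', ''u'', ''mate'', ''cov''} \<longrightarrow> s2 v = s v"
        proof (intro allI impI)
          fix v assume v: "v \<notin> {''total'', ''u'', ''mate'', ''cov''}"
          then have "s2 v = ?s1 v" using fr2 by simp
          also have "\<dots> = s v" using v f1 by simp
          finally show "s2 v = s v" .
        qed
      qed (use u t1 in simp_all)
    qed
    then show "?R s1 (t1 + (1 + bcost (Less (Var ''u'') (Var ''n''))))"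
      by (simp add: wp_Assign eval_nat_numeral)
  qed
  then show ?thesis unfolding setup_vertices_def using pn
    by (simp add: wp_Seq_fun wp_Assign eval_nat_numeral)
qed

definition DM_augment :: com where
  "DM_augment = setup_vertices ;; setup_arcs ;; phases"

lemma tame_DM_augment: "tame DM_augment"
  unfolding DM_augment_def setup_vertices_def setup_arcs_def arc_step_def phases_def
    phase_independent_def phase_maximum_def phase_pair_def pair_step_def emit_def augment_def probe_def
    search_def search_step_def flip_def flip_step_def phase_unbalanced_def phase_chain_def chain_step_def
    chain_commit_def phase_rest_def rest_step_def phase_close_def
  by simp

lemma DM_augment_correct:
  assumes G: "bipartite_graph G" "numbered G" and le: "card (vplus G) \<le> card (vminus G)"
    and es: "distinct es" "set es = edges G"
  defines "p \<equiv> card (vplus G)" and "n \<equiv> card (vminus G)" and "m \<equiv> card (edges G)"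
  shows "\<exists>t s. run DM_augment (input_state G es) t s \<and> min_DM_augmentation G (output_edges s) \<and>
    t \<le> 7000 * (m + 1) * (p + n + 1)"
proof -
  let ?s = "input_state G es"
  have V: "vplus G = {..<p}" "vminus G = {p..<p + n}"
    using G(2) unfolding numbered_def p_def n_def by auto
  have m: "length es = m" using distinct_card[OF es(1)] es(2) unfolding m_def by simp
  have E: "edges G \<subseteq> {..<p} \<times> {p..<p + n}" using G(1) V unfolding bipartite_graph_def by auto
  have esi: "fst (es ! i) < p" "p \<le> snd (es ! i)" "snd (es ! i) < p + n" if "i < m" for i
  proof -
    have "es ! i \<in> edges G" using that m es(2) nth_mem by metis
    then have "es ! i \<in> {..<p} \<times> {p..<p + n}" using E by blast
    then show "fst (es ! i) < p" "p \<le> snd (es ! i)" "snd (es ! i) < p + n"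
      by (auto simp: mem_Times_iff)
  qed
  have in0: "?s ''p'' 0 = p" "?s ''n'' 0 = n" "?s ''m'' 0 = m"
    "?s ''tail'' = (\<lambda>i. if i < length es then fst (es ! i) else 0)"
    "?s ''head'' = (\<lambda>i. if i < length es then snd (es ! i) else 0)"
    "?s ''first'' = (\<lambda>_. 0)" "?s ''seen'' = (\<lambda>_. 0)" "?s ''stamp'' = (\<lambda>_. 0)"
    "?s ''ind'' = (\<lambda>_. 0)" "?s ''F_size'' = (\<lambda>_. 0)"
    unfolding input_state_def p_def n_def using m by simp_all
  let ?T = "40 * n + 40 * (p + n) + 100 + (100 * m + 40) + 6000 * (m + 1) * (p + n + 1)"
  have "wp setup_vertices (wp setup_arcs (wp phases (\<lambda>s' t'. min_DM_augmentation G (output_edges s') \<and> t' \<le> ?T))) ?s 0"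
  proof (rule setup_vertices_correct[where p = p and n = n])
    show "?s ''p'' 0 = p" "?s ''n'' 0 = n" by (rule in0)+
  next
    fix s1 t1 assume fr1: "\<forall>v. v \<notin> {''total'', ''u'', ''mate'', ''cov''} \<longrightarrow> s1 v = ?s v"
      and tot: "s1 ''total'' 0 = p + n"
      and ini: "\<And>x. x < p + n \<Longrightarrow> s1 ''mate'' x = x \<and> s1 ''cov'' x = 1"
      and t1: "t1 \<le> 0 + 40 * n + 40 * (p + n) + 100"
    have f1: "s1 ''p'' 0 = p" "s1 ''n'' 0 = n" "s1 ''m'' 0 = m"
      "s1 ''tail'' = (\<lambda>i. if i < length es then fst (es ! i) else 0)"
      "s1 ''head'' = (\<lambda>i. if i < length es then snd (es ! i) else 0)"
      "s1 ''first'' = (\<lambda>_. 0)" "s1 ''seen'' = (\<lambda>_. 0)" "s1 ''stamp'' = (\<lambda>_. 0)"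
      "s1 ''ind'' = (\<lambda>_. 0)" "s1 ''F_size'' = (\<lambda>_. 0)"
      using fr1 in0 by simp_all
    show "wp setup_arcs (wp phases (\<lambda>s' t'. min_DM_augmentation G (output_edges s') \<and> t' \<le> ?T)) s1 t1"
    proof (rule setup_arcs_correct[where es = es])
      show "s1 ''m'' 0 = length es" using f1 m by simp
      show "s1 ''tail'' i = fst (es ! i) \<and> s1 ''head'' i = snd (es ! i)" if "i < length es" for i
        using that f1 by simp
      show "fst (es ! i) \<noteq> snd (es ! i)" if "i < length es" for i using esi[of i] that m by simp
      show "s1 ''first'' v = 0" for v using f1 by simp
      fix s2 t2 assume fr2: "\<forall>v. v \<notin> {''edge'', ''arc'', ''dst'', ''next'', ''first''} \<longrightarrow> s2 v = s1 v"
        and lk: "\<And>v. linked (s2 ''next'') (s2 ''first'' v) (arcs es (length es) v)"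
        and dst: "\<And>i. i < length es \<Longrightarrow> s2 ''dst'' (2 * i + 1) = snd (es ! i) \<and> s2 ''dst'' (2 * i + 2) = fst (es ! i)"
        and t2: "t2 \<le> t1 + 100 * length es + 40"
      let ?AL = "arcs es (length es)" and ?d = "s2 ''dst''"
      have f2: "s2 ''p'' 0 = p" "s2 ''n'' 0 = n" "s2 ''total'' 0 = p + n" "s2 ''seen'' = (\<lambda>_. 0)"
        "s2 ''stamp'' = (\<lambda>_. 0)" "s2 ''ind'' = (\<lambda>_. 0)" "s2 ''F_size'' = (\<lambda>_. 0)"
        "s2 ''mate'' = s1 ''mate''" "s2 ''cov'' = s1 ''cov''"
        using fr2 f1 tot by simp_all
      have img: "?d ` set (?AL v) = {y. (v, y) \<in> edges G \<or> (y, v) \<in> edges G}" for v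
      proof (intro equalityI subsetI)
        fix y assume "y \<in> ?d ` set (?AL v)"
        then obtain a where a: "a \<in> set (?AL v)" "y = ?d a" by blast
        then obtain i where i: "i < length es" "a = 2 * i + 1 \<and> v = fst (es ! i) \<or> a = 2 * i + 2 \<and> v = snd (es ! i)"
          unfolding set_arcs by blast
        have "(fst (es ! i), snd (es ! i)) \<in> edges G" using i(1) es(2) nth_mem by fastforce
        then show "y \<in> {y. (v, y) \<in> edges G \<or> (y, v) \<in> edges G}" using i(2) dst[OF i(1)] a(2) by auto
      next
        fix y assume "y \<in> {y. (v, y) \<in> edges G \<or> (y, v) \<in> edges G}"
        then consider "(v, y) \<in> set es" | "(y, v) \<in> set es" using es(2) by blast
        then show "y \<in> ?d ` set (?AL v)"
        proof cases
          case 1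
          then obtain i where i: "i < length es" "es ! i = (v, y)" by (auto simp: in_set_conv_nth)
          then have "2 * i + 1 \<in> set (?AL v)" unfolding set_arcs by auto
          moreover have "y = ?d (2 * i + 1)" using dst[OF i(1)] i(2) by simp
          ultimately show ?thesis by blast
        next
          case 2
          then obtain i where i: "i < length es" "es ! i = (y, v)" by (auto simp: in_set_conv_nth)
          then have "2 * i + 2 \<in> set (?AL v)" unfolding set_arcs by auto
          moreover have "y = ?d (2 * i + 2)" using dst[OF i(1)] i(2) by simp
          ultimately show ?thesis by blast
        qed
      qed
      interpret graph_mem p n m "s2 ''first''" "s2 ''next''" ?d ?AL
      proof
        show "linked (s2 ''next'') (s2 ''first'' v) (?AL v)" for v by (rule lk)
        show "?d a < p + n \<and> v \<in> ?d ` set (?AL (?d a)) \<and> (?d a < p \<longleftrightarrow> \<not> v < p)"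
          if "a \<in> set (?AL v)" for v a
        proof -
          have "?d a \<in> {y. (v, y) \<in> edges G \<or> (y, v) \<in> edges G}" using img[of v] that by blast
          then show ?thesis unfolding img using E by auto
        qed
        have "(\<Sum>v<p + n. length (?AL v)) = 2 * length es"
          by (rule sum_length_arcs) (use esi m in \<open>force\<close>)
        then show "(\<Sum>v<p + n. length (?AL v)) \<le> 2 * m" using m by simp
      qed
      show "wp phases (\<lambda>s' t'. min_DM_augmentation G (output_edges s') \<and> t' \<le> ?T) s2 t2"
      proof (rule phases_correct)
        show "base s2" unfolding base_def using f2 by simp
        show "p \<le> n" using le unfolding p_def n_def .
        fix s' t' assume good: "good_output (output_edges s')" and t': "t' \<le> t2 + 6000 * (m + 1) * (p + n + 1)"
        have "min_DM_augmentation G (output_edges s')"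
        proof (rule good_output_minimum[OF G(1) V _ _ good])
          show "p \<le> n" using le unfolding p_def n_def .
          show "N v = {y. (v, y) \<in> edges G \<or> (y, v) \<in> edges G}" for v unfolding N_def by (rule img)
        qed
        then show "min_DM_augmentation G (output_edges s') \<and> t' \<le> ?T" using t' t1 t2 m by linarith
      qed (use f2 ini in simp_all)
    qed
  qed
  then obtain t s where "run DM_augment ?s t s" "min_DM_augmentation G (output_edges s)" "t \<le> ?T"
    unfolding DM_augment_def wp_Seq_fun[symmetric] by (auto simp: wp_def)
  moreover have "?T \<le> 7000 * (m + 1) * (p + n + 1)"
  proof -
    define q where "q = (m + 1) * (p + n + 1)"
    have "p + n + 1 \<le> q" "m + 1 \<le> q" unfolding q_def by simp_all
    moreover have "6000 * (m + 1) * (p + n + 1) = 6000 * q" "7000 * (m + 1) * (p + n + 1) = 7000 * q"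
      unfolding q_def by (simp_all only: mult.assoc)
    ultimately show ?thesis by simp
  qed
  ultimately show ?thesis by (meson le_trans)
qed

text \<open>The origin of the final constant: \<open>m + 1\<close> is at most twice and
  \<open>p + n + 1\<close> at most three times the corresponding maximum, and
  \<open>7000 * 2 * 3 = 42000\<close>. The maxima keep the bound positive for graphs without edges
  or vertices.\<close>

lemma time_le_product:
  fixes p n m :: nat
  assumes "p \<le> n"
  shows "7000 * (m + 1) * (p + n + 1) \<le> 42000 * (max 1 n * max 1 m)"
proof -
  have "m + 1 \<le> 2 * max 1 m" "p + n + 1 \<le> 3 * max 1 n" using assms by auto
  then have "(m + 1) * (p + n + 1) \<le> (2 * max 1 m) * (3 * max 1 n)" by (rule mult_le_mono)
  then have "7000 * ((m + 1) * (p + n + 1)) \<le> 7000 * ((2 * max 1 m) * (3 * max 1 n))" by (rule mult_le_mono2)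
  then show ?thesis by (simp only: mult.assoc mult.left_commute mult.commute)
qed

text \<open>The exponent 20 is \<open>18 + 2\<close>: the constant is absorbed by
  \<open>2 ^ 18\<close>, the base being at least 2, and two more factors bound the product. The left
  side is the largest input value plus the running time.\<close>

lemma word_size_suffices:
  fixes n m :: nat
  shows "2 * n + m + 42000 * (max 1 n * max 1 m) \<le> (n + m + 2) ^ 20"
proof -
  define q where "q = n + m + 2"
  have "max 1 n \<le> q" "max 1 m \<le> q" unfolding q_def by auto
  then have "max 1 n * max 1 m \<le> q * q" by (rule mult_le_mono)
  moreover have "2 * n + m \<le> 2 * q" unfolding q_def by simp
  moreover have "2 * q \<le> q * q" unfolding q_def by simp
  ultimately have 1: "2 * n + m + 42000 * (max 1 n * max 1 m) \<le> 42001 * (q * q)" by linarith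
  have "(42001 :: nat) \<le> 2 ^ 18" by simp
  also have "\<dots> \<le> q ^ 18" unfolding q_def by (rule power_mono) simp_all
  finally have "42001 * (q * q) \<le> q ^ 18 * (q * q)" by (rule mult_le_mono1)
  also have "\<dots> = q ^ 20" by (simp add: eval_nat_numeral)
  finally show ?thesis using 1 unfolding q_def by simp
qed

theorem theorem1p4:
  shows "\<exists>(prog :: com) (C :: nat) (d :: nat).
    \<forall>(G :: nat bigraph) (es :: (nat \<times> nat) list) (n :: nat) (m :: nat).
      bipartite_graph G \<and> numbered G \<and>
      card (vplus G) \<le> card (vminus G) \<and> card (vminus G) = n \<and> card (edges G) = m \<and>
      distinct es \<and> set es = edges G \<longrightarrow>
      (\<exists>t s. exec ((n + m + 2) ^ d) prog (input_state G es) t s \<and>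
             t \<le> C * (max 1 n * max 1 m) \<and>
             min_DM_augmentation G (output_edges s))"
proof (rule exI[of _ DM_augment], rule exI[of _ 42000], rule exI[of _ 20], intro allI impI, elim conjE)
  fix G :: "nat bigraph" and es :: "(nat \<times> nat) list" and n m :: nat
  assume G: "bipartite_graph G" "numbered G" and le: "card (vplus G) \<le> card (vminus G)"
    and n: "card (vminus G) = n" and m: "card (edges G) = m" and es: "distinct es" "set es = edges G"
  obtain t s where run: "run DM_augment (input_state G es) t s" and min: "min_DM_augmentation G (output_edges s)"
    and t: "t \<le> 7000 * (m + 1) * (card (vplus G) + n + 1)"
    using DM_augment_correct[OF G le es] n m by auto
  have t': "t \<le> 42000 * (max 1 n * max 1 m)" using t time_le_product[of "card (vplus G)" n m] le n by linarith
  \<comment> \<open>The initial bound for \<open>run_exec\<close>: vertex names are below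
    \<open>p + n\<close>, hence at most \<open>2 * n\<close>, and the number of edges is
    \<open>m\<close>.\<close>
  have "\<forall>x i. input_state G es x i \<le> 2 * n + m"
  proof (intro allI)
    fix x i
    have len: "length es = m" using distinct_card[OF es(1)] es(2) m by simp
    have mem: "fst (es ! i) \<le> 2 * n \<and> snd (es ! i) \<le> 2 * n" if "i < length es" for i
    proof -
      have "es ! i \<in> edges G" using that es(2) nth_mem by metis
      then have "es ! i \<in> vplus G \<times> vminus G" using G(1) unfolding bipartite_graph_def by blast
      then have "es ! i \<in> {0..<card (vplus G)} \<times> {card (vplus G)..<card (vplus G) + n}"
        using G(2) n unfolding numbered_def by metis
      then show ?thesis using le n by (auto simp: mem_Times_iff)
    qed
    have "fst (es ! i) \<le> 2 * n + m" "snd (es ! i) \<le> 2 * n + m" if "i < length es"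
      using mem[OF that] by linarith+
    then show "input_state G es x i \<le> 2 * n + m"
      using le n len unfolding input_state_def by simp
  qed
  from run_exec[OF run tame_DM_augment this, of "(n + m + 2) ^ 20"]
  have "exec ((n + m + 2) ^ 20) DM_augment (input_state G es) t s"
    using word_size_suffices[of n m] t' by linarith
  with t' min show "\<exists>t s. exec ((n + m + 2) ^ 20) DM_augment (input_state G es) t s \<and>
      t \<le> 42000 * (max 1 n * max 1 m) \<and> min_DM_augmentation G (output_edges s)" by blast
qed

end
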